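(* Let $d\ge2$ and let $\sigma:\mathbb{R}^d\to\mathbb{R}$ be a bounded, almost everywhere continuous function with compact support such that $\int_{\mathbb{R}^d}\sigma(x)\,dx<0$. Let $\{\xi_n\}_{n\ge1}$ be a decreasing sequence of positive numbers with $\xi_n\searrow0$, and for each $n$ let $\sigma_n:\xi_n\mathbb{Z}^d\to\mathbb{R}$ be $\sigma_n(x):=\xi_n^{-d}\int_{x+[-\xi_n/2,\xi_n/2]^d}\sigma(y)\,dy$. Assume $R>0$ is such that $\operatorname{supp}\sigma\subset B(0,R)$ and $\operatorname{supp}\sigma_n\subset B(0,R)$ for all $n$. Then, in the sense of distributions on $\mathbb{R}^d$, $$\operatorname{GDS}_R^{\xi_n}(\sigma_n)\to\operatorname{Bal}_R(\sigma,0)\quad\text{as }n\to\infty.$$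
   Context: Discrete setting on $\xi\mathbb{Z}^d$: $y'\sim y$ means $y'$ is one of the $2d$ lattice neighbours of $y$; $\Delta f(y)=\frac{1}{2d\xi^2}\sum_{y'\sim y}(f(y')-f(y))$; toppling at $x$ is $T_x\eta(y):=\eta(y)+\eta_+(x)\xi^2\Delta\delta_x(y)$ (remove the positive mass at $x$ and distribute it equally to the $2d$ neighbours). For a bounded finitely supported $\tau:\xi\mathbb{Z}^d\to\mathbb{R}$ with $\operatorname{supp}\tau\subset\hat B_R:=B(0,R)\cap\xi\mathbb{Z}^d$, take any sequence of points of $\hat B_R$ in which each point of $\hat B_R$ occurs infinitely often and topple successively at these points; the resulting configurations converge pointwise to a limit configuration, independent of the chosen sequence, called $\operatorname{GDS}^\xi_R(\tau)$. It is identified with the signed measure $\xi^d\sum_{x\in\xi\mathbb{Z}^d}\operatorname{GDS}^\xi_R(\tau)(x)\,\delta_x$ on $\mathbb{R}^d$ ($\delta_x$ the Dirac measure). Continuous setting: for a compactly supported signed Radon measure $\sigma$ on $\mathbb{R}^d$, $U^\sigma$ denotes its Newtonian potential normalized so that $-\Delta U^\sigma=2d\,\sigma$ in the sense of distributions. Let $V^{\sigma,R}$ be the largest element of $\{V\in\mathcal{D}'(\mathbb{R}^d): V\le U^\sigma \text{ in }\mathbb{R}^d,\ \Delta V\ge0\text{ in }B(0,R)\}$ (which exists). The partial balayage is $\operatorname{Bal}_R(\sigma,0):=-\frac{1}{2d}\Delta V^{\sigma,R}$, a signed Radon measure. Here $\sigma$ is identified with the measure $\sigma(x)\,dx$. 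*)

theory Defs
  imports "HOL-Analysis.Analysis"
begin

text \<open>Lattice points of xi Z^d are indexed by integer vectors k; the point is xi * k.\<close>

definition lpt :: "real \<Rightarrow> int ^ 'n \<Rightarrow> real ^ 'n" where
  "lpt \<xi> k = \<xi> *\<^sub>R (\<chi> i. real_of_int (k $ i))"

definition nbrs :: "int ^ 'n \<Rightarrow> (int ^ 'n) set" where
  "nbrs k = (\<lambda>i. k + axis i 1) ` UNIV \<union> (\<lambda>i. k - axis i 1) ` UNIV"

definition disc_lap :: "real \<Rightarrow> (int ^ 'n \<Rightarrow> real) \<Rightarrow> int ^ 'n \<Rightarrow> real" where
  "disc_lap \<xi> f k = 1 / (2 * real CARD('n) * \<xi>\<^sup>2) * (\<Sum>k'\<in>nbrs k. f k' - f k)"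

definition topple :: "real \<Rightarrow> int ^ 'n \<Rightarrow> (int ^ 'n \<Rightarrow> real) \<Rightarrow> int ^ 'n \<Rightarrow> real" where
  "topple \<xi> x \<eta> = (\<lambda>y. \<eta> y + max (\<eta> x) 0 * \<xi>\<^sup>2 *
       disc_lap \<xi> (\<lambda>z. if z = x then 1 else 0) y)"

primrec topple_iter :: "real \<Rightarrow> (nat \<Rightarrow> int ^ 'n) \<Rightarrow> (int ^ 'n \<Rightarrow> real) \<Rightarrow> nat \<Rightarrow> int ^ 'n \<Rightarrow> real" where
  "topple_iter \<xi> s \<tau> 0 = \<tau>"
| "topple_iter \<xi> s \<tau> (Suc m) = topple \<xi> (s m) (topple_iter \<xi> s \<tau> m)"

definition lat_ball :: "real \<Rightarrow> real \<Rightarrow> (int ^ 'n) set" where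
  "lat_ball \<xi> R = {k. norm (lpt \<xi> k) < R}"

definition admissible_seq :: "real \<Rightarrow> real \<Rightarrow> (nat \<Rightarrow> int ^ 'n) \<Rightarrow> bool" where
  "admissible_seq \<xi> R s \<longleftrightarrow> range s \<subseteq> lat_ball \<xi> R \<and>
      (\<forall>p\<in>lat_ball \<xi> R. infinite {m. s m = p})"

definition GDS :: "real \<Rightarrow> real \<Rightarrow> (int ^ 'n \<Rightarrow> real) \<Rightarrow> int ^ 'n \<Rightarrow> real" where
  "GDS \<xi> R \<tau> = (THE \<eta>. \<forall>s. admissible_seq \<xi> R s \<longrightarrow>
        (\<forall>y. (\<lambda>m. topple_iter \<xi> s \<tau> m y) \<longlonglongrightarrow> \<eta> y))"

definition pd :: "'n \<Rightarrow> (real ^ 'n \<Rightarrow> real) \<Rightarrow> real ^ 'n \<Rightarrow> real" where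
  "pd i f x = frechet_derivative f (at x) (axis i 1)"

fun iterpd :: "'n list \<Rightarrow> (real ^ 'n \<Rightarrow> real) \<Rightarrow> real ^ 'n \<Rightarrow> real" where
  "iterpd [] f = f"
| "iterpd (i # is) f = pd i (iterpd is f)"

definition smooth :: "(real ^ 'n \<Rightarrow> real) \<Rightarrow> bool" where
  "smooth f \<longleftrightarrow> (\<forall>is x. iterpd is f differentiable (at x))"

definition test_fun :: "(real ^ 'n \<Rightarrow> real) \<Rightarrow> bool" where
  "test_fun \<phi> \<longleftrightarrow> smooth \<phi> \<and> compact (closure {x. \<phi> x \<noteq> 0})"

definition lap :: "(real ^ 'n \<Rightarrow> real) \<Rightarrow> real ^ 'n \<Rightarrow> real" where
  "lap \<phi> x = (\<Sum>i\<in>UNIV. iterpd [i, i] \<phi> x)"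

definition is_distribution :: "((real ^ 'n \<Rightarrow> real) \<Rightarrow> real) \<Rightarrow> bool" where
  "is_distribution T \<longleftrightarrow>
     (\<forall>\<phi>. \<not> test_fun \<phi> \<longrightarrow> T \<phi> = 0) \<and>
     (\<forall>\<phi> \<psi> a b. test_fun \<phi> \<and> test_fun \<psi> \<longrightarrow>
         T (\<lambda>x. a * \<phi> x + b * \<psi> x) = a * T \<phi> + b * T \<psi>) \<and>
     (\<forall>K. compact K \<longrightarrow> (\<exists>C N. \<forall>\<phi>. test_fun \<phi> \<and> closure {x. \<phi> x \<noteq> 0} \<subseteq> K \<longrightarrow>
         \<bar>T \<phi>\<bar> \<le> C * (\<Sum>is\<in>{is. length is \<le> N}. (SUP x. \<bar>iterpd is \<phi> x\<bar>))))"

definition dist_le :: "((real ^ 'n \<Rightarrow> real) \<Rightarrow> real) \<Rightarrow> ((real ^ 'n \<Rightarrow> real) \<Rightarrow> real) \<Rightarrow> bool" where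
  "dist_le S T \<longleftrightarrow> (\<forall>\<phi>. test_fun \<phi> \<and> (\<forall>x. \<phi> x \<ge> 0) \<longrightarrow> S \<phi> \<le> T \<phi>)"

definition fdist :: "(real ^ 'n \<Rightarrow> real) \<Rightarrow> (real ^ 'n \<Rightarrow> real) \<Rightarrow> real" where
  "fdist f \<phi> = (if test_fun \<phi> then (LINT x|lebesgue. f x * \<phi> x) else 0)"

definition dist_tendsto :: "(nat \<Rightarrow> (real ^ 'n \<Rightarrow> real) \<Rightarrow> real) \<Rightarrow> ((real ^ 'n \<Rightarrow> real) \<Rightarrow> real) \<Rightarrow> bool" where
  "dist_tendsto Ts T \<longleftrightarrow> (\<forall>\<phi>. test_fun \<phi> \<longrightarrow> (\<lambda>n. Ts n \<phi>) \<longlonglongrightarrow> T \<phi>)"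

definition lattice_dist :: "real \<Rightarrow> (int ^ 'n \<Rightarrow> real) \<Rightarrow> (real ^ 'n \<Rightarrow> real) \<Rightarrow> real" where
  "lattice_dist \<xi> \<eta> \<phi> = (if test_fun \<phi> then
      \<xi> ^ CARD('n) * (\<Sum>k | \<eta> k \<noteq> 0. \<eta> k * \<phi> (lpt \<xi> k)) else 0)"

text \<open>Fundamental solution G with -Delta G = delta_0 (d = 2: -(1/2pi) log|z|;
  d >= 3: |z|^(2-d) / ((d-2) * surface area of unit sphere)).\<close>
definition newton_kernel :: "real ^ 'n \<Rightarrow> real" where
  "newton_kernel z = (if CARD('n) = 2 then - ln (norm z) / (2 * pi)
     else norm z powr (2 - real CARD('n)) /
          ((real CARD('n) - 2) * real CARD('n) * measure lborel (ball (0::real ^ 'n) 1)))"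

text \<open>Newtonian potential of sigma(x)dx, normalised so that -Delta U = 2d sigma.\<close>
definition newton_pot :: "(real ^ 'n \<Rightarrow> real) \<Rightarrow> real ^ 'n \<Rightarrow> real" where
  "newton_pot \<sigma> x = 2 * real CARD('n) * (LINT y|lebesgue. newton_kernel (x - y) * \<sigma> y)"

definition Vset :: "(real ^ 'n \<Rightarrow> real) \<Rightarrow> real \<Rightarrow> ((real ^ 'n \<Rightarrow> real) \<Rightarrow> real) set" where
  "Vset \<sigma> R = {V. is_distribution V \<and> dist_le V (fdist (newton_pot \<sigma>)) \<and>
      (\<forall>\<phi>. test_fun \<phi> \<and> (\<forall>x. \<phi> x \<ge> 0) \<and> closure {x. \<phi> x \<noteq> 0} \<subseteq> ball 0 R
             \<longrightarrow> V (lap \<phi>) \<ge> 0)}"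

definition Vmax :: "(real ^ 'n \<Rightarrow> real) \<Rightarrow> real \<Rightarrow> (real ^ 'n \<Rightarrow> real) \<Rightarrow> real" where
  "Vmax \<sigma> R = (THE V. V \<in> Vset \<sigma> R \<and> (\<forall>W\<in>Vset \<sigma> R. dist_le W V))"

definition Bal :: "real \<Rightarrow> (real ^ 'n \<Rightarrow> real) \<Rightarrow> (real ^ 'n \<Rightarrow> real) \<Rightarrow> real" where
  "Bal R \<sigma> \<phi> = (if test_fun \<phi> then - (1 / (2 * real CARD('n))) * Vmax \<sigma> R (lap \<phi>) else 0)"

definition cell_avg :: "(real ^ 'n \<Rightarrow> real) \<Rightarrow> real \<Rightarrow> int ^ 'n \<Rightarrow> real" where
  "cell_avg \<sigma> \<xi> k = \<xi> powr (- real CARD('n)) *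
     (LINT y:cbox (lpt \<xi> k - (\<xi> / 2) *\<^sub>R One) (lpt \<xi> k + (\<xi> / 2) *\<^sub>R One)|lebesgue. \<sigma> y)"

end

theory Submission
  imports Defs
begin

text \<open>
  Write \<open>GDS = \<sigma>\<^sub>n + \<Delta> u\<^sub>n\<close>, where the odometer \<open>u\<^sub>n\<close> is the least nonnegative lattice function with
  \<open>\<sigma>\<^sub>n + \<Delta> u\<^sub>n \<le> 0\<close> on the lattice ball. The quadratic barrier \<open>C ((R + \<xi>)\<^sup>2 - |x|\<^sup>2)\<close> bounds \<open>u\<^sub>n\<close>
  uniformly, so the measures \<open>\<xi>\<^sup>d \<Sum> u\<^sub>n \<delta>\<close> have cluster points \<open>D\<close>, and \<open>U - D\<close> is admissible in the
  obstacle problem defining the balayage.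

  Conversely, if \<open>W\<close> is admissible then \<open>D = U - W\<close> is a positive functional, and its mollification
  \<open>w(k) = D(\<rho>(\<cdot> - \<xi> k))\<close> is almost a discrete supersolution for \<open>\<sigma>\<^sub>n\<close> in a slightly smaller ball. The
  consistency error is absorbed by a quadratic, the boundary shell by the barrier, and the
  difference between \<open>\<sigma>\<^sub>n\<close> and the mollified density by another odometer, which is small in \<open>L\<^sup>1\<close>
  because \<open>\<sigma>\<close> is almost everywhere continuous. Minimality of \<open>u\<^sub>n\<close> then shows that every limit of
  \<open>u\<^sub>n\<close> lies below \<open>U - W\<close>. Hence all cluster points coincide, and \<open>U - D\<close> is the largest
  admissible distribution.
\<close>


section \<open>Toppling and the odometer\<close>

text \<open>\<open>Vmax\<close> is a definite description over an abstract set of distributions, so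
  both the existence of a largest element and its uniqueness have to come out of the proof; the
  limit of the discrete odometers supplies the witness. A competitor \<open>W\<close> has no
  pointwise values, and its condition \<open>\<Delta> W \<ge> 0\<close> can only be tested with
  functions supported in the ball. Hence the lattice function sampled from \<open>D = U - W\<close>
  obeys its inequality only at distance \<open>r\<close> from the boundary. What lets estimates pass
  through \<open>D\<close> is positivity: a pointwise error of size \<open>\<epsilon>\<close> on a
  fixed ball costs at most \<open>\<epsilon> * D \<theta>\<close> for a cutoff
  \<open>\<theta>\<close>, so no regularity of \<open>D\<close> enters. Cluster points are taken
  along filters, because the product space indexed by all test functions is compact but need not be
  sequentially compact. The two limits are ordered: for a fixed mollifier the mesh tends to zero,
  and only the choice of mollifier makes the remaining error small. On the continuous side the main
  fact is \<open>- \<Delta> U = 2 d \<sigma>\<close>, obtained from a truncated kernel whose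
  Laplacian is a multiple of a ball's indicator.\<close>

lemma sum_nbrs:
  fixes k :: "int ^ 'n" and g :: "int ^ 'n \<Rightarrow> real"
  shows "sum g (nbrs k) = (\<Sum>i\<in>UNIV. g (k + axis i 1) + g (k - axis i 1))"
proof -
  have inj1: "inj (\<lambda>i. k + axis i 1)" and inj2: "inj (\<lambda>i. k - axis i 1)"
    by (auto simp: inj_on_def axis_eq_axis)
  have disj: "(\<lambda>i. k + axis i 1) ` UNIV \<inter> (\<lambda>i. k - axis i 1) ` UNIV = {}"
  proof -
    have "k + axis i 1 \<noteq> k - axis j 1" for i j
    proof
      assume "k + axis i 1 = k - axis j 1"
      then have "axis i 1 + axis j (1::int) = 0" by (simp add: algebra_simps)
      then have "(axis i 1 + axis j (1::int)) $ i = 0" by simp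
      then show False by (auto simp: axis_def split: if_splits)
    qed
    then show ?thesis by blast
  qed
  show ?thesis
    unfolding nbrs_def using disj inj1 inj2
    by (simp add: sum.union_disjoint sum.reindex sum.distrib)
qed

lemma card_nbrs: "card (nbrs (k :: int ^ 'n)) = 2 * CARD('n)"
proof -
  have "real (card (nbrs k)) = (\<Sum>k'\<in>nbrs k. 1::real)" by simp
  also have "\<dots> = real (2 * CARD('n))" by (simp only: sum_nbrs) simp
  finally show ?thesis by (simp only: of_nat_eq_iff)
qed

lemma finite_nbrs [simp]: "finite (nbrs k)"
  by (simp add: nbrs_def)

lemma nbrs_irrefl [simp]: "k \<notin> nbrs k"
proof -
  have "axis i (1::int) \<noteq> 0" for i :: 'a by (simp add: axis_eq_0_iff)
  then show ?thesis by (auto simp: nbrs_def)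
qed

lemma nbrs_sym: "k' \<in> nbrs k \<longleftrightarrow> k \<in> nbrs k'"
proof -
  have *: "k' \<in> nbrs k \<Longrightarrow> k \<in> nbrs k'" for k k' :: "int ^ 'a"
    unfolding nbrs_def by (auto simp: image_iff)
  show ?thesis using * by blast
qed

lemma disc_lap_eq:
  fixes k :: "int ^ 'n"
  shows "disc_lap \<xi> f k =
    1 / (2 * real CARD('n) * \<xi>\<^sup>2) * (sum f (nbrs k) - 2 * real CARD('n) * f k)"
  by (simp add: disc_lap_def sum_subtractf card_nbrs)

lemma disc_lap_axis:
  fixes k :: "int ^ 'n"
  shows "disc_lap \<xi> f k = 1 / (2 * real CARD('n) * \<xi>\<^sup>2) *
     (\<Sum>i\<in>UNIV. f (k + axis i 1) + f (k - axis i 1) - 2 * f k)"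
  by (simp add: disc_lap_def sum_nbrs algebra_simps)

lemma disc_lap_add: "disc_lap \<xi> (\<lambda>k. f k + g k) k = disc_lap \<xi> f k + disc_lap \<xi> g k"
proof -
  have "a * ((S + T) - b * (x + y)) = a * (S - b * x) + a * (T - b * y)" for a b x y S T :: real
    by (simp add: algebra_simps)
  then show ?thesis by (simp only: disc_lap_eq sum.distrib)
qed

lemma disc_lap_cmult: "disc_lap \<xi> (\<lambda>k. c * f k) k = c * disc_lap \<xi> f k"
proof -
  have "a * (c * S - b * (c * x)) = c * (a * (S - b * x))" for a b x S :: real
    by (simp add: algebra_simps)
  then show ?thesis by (simp only: disc_lap_eq sum_distrib_left[symmetric])
qed

lemma disc_lap_const [simp]: "disc_lap \<xi> (\<lambda>k. c) k = 0"
  by (simp add: disc_lap_def)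

lemma disc_lap_mono_at:
  assumes "f k = g k" "\<And>k'. k' \<in> nbrs k \<Longrightarrow> f k' \<le> g k'"
  shows "disc_lap \<xi> f k \<le> disc_lap \<xi> g k"
  unfolding disc_lap_def using assms
  by (intro mult_left_mono sum_mono) auto

lemma disc_lap_cong_at:
  assumes "f k = g k" "\<And>k'. k' \<in> nbrs k \<Longrightarrow> f k' = g k'"
  shows "disc_lap \<xi> f k = disc_lap \<xi> g k"
  unfolding disc_lap_def using assms by (metis (mono_tags, lifting) sum.cong)

lemma disc_lap_delta:
  fixes x :: "int ^ 'n"
  assumes "\<xi> > 0"
  shows "disc_lap \<xi> (\<lambda>z. if z = x then 1 else 0) y =
    (if y = x then - 1 / \<xi>\<^sup>2 else if y \<in> nbrs x then 1 / (2 * real CARD('n) * \<xi>\<^sup>2) else 0)"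
proof -
  have "sum (\<lambda>z. if z = x then 1 else 0) (nbrs y) = (if x \<in> nbrs y then 1 else (0::real))"
    by simp
  then show ?thesis
    using assms by (auto simp: disc_lap_eq nbrs_sym[of x y])
qed

lemma disc_lap_upd:
  "disc_lap \<xi> (f(x := f x + c)) y = disc_lap \<xi> f y + c * disc_lap \<xi> (\<lambda>z. if z = x then 1 else 0) y"
proof -
  have "f(x := f x + c) = (\<lambda>z. f z + c * (if z = x then 1 else 0))" by auto
  then show ?thesis by (simp add: disc_lap_add disc_lap_cmult)
qed

section \<open>Finiteness of lattice balls and existence of admissible sequences\<close>

lemma finite_int_vec: "finite {k :: int ^ 'n. \<forall>i. k $ i \<in> {a..b}}"
proof -
  have "{k :: int ^ 'n. \<forall>i. k $ i \<in> {a..b}} \<subseteq> vec_lambda ` (PiE UNIV (\<lambda>_. {a..b}))"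
  proof
    fix k :: "int ^ 'n" assume "k \<in> {k. \<forall>i. k $ i \<in> {a..b}}"
    then have "vec_nth k \<in> PiE UNIV (\<lambda>_. {a..b})" by auto
    moreover have "k = vec_lambda (vec_nth k)" by simp
    ultimately show "k \<in> vec_lambda ` (PiE UNIV (\<lambda>_. {a..b}))" by blast
  qed
  then show ?thesis by (meson finite_PiE finite_atLeastAtMost_int finite_imageI finite_subset finite)
qed

lemma lpt_nth [simp]: "lpt \<xi> k $ i = \<xi> * real_of_int (k $ i)"
  by (simp add: lpt_def)

lemma finite_lat_ball:
  assumes "\<xi> > 0"
  shows "finite (lat_ball \<xi> R :: (int ^ 'n) set)"
proof -
  have "k $ i \<in> {- \<lceil>R / \<xi>\<rceil>..\<lceil>R / \<xi>\<rceil>}" if "k \<in> lat_ball \<xi> R" for k :: "int ^ 'n" and i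
  proof -
    have "\<bar>\<xi> * real_of_int (k $ i)\<bar> < R"
      using that component_le_norm_cart[of "lpt \<xi> k" i] by (simp add: lat_ball_def)
    then have "\<xi> * \<bar>real_of_int (k $ i)\<bar> < R" using assms by (simp add: abs_mult)
    then have "\<bar>real_of_int (k $ i)\<bar> < R / \<xi>" using assms by (simp add: field_simps)
    then have "\<bar>k $ i\<bar> \<le> \<lceil>R / \<xi>\<rceil>" by linarith
    then show ?thesis by auto
  qed
  then have "lat_ball \<xi> R \<subseteq> {k :: int ^ 'n. \<forall>i. k $ i \<in> {- \<lceil>R / \<xi>\<rceil>..\<lceil>R / \<xi>\<rceil>}}" by blast
  then show ?thesis using finite_int_vec finite_subset by blast
qed

lemma zero_in_lat_ball: "R > 0 \<Longrightarrow> 0 \<in> lat_ball \<xi> R"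
  by (simp add: lat_ball_def lpt_def zero_vec_def[symmetric])

text \<open>The first component of \<open>prod_decode\<close> takes every value infinitely often, so
  enumerating the finite ball through it revisits each point. Without at least one such sequence the
  description in \<open>GDS\<close> would be satisfied by every configuration.\<close>

lemma ex_admissible_seq:
  assumes "\<xi> > 0" "R > 0"
  shows "\<exists>s :: nat \<Rightarrow> int ^ 'n. admissible_seq \<xi> R s"
proof -
  let ?B = "lat_ball \<xi> R :: (int ^ 'n) set"
  have ne: "?B \<noteq> {}" using zero_in_lat_ball[OF assms(2)] by blast
  have c: "countable ?B" using finite_lat_ball[OF assms(1)] by (rule countable_finite)
  define s where "s m = from_nat_into ?B (fst (prod_decode m))" for m
  have "infinite {m. s m = p}" if p: "p \<in> ?B" for p
  proof -
    obtain j where j: "from_nat_into ?B j = p"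
      using p c by (metis from_nat_into_surj)
    have "(\<lambda>l. prod_encode (j, l)) ` UNIV \<subseteq> {m. s m = p}"
      by (auto simp: s_def j)
    moreover have "infinite (range (\<lambda>l. prod_encode (j, l)))"
      by (rule range_inj_infinite) (auto simp: inj_on_def)
    ultimately show ?thesis using infinite_super by blast
  qed
  moreover have "range s \<subseteq> ?B" using ne unfolding s_def by (blast intro: from_nat_into)
  ultimately show ?thesis unfolding admissible_seq_def by blast
qed

section \<open>Odometers and least supersolutions\<close>

primrec odo :: "real \<Rightarrow> (nat \<Rightarrow> int ^ 'n) \<Rightarrow> (int ^ 'n \<Rightarrow> real) \<Rightarrow> nat \<Rightarrow> int ^ 'n \<Rightarrow> real" where
  "odo \<xi> s \<tau> 0 = (\<lambda>_. 0)"
| "odo \<xi> s \<tau> (Suc m) = (odo \<xi> s \<tau> m)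
     (s m := odo \<xi> s \<tau> m (s m) + \<xi>\<^sup>2 * max (topple_iter \<xi> s \<tau> m (s m)) 0)"

text \<open>Each toppling adds the emitted positive mass times \<open>\<xi>\<^sup>2\<close> at one
  site, and its effect on the configuration is linear in that amount, so the whole history is
  summarised by one Laplacian.\<close>

lemma topple_iter_eq: "topple_iter \<xi> s \<tau> m y = \<tau> y + disc_lap \<xi> (odo \<xi> s \<tau> m) y"
  by (induction m arbitrary: y) (simp_all add: topple_def disc_lap_upd)

definition supersol :: "real \<Rightarrow> real \<Rightarrow> (int ^ 'n \<Rightarrow> real) \<Rightarrow> (int ^ 'n \<Rightarrow> real) \<Rightarrow> bool" where
  "supersol \<xi> R \<tau> h \<longleftrightarrow> (\<forall>k. 0 \<le> h k) \<and> (\<forall>k\<in>lat_ball \<xi> R. \<tau> k + disc_lap \<xi> h k \<le> 0)"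

text \<open>Minimality replaces the toppling sequence: the description mentions only
  \<open>\<tau>\<close> and the ball, which is what makes the limit the same for all
  sequences.\<close>

definition odometer :: "real \<Rightarrow> real \<Rightarrow> (int ^ 'n \<Rightarrow> real) \<Rightarrow> (int ^ 'n \<Rightarrow> real) \<Rightarrow> bool" where
  "odometer \<xi> R \<tau> u \<longleftrightarrow> supersol \<xi> R \<tau> u \<and> (\<forall>k. k \<notin> lat_ball \<xi> R \<longrightarrow> u k = 0) \<and>
     (\<forall>h. supersol \<xi> R \<tau> h \<longrightarrow> (\<forall>k. u k \<le> h k))"

lemma odometer_unique: "odometer \<xi> R \<tau> u \<Longrightarrow> odometer \<xi> R \<tau> v \<Longrightarrow> u = v"
  unfolding odometer_def by (intro ext antisym) auto

lemma odo_le_Suc: "odo \<xi> s \<tau> m k \<le> odo \<xi> s \<tau> (Suc m) k"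
  by simp

lemma odo_nonneg: "0 \<le> odo \<xi> s \<tau> m k"
  by (induction m arbitrary: k) (auto intro: add_nonneg_nonneg)

lemma topple_iter_after:
  assumes "\<xi> > 0"
  shows "topple_iter \<xi> s \<tau> (Suc m) (s m) = min (topple_iter \<xi> s \<tau> m (s m)) 0"
  using assms by (auto simp: topple_def disc_lap_delta max_def min_def)

text \<open>Toppling a site with positive mass makes the equation an equality there, so a supersolution
  that dominates the odometer at the neighbours dominates it at the site itself.\<close>

lemma odo_le_supersol:
  fixes s :: "nat \<Rightarrow> int ^ 'n"
  assumes \<xi>: "\<xi> > 0" and s: "admissible_seq \<xi> R s" and h: "supersol \<xi> R \<tau> h"
  shows "odo \<xi> s \<tau> m k \<le> h k"
proof (induction m arbitrary: k)
  case 0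
  then show ?case using h by (simp add: supersol_def)
next
  case (Suc m)
  let ?u = "odo \<xi> s \<tau> (Suc m)" and ?x = "s m"
  show ?case
  proof (cases "k = ?x \<and> topple_iter \<xi> s \<tau> m ?x > 0")
    case False
    then show ?thesis using Suc.IH[of k] by auto
  next
    case True
    have x: "?x \<in> lat_ball \<xi> R" using s by (auto simp: admissible_seq_def)
    have "topple_iter \<xi> s \<tau> (Suc m) ?x = 0" 
      using True topple_iter_after[OF \<xi>, of s \<tau> m] by (simp del: topple_iter.simps)
    then have 1: "disc_lap \<xi> ?u ?x = - \<tau> ?x" by (simp only: topple_iter_eq)
    have "disc_lap \<xi> h ?x \<le> - \<tau> ?x" using h x by (auto simp: supersol_def)
    then have 2: "disc_lap \<xi> h ?x \<le> disc_lap \<xi> ?u ?x" using 1 by simp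
    have "sum ?u (nbrs ?x) \<le> sum h (nbrs ?x)"
    proof (rule sum_mono)
      fix j assume "j \<in> nbrs ?x"
      then have "j \<noteq> ?x" by auto
      then show "?u j \<le> h j" using Suc.IH[of j] by simp
    qed
    moreover have "1 / (2 * real CARD('n) * \<xi>\<^sup>2) > 0" using \<xi> by simp
    with 2 have "sum h (nbrs ?x) - 2 * real CARD('n) * h ?x
        \<le> sum ?u (nbrs ?x) - 2 * real CARD('n) * ?u ?x"
      unfolding disc_lap_eq by (rule mult_left_le_imp_le)
    ultimately have "2 * real CARD('n) * ?u ?x \<le> 2 * real CARD('n) * h ?x" by linarith
    then show ?thesis using True by (simp del: odo.simps)
  qed
qed

section \<open>The quadratic barrier and convergence of toppling\<close>

lemma norm_vec_sq: "(norm (x :: real ^ 'n))\<^sup>2 = (\<Sum>i\<in>UNIV. (x $ i)\<^sup>2)"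
  by (simp only: power2_norm_eq_inner) (simp add: inner_vec_def power2_eq_square)

lemma lpt_add: "lpt \<xi> (k + l) = lpt \<xi> k + lpt \<xi> l"
  by (simp add: vec_eq_iff algebra_simps)

lemma lpt_diff: "lpt \<xi> (k - l) = lpt \<xi> k - lpt \<xi> l"
  by (simp add: vec_eq_iff algebra_simps)

lemma lpt_axis: "lpt \<xi> (axis i 1) = \<xi> *\<^sub>R axis i 1"
  by (simp add: vec_eq_iff axis_def)

lemma norm_nbr_less:
  assumes "\<xi> > 0" "k' \<in> nbrs k"
  shows "norm (lpt \<xi> k') \<le> norm (lpt \<xi> k) + \<xi>"
proof -
  have n: "norm (\<xi> *\<^sub>R axis i (1::real) :: real ^ 'a) = \<xi>" for i :: 'a
    using assms(1) by (simp add: norm_axis_1)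
  have "norm (lpt \<xi> k + \<xi> *\<^sub>R axis i 1) \<le> norm (lpt \<xi> k) + \<xi>" for i
    using norm_triangle_ineq[of "lpt \<xi> k" "\<xi> *\<^sub>R axis i 1"] by (simp only: n)
  moreover have "norm (lpt \<xi> k - \<xi> *\<^sub>R axis i 1) \<le> norm (lpt \<xi> k) + \<xi>" for i
    using norm_triangle_ineq4[of "lpt \<xi> k" "\<xi> *\<^sub>R axis i 1"] by (simp only: n)
  ultimately show ?thesis
    using assms(2) unfolding nbrs_def by (auto simp: lpt_add lpt_diff lpt_axis)
qed

text \<open>The second difference of a quadratic is exact, each direction giving
  \<open>2 * \<xi>\<^sup>2\<close>; hence quadratic barriers carry no discretisation error.\<close>

lemma disc_lap_norm_sq:
  fixes k :: "int ^ 'n"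
  assumes "\<xi> > 0"
  shows "disc_lap \<xi> (\<lambda>k. (norm (lpt \<xi> k))\<^sup>2) k = 1"
proof -
  have a: "(norm (x + \<xi> *\<^sub>R axis i 1))\<^sup>2 + (norm (x - \<xi> *\<^sub>R axis i 1))\<^sup>2 - 2 * (norm x)\<^sup>2 = 2 * \<xi>\<^sup>2"
    for x :: "real ^ 'n" and i
    by (simp only: power2_norm_eq_inner)
      (simp add: inner_add_left inner_add_right inner_diff_left inner_diff_right inner_axis_axis power2_eq_square algebra_simps)
  show ?thesis
    using assms by (simp add: disc_lap_axis lpt_add lpt_diff lpt_axis a)
qed

text \<open>Neighbours of points of the ball have norm at most \<open>R + \<xi>\<close>. With that
  radius the positive part is inactive on the whole stencil and the Laplacian is exactly
  \<open>- C\<close>; farther out the cut at zero keeps the function nonnegative.\<close>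

lemma supersol_barrier:
  fixes \<tau> :: "int ^ 'n \<Rightarrow> real"
  assumes \<xi>: "\<xi> > 0" and R: "R > 0" and C: "C \<ge> 0" "\<And>k. k \<in> lat_ball \<xi> R \<Longrightarrow> \<tau> k \<le> C"
  shows "supersol \<xi> R \<tau> (\<lambda>k. max 0 (C * ((R + \<xi>)\<^sup>2 - (norm (lpt \<xi> k))\<^sup>2)))"
  unfolding supersol_def
proof (intro conjI ballI allI)
  fix k :: "int ^ 'n" assume k: "k \<in> lat_ball \<xi> R"
  have nn: "max 0 (C * ((R + \<xi>)\<^sup>2 - (norm (lpt \<xi> j))\<^sup>2)) = C * ((R + \<xi>)\<^sup>2 - (norm (lpt \<xi> j))\<^sup>2)"
    if "norm (lpt \<xi> j) \<le> R + \<xi>" for j :: "int ^ 'n"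
    using that C(1) by (simp add: power_mono)
  have "disc_lap \<xi> (\<lambda>k. max 0 (C * ((R + \<xi>)\<^sup>2 - (norm (lpt \<xi> k))\<^sup>2))) k =
        disc_lap \<xi> (\<lambda>k. C * (R + \<xi>)\<^sup>2 + (- C) * (norm (lpt \<xi> k))\<^sup>2) k"
  proof (rule disc_lap_cong_at)
    have "norm (lpt \<xi> k) < R" using k by (simp add: lat_ball_def)
    then show "max 0 (C * ((R + \<xi>)\<^sup>2 - (norm (lpt \<xi> k))\<^sup>2)) =
        C * (R + \<xi>)\<^sup>2 + - C * (norm (lpt \<xi> k))\<^sup>2" using nn[of k] \<xi> by (simp add: algebra_simps)
    fix j assume "j \<in> nbrs k"
    then have "norm (lpt \<xi> j) \<le> R + \<xi>"
      using norm_nbr_less[OF \<xi>, of j k] \<open>norm (lpt \<xi> k) < R\<close> by linarith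
    then show "max 0 (C * ((R + \<xi>)\<^sup>2 - (norm (lpt \<xi> j))\<^sup>2)) =
        C * (R + \<xi>)\<^sup>2 + - C * (norm (lpt \<xi> j))\<^sup>2" using nn[of j] by (simp add: algebra_simps)
  qed
  also have "\<dots> = - C"
    by (simp only: disc_lap_add disc_lap_cmult disc_lap_norm_sq[OF \<xi>] disc_lap_const)
  finally show "\<tau> k + disc_lap \<xi> (\<lambda>k. max 0 (C * ((R + \<xi>)\<^sup>2 - (norm (lpt \<xi> k))\<^sup>2))) k \<le> 0"
    using C(2)[OF k] by simp
qed simp

text \<open>Monotone convergence below the barrier. The limit is itself a supersolution: a site with
  positive limiting mass would be positive at all late times, whereas its mass is nonpositive right
  after each of its infinitely many topplings.\<close>

lemma odo_converges:
  fixes s :: "nat \<Rightarrow> int ^ 'n"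
  assumes \<xi>: "\<xi> > 0" and R: "R > 0" and s: "admissible_seq \<xi> R s"
  shows "\<exists>u. odometer \<xi> R \<tau> u \<and> (\<forall>k. (\<lambda>m. odo \<xi> s \<tau> m k) \<longlonglongrightarrow> u k)"
proof -
  let ?B = "lat_ball \<xi> R :: (int ^ 'n) set"
  \<comment> \<open>Any upper bound of \<open>\<tau>\<close> on the finite ball serves here; the
    bounds uniform in the mesh come later from the bound on \<sigma>.\<close>
  define C where "C = (\<Sum>k\<in>?B. \<bar>\<tau> k\<bar>)"
  have C: "C \<ge> 0" "\<And>k. k \<in> ?B \<Longrightarrow> \<tau> k \<le> C"
    unfolding C_def using finite_lat_ball[OF \<xi>] member_le_sum[of _ ?B "\<lambda>k. \<bar>\<tau> k\<bar>"]
    by (auto intro: sum_nonneg order_trans[OF abs_ge_self])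
  have h: "supersol \<xi> R \<tau> (\<lambda>k. max 0 (C * ((R + \<xi>)\<^sup>2 - (norm (lpt \<xi> k))\<^sup>2)))"
    by (rule supersol_barrier[OF \<xi> R C])
  have conv: "\<exists>L. (\<lambda>m. odo \<xi> s \<tau> m k) \<longlonglongrightarrow> L" for k
  proof -
    have "incseq (\<lambda>m. odo \<xi> s \<tau> m k)" by (rule incseq_SucI) (rule odo_le_Suc)
    moreover have "\<forall>m. odo \<xi> s \<tau> m k \<le> max 0 (C * ((R + \<xi>)\<^sup>2 - (norm (lpt \<xi> k))\<^sup>2))"
      using odo_le_supersol[OF \<xi> s h] by blast
    ultimately obtain L where "(\<lambda>m. odo \<xi> s \<tau> m k) \<longlonglongrightarrow> L" by (rule incseq_convergent)
    then show ?thesis by blast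
  qed
  then obtain u where u: "\<And>k. (\<lambda>m. odo \<xi> s \<tau> m k) \<longlonglongrightarrow> u k" by metis
  have it: "(\<lambda>m. topple_iter \<xi> s \<tau> m k) \<longlonglongrightarrow> \<tau> k + disc_lap \<xi> u k" for k
    unfolding topple_iter_eq disc_lap_eq by (intro tendsto_intros u)
  have "u k \<ge> 0" for k using u[of k] odo_nonneg by (meson LIMSEQ_le_const)
  moreover have "u k = 0" if "k \<notin> ?B" for k
  proof -
    have "odo \<xi> s \<tau> m k = 0" for m
      using that s by (induction m) (auto simp: admissible_seq_def)
    then have "(\<lambda>m. 0) \<longlonglongrightarrow> u k" using u[of k] by simp
    then show ?thesis by (simp add: LIMSEQ_const_iff)
  qed
  moreover have "u k \<le> h k" if "supersol \<xi> R \<tau> h" for h k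
    using u[of k] odo_le_supersol[OF \<xi> s that] by (meson LIMSEQ_le_const2)
  moreover have "\<tau> k + disc_lap \<xi> u k \<le> 0" if k: "k \<in> ?B" for k
  proof (rule ccontr)
    assume "\<not> ?thesis"
    then have "eventually (\<lambda>m. topple_iter \<xi> s \<tau> m k > 0) sequentially"
      using order_tendstoD(1)[OF it[of k], of 0] by simp
    then obtain N where N: "\<And>m. m \<ge> N \<Longrightarrow> topple_iter \<xi> s \<tau> m k > 0"
      by (auto simp: eventually_sequentially)
    have "infinite {m. s m = k}" using s k by (auto simp: admissible_seq_def)
    then obtain m where "m > N" "s m = k" unfolding infinite_nat_iff_unbounded by auto
    then have "topple_iter \<xi> s \<tau> (Suc m) k \<le> 0" 
      using topple_iter_after[OF \<xi>, of s \<tau> m] by (simp del: topple_iter.simps)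
    then show False using N[of "Suc m"] \<open>m > N\<close> by (simp del: topple_iter.simps)
  qed
  ultimately have "odometer \<xi> R \<tau> u" by (auto simp: odometer_def supersol_def)
  then show ?thesis using u by blast
qed

text \<open>Only positive mass leaves a site and it is spread over the neighbours, so nonnegativity
  survives. In the limit this bounds \<open>- disc_lap \<xi> u\<close> by \<open>\<tau>\<close> on
  the whole lattice.\<close>

lemma topple_iter_nonneg:
  assumes "\<xi> > 0" "\<And>k. \<tau> k \<ge> 0"
  shows "topple_iter \<xi> s \<tau> m y \<ge> 0"
proof (induction m arbitrary: y)
  case (Suc m)
  then show ?case using assms(1) Suc.IH[of "s m"]
    by (auto simp: topple_def disc_lap_delta)
qed (simp add: assms)

text \<open>All admissible sequences lead to the same least supersolution, so the configuration
  described in \<open>GDS\<close> exists and is unique. The last conclusion, a lower bound even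
  outside the ball, is what \<open>odometer_sum_le\<close> relies on.\<close>

lemma GDS_odometer:
  fixes \<tau> :: "int ^ 'n \<Rightarrow> real"
  assumes \<xi>: "\<xi> > 0" and R: "R > 0"
  obtains u where "odometer \<xi> R \<tau> u" "GDS \<xi> R \<tau> = (\<lambda>k. \<tau> k + disc_lap \<xi> u k)"
    "(\<forall>k. 0 \<le> \<tau> k) \<Longrightarrow> (\<forall>k. 0 \<le> \<tau> k + disc_lap \<xi> u k)"
proof -
  obtain s0 :: "nat \<Rightarrow> int ^ 'n" where s0: "admissible_seq \<xi> R s0"
    using ex_admissible_seq[OF assms] by blast
  obtain u where u: "odometer \<xi> R \<tau> u" using odo_converges[OF assms s0] by blast
  have lim: "(\<lambda>m. topple_iter \<xi> s \<tau> m k) \<longlonglongrightarrow> \<tau> k + disc_lap \<xi> u k"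
    if s: "admissible_seq \<xi> R s" for s k
  proof -
    obtain v where v: "odometer \<xi> R \<tau> v" "\<And>k. (\<lambda>m. odo \<xi> s \<tau> m k) \<longlonglongrightarrow> v k"
      using odo_converges[OF assms s] by blast
    then have "v = u" using u odometer_unique by blast
    then show ?thesis unfolding topple_iter_eq disc_lap_eq using v by (intro tendsto_intros) auto
  qed
  have "GDS \<xi> R \<tau> = (\<lambda>k. \<tau> k + disc_lap \<xi> u k)"
    unfolding GDS_def
  proof (rule the_equality)
    show "\<forall>s. admissible_seq \<xi> R s \<longrightarrow>
      (\<forall>y. (\<lambda>m. topple_iter \<xi> s \<tau> m y) \<longlonglongrightarrow> \<tau> y + disc_lap \<xi> u y)" using lim by blast
    fix \<eta> assume "\<forall>s. admissible_seq \<xi> R s \<longrightarrow> (\<forall>y. (\<lambda>m. topple_iter \<xi> s \<tau> m y) \<longlonglongrightarrow> \<eta> y)"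
    then show "\<eta> = (\<lambda>k. \<tau> k + disc_lap \<xi> u k)" using lim s0 LIMSEQ_unique by blast
  qed
  moreover have "0 \<le> \<tau> k + disc_lap \<xi> u k" if "\<forall>k. 0 \<le> \<tau> k" for k
    using lim[OF s0, of k] topple_iter_nonneg[OF \<xi>] that by (meson LIMSEQ_le_const)
  ultimately show ?thesis using that u by blast
qed

section \<open>Summation by parts and a bound in mean for odometers\<close>

lemma sum_shift:
  fixes u \<phi> :: "int ^ 'n \<Rightarrow> real"
  assumes "finite B" "\<And>k. u k \<noteq> 0 \<Longrightarrow> k \<in> B \<and> k + e \<in> B"
  shows "(\<Sum>k\<in>B. u k * \<phi> (k + e)) = (\<Sum>k\<in>B. u (k - e) * \<phi> k)"
proof -
  have "(\<Sum>k\<in>B. u k * \<phi> (k + e)) = (\<Sum>k | u k \<noteq> 0. u k * \<phi> (k + e))"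
    using assms by (intro sum.mono_neutral_right) auto
  also have "\<dots> = (\<Sum>k | u (k - e) \<noteq> 0. u (k - e) * \<phi> k)"
    by (rule sum.reindex_bij_witness[where i = "\<lambda>k. k - e" and j = "\<lambda>k. k + e"]) auto
  also have "\<dots> = (\<Sum>k\<in>B. u (k - e) * \<phi> k)"
  proof (rule sum.mono_neutral_left)
    show "{k. u (k - e) \<noteq> 0} \<subseteq> B"
    proof
      fix k assume "k \<in> {k. u (k - e) \<noteq> 0}"
      then show "k \<in> B" using assms(2)[of "k - e"] by simp
    qed
  qed (use assms in auto)
  finally show ?thesis .
qed

text \<open>The set \<open>B\<close> contains the support of \<open>u\<close> together with all
  neighbours of that support, so shifts by unit vectors move nothing across the boundary of
  \<open>B\<close> and no boundary terms arise.\<close>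

lemma disc_lap_by_parts:
  fixes u \<phi> :: "int ^ 'n \<Rightarrow> real"
  assumes B: "finite B" and u: "\<And>k. u k \<noteq> 0 \<Longrightarrow> insert k (nbrs k) \<subseteq> B"
  shows "(\<Sum>k\<in>B. u k * disc_lap \<xi> \<phi> k) = (\<Sum>k\<in>B. disc_lap \<xi> u k * \<phi> k)"
proof -
  have s1: "(\<Sum>k\<in>B. u k * \<phi> (k + axis i 1)) = (\<Sum>k\<in>B. u (k - axis i 1) * \<phi> k)" for i
    by (rule sum_shift) (use u B in \<open>force simp: nbrs_def\<close>)+
  have "(\<Sum>k\<in>B. u k * \<phi> (k + - axis i 1)) = (\<Sum>k\<in>B. u (k - - axis i 1) * \<phi> k)" for i
    by (rule sum_shift) (use u B in \<open>force simp: nbrs_def\<close>)+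
  then have s2: "(\<Sum>k\<in>B. u k * \<phi> (k - axis i 1)) = (\<Sum>k\<in>B. u (k + axis i 1) * \<phi> k)" for i
    by simp
  have "(\<Sum>k\<in>B. \<Sum>i\<in>UNIV. u k * (\<phi> (k + axis i 1) + \<phi> (k - axis i 1) - 2 * \<phi> k)) =
        (\<Sum>k\<in>B. \<Sum>i\<in>UNIV. (u (k + axis i 1) + u (k - axis i 1) - 2 * u k) * \<phi> k)"
    by (subst (1 2) sum.swap)
      (simp add: ring_distribs sum.distrib sum_subtractf s1 s2 mult_ac)
  then have "1 / (2 * real CARD('n) * \<xi>\<^sup>2) *
        (\<Sum>k\<in>B. \<Sum>i\<in>UNIV. u k * (\<phi> (k + axis i 1) + \<phi> (k - axis i 1) - 2 * \<phi> k)) =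
        1 / (2 * real CARD('n) * \<xi>\<^sup>2) *
        (\<Sum>k\<in>B. \<Sum>i\<in>UNIV. (u (k + axis i 1) + u (k - axis i 1) - 2 * u k) * \<phi> k)"
    by (rule arg_cong)
  then show ?thesis
    unfolding disc_lap_axis sum_distrib_left sum_distrib_right
    by (simp add: mult_ac)
qed

text \<open>Duality with \<open>q\<close>, whose Laplacian is \<open>-1\<close>: the sum of
  \<open>p\<close> equals the sum of \<open>- disc_lap \<xi> p * q\<close>, and
  \<open>f + disc_lap \<xi> p \<ge> 0\<close> together with
  \<open>0 \<le> q \<le> (R + \<xi>)\<^sup>2\<close> on \<open>B\<close> bounds it. The result is
  linear in the sum of \<open>f\<close>, so a discrepancy that is small in mean has an odometer that
  is small in mean.\<close>

lemma odometer_sum_le: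
  fixes f :: "int ^ 'n \<Rightarrow> real"
  assumes \<xi>: "\<xi> > 0" and R: "R > 0" and f: "\<And>k. 0 \<le> f k"
    and f0: "\<And>k. k \<notin> lat_ball \<xi> R \<Longrightarrow> f k = 0" and p: "odometer \<xi> R f p"
  shows "(\<Sum>k\<in>lat_ball \<xi> R. p k) \<le> (R + \<xi>)\<^sup>2 * (\<Sum>k\<in>lat_ball \<xi> R. f k)"
proof -
  let ?B = "lat_ball \<xi> R :: (int ^ 'n) set"
  define B where "B = ?B \<union> (\<Union>k\<in>?B. nbrs k)"
  define q where "q k = (R + \<xi>)\<^sup>2 + (-1) * (norm (lpt \<xi> k))\<^sup>2" for k :: "int ^ 'n"
  have finB: "finite B" unfolding B_def using finite_lat_ball[OF \<xi>] by auto
  have nB: "norm (lpt \<xi> k) \<le> R + \<xi>" if "k \<in> B" for k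
    using that \<xi> norm_nbr_less[OF \<xi>] unfolding B_def lat_ball_def by force
  have p0: "p k = 0" if "k \<notin> ?B" for k using p that by (auto simp: odometer_def)
  \<comment> \<open>The sign of the final configuration is known for the odometer supplied by
    toppling; uniqueness transfers it to \<open>p\<close>.\<close>
  obtain p' where p': "odometer \<xi> R f p'" "\<And>k. 0 \<le> f k + disc_lap \<xi> p' k"
    using GDS_odometer[OF \<xi> R, of f] f by metis
  then have pos: "0 \<le> f k + disc_lap \<xi> p k" for k using odometer_unique[OF p] by metis
  have "disc_lap \<xi> q k = -1" for k
    unfolding q_def by (simp only: disc_lap_add disc_lap_cmult disc_lap_norm_sq[OF \<xi>] disc_lap_const)
  then have "(\<Sum>k\<in>?B. p k) = (\<Sum>k\<in>?B. - (p k * disc_lap \<xi> q k))" by simp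
  also have "\<dots> = - (\<Sum>k\<in>B. p k * disc_lap \<xi> q k)"
    unfolding sum_negf using finB p0 by (intro arg_cong[of _ _ uminus] sum.mono_neutral_left) (auto simp: B_def)
  also have "(\<Sum>k\<in>B. p k * disc_lap \<xi> q k) = (\<Sum>k\<in>B. disc_lap \<xi> p k * q k)"
    by (rule disc_lap_by_parts[OF finB]) (use p0 in \<open>force simp: B_def\<close>)
  also have "- (\<Sum>k\<in>B. disc_lap \<xi> p k * q k) = (\<Sum>k\<in>B. - disc_lap \<xi> p k * q k)"
    by (simp add: sum_negf)
  also have "\<dots> \<le> (\<Sum>k\<in>B. f k * (R + \<xi>)\<^sup>2)"
  proof (rule sum_mono)
    fix k assume k: "k \<in> B"
    have q: "0 \<le> q k" "q k \<le> (R + \<xi>)\<^sup>2" unfolding q_def using nB[OF k] by (auto intro: power_mono)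
    have "- disc_lap \<xi> p k \<le> f k" using pos[of k] by simp
    then have "- disc_lap \<xi> p k * q k \<le> f k * q k" using q by (intro mult_right_mono)
    also have "\<dots> \<le> f k * (R + \<xi>)\<^sup>2" using q f by (intro mult_left_mono)
    finally show "- disc_lap \<xi> p k * q k \<le> f k * (R + \<xi>)\<^sup>2" .
  qed
  also have "\<dots> = (\<Sum>k\<in>?B. f k * (R + \<xi>)\<^sup>2)"
    using finB f0 by (intro sum.mono_neutral_right) (auto simp: B_def)
  finally show ?thesis by (simp add: sum_distrib_right[symmetric] mult.commute)
qed


section \<open>Test functions\<close>

lemma pd_eqI: "(f has_derivative f') (at x) \<Longrightarrow> pd i f x = f' (axis i 1)"
  by (simp add: pd_def frechet_derivative_at[symmetric])

lemma iterpd_append: "iterpd (is @ js) f = iterpd is (iterpd js f)"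
  by (induction "is") auto

lemma smooth_iterpd: "smooth f \<Longrightarrow> smooth (iterpd js f)"
  by (simp add: smooth_def iterpd_append[symmetric])

lemma smooth_pd: "smooth f \<Longrightarrow> smooth (pd i f)"
  using smooth_iterpd[of f "[i]"] by simp

lemma smooth_differentiable: "smooth f \<Longrightarrow> f differentiable at x"
  unfolding smooth_def by (metis iterpd.simps(1))

lemma smooth_continuous_on: "smooth f \<Longrightarrow> continuous_on S f"
  by (simp add: continuous_at_imp_continuous_on differentiable_imp_continuous_within smooth_differentiable)

text \<open>Formulas for iterated derivatives are avoided: it is enough to place \<open>f\<close> in
  some class of differentiable functions that is stable under every \<open>pd i\<close>.\<close>

lemma smoothI_closed:
  assumes "f \<in> A" "\<And>g x. g \<in> A \<Longrightarrow> g differentiable at x" "\<And>g i. g \<in> A \<Longrightarrow> pd i g \<in> A"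
  shows "smooth f"
proof -
  have "iterpd is f \<in> A" for "is" by (induction "is") (use assms in auto)
  then show ?thesis using assms(2) by (simp add: smooth_def)
qed

lemma pd_lin:
  assumes "f differentiable at x" "g differentiable at x"
  shows "pd i (\<lambda>x. a * f x + b * g x) x = a * pd i f x + b * pd i g x"
proof -
  have "((\<lambda>x. a * f x + b * g x) has_derivative
      (\<lambda>v. a * frechet_derivative f (at x) v + b * frechet_derivative g (at x) v)) (at x)"
    using assms by (auto intro!: derivative_eq_intros simp: frechet_derivative_works[symmetric])
  from pd_eqI[OF this] show ?thesis by (simp add: pd_def)
qed

lemma iterpd_lin:
  assumes "smooth f" "smooth g"
  shows "iterpd is (\<lambda>x. a * f x + b * g x) = (\<lambda>x. a * iterpd is f x + b * iterpd is g x)"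
proof (induction "is")
  case (Cons i "is")
  show ?case
    unfolding iterpd.simps Cons
    by (rule ext, rule pd_lin) (use assms in \<open>auto simp: smooth_def\<close>)
qed simp

lemma smooth_lin: "smooth f \<Longrightarrow> smooth g \<Longrightarrow> smooth (\<lambda>x. a * f x + b * g x)"
  unfolding smooth_def[of "\<lambda>x. a * f x + b * g x"]
  by (simp add: iterpd_lin) (auto simp: smooth_def intro!: derivative_intros)

lemma pd_translate:
  assumes "f differentiable at (x - a)"
  shows "pd i (\<lambda>x. f (x - a)) x = pd i f (x - a)" "(\<lambda>x. f (x - a)) differentiable at x"
proof -
  have 1: "(f has_derivative frechet_derivative f (at (x - a))) (at (x - a))"
    using assms by (simp add: frechet_derivative_works)
  have 2: "((\<lambda>x. x - a) has_derivative (\<lambda>v. v)) (at x)"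
    by (auto intro!: derivative_eq_intros)
  have 3: "((\<lambda>x. f (x - a)) has_derivative (\<lambda>v. frechet_derivative f (at (x - a)) v)) (at x)"
    using has_derivative_compose[OF 2 1] by simp
  show "pd i (\<lambda>x. f (x - a)) x = pd i f (x - a)" using pd_eqI[OF 3] by (simp add: pd_def)
  show "(\<lambda>x. f (x - a)) differentiable at x" using 3 by (auto simp: differentiable_def)
qed

lemma iterpd_translate:
  assumes "smooth f"
  shows "iterpd is (\<lambda>x. f (x - a)) = (\<lambda>x. iterpd is f (x - a))"
proof (induction "is")
  case (Cons i "is")
  show ?case
    unfolding iterpd.simps Cons
    by (rule ext, rule pd_translate) (use assms in \<open>auto simp: smooth_def\<close>)
qed simp

lemma smooth_translate:
  assumes "smooth f" shows "smooth (\<lambda>x. f (x - a))"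
  unfolding smooth_def iterpd_translate[OF assms]
  using assms by (intro allI pd_translate(2)) (simp add: smooth_def)

lemma test_smooth: "test_fun \<phi> \<Longrightarrow> smooth \<phi>"
  by (simp add: test_fun_def)

lemma test_funI:
  assumes "smooth \<phi>" "\<And>x. norm x > r \<Longrightarrow> \<phi> x = 0"
  shows "test_fun \<phi>"
proof -
  have "{x. \<phi> x \<noteq> 0} \<subseteq> cball 0 r" using assms(2) by (force simp: not_less[symmetric])
  then have "bounded {x. \<phi> x \<noteq> 0}" using bounded_cball bounded_subset by blast
  then show ?thesis using assms(1) by (simp add: test_fun_def)
qed

lemma test_fun_support:
  assumes "test_fun \<phi>"
  obtains r where "r > 0" "\<And>x. norm x \<ge> r \<Longrightarrow> \<phi> x = 0"
proof -
  have "bounded {x. \<phi> x \<noteq> 0}"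
    using assms by (auto simp: test_fun_def intro: bounded_subset[OF compact_imp_bounded closure_subset])
  then obtain b where b: "b > 0" "\<forall>x\<in>{x. \<phi> x \<noteq> 0}. norm x < b" by (meson bounded_pos_less)
  show ?thesis by (rule that[of b]) (use b in force)+
qed

lemma test_lin:
  assumes "test_fun \<phi>" "test_fun \<psi>"
  shows "test_fun (\<lambda>x. a * \<phi> x + b * \<psi> x)"
proof -
  obtain r s where r: "\<And>x. norm x \<ge> r \<Longrightarrow> \<phi> x = 0" and s: "\<And>x. norm x \<ge> s \<Longrightarrow> \<psi> x = 0"
    using test_fun_support assms by metis
  show ?thesis
    by (rule test_funI[of _ "max r s"]) (use r s assms in \<open>auto intro: smooth_lin simp: test_smooth\<close>)
qed

lemma test_zero: "test_fun (\<lambda>x :: real ^ 'n. 0)"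
proof (rule test_funI)
  show "smooth (\<lambda>x :: real ^ 'n. 0)"
    by (rule smoothI_closed[where A = "{\<lambda>x. 0}"]) (auto intro!: pd_eqI[of _ "\<lambda>_. 0", OF has_derivative_const])
qed auto

lemma test_cmult: "test_fun \<phi> \<Longrightarrow> test_fun (\<lambda>x. a * \<phi> x)"
  using test_lin[of \<phi> \<phi> a 0] by simp

lemma test_add: "test_fun \<phi> \<Longrightarrow> test_fun \<psi> \<Longrightarrow> test_fun (\<lambda>x. \<phi> x + \<psi> x)"
  using test_lin[of \<phi> \<psi> 1 1] by simp

lemma test_diff: "test_fun \<phi> \<Longrightarrow> test_fun \<psi> \<Longrightarrow> test_fun (\<lambda>x. \<phi> x - \<psi> x)"
  using test_lin[of \<phi> \<psi> 1 "-1"] by simp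

lemma test_sum:
  assumes "finite K" "\<And>k. k \<in> K \<Longrightarrow> test_fun (\<phi> k)"
  shows "test_fun (\<lambda>x. \<Sum>k\<in>K. \<phi> k x)"
  using assms by (induction K rule: finite_induct) (auto intro: test_zero test_add)

lemma test_translate:
  assumes "test_fun \<phi>" shows "test_fun (\<lambda>x. \<phi> (x - a))"
proof -
  obtain r where r: "\<And>x. norm x \<ge> r \<Longrightarrow> \<phi> x = 0" using test_fun_support assms by metis
  have "\<phi> (x - a) = 0" if "norm x > r + norm a" for x
    using r[of "x - a"] norm_triangle_ineq2[of x a] that by linarith
  then show ?thesis
    by (rule test_funI[OF smooth_translate[OF test_smooth[OF assms]]])
qed

lemma pd_zero_outside:
  assumes "open S" "x \<in> S" "\<And>y. y \<in> S \<Longrightarrow> f y = 0"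
  shows "pd i f x = 0"
proof -
  have "((\<lambda>x. 0) has_derivative (\<lambda>v. 0)) (at x)" by simp
  then have "(f has_derivative (\<lambda>v. 0)) (at x)"
    by (rule has_derivative_transform_within_open[OF _ assms(1,2)]) (use assms(3) in auto)
  from pd_eqI[OF this] show ?thesis .
qed

lemma pd_zero_norm:
  assumes "\<And>x. norm x \<ge> r \<Longrightarrow> f x = 0" "norm x > r"
  shows "pd i f x = 0"
proof (rule pd_zero_outside[of "- cball 0 r"])
  show "open (- cball 0 r :: (real ^ 'a) set)" by (simp add: open_Compl)
qed (use assms in auto)

lemma test_pd:
  assumes "test_fun \<phi>" shows "test_fun (pd i \<phi>)"
proof -
  obtain r where r: "\<And>x. norm x \<ge> r \<Longrightarrow> \<phi> x = 0" using test_fun_support assms by metis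
  show ?thesis
    by (rule test_funI[of _ r]) (use assms r in \<open>auto intro: smooth_pd pd_zero_norm simp: test_smooth\<close>)
qed

lemma lap_eq: "lap \<phi> x = (\<Sum>i\<in>UNIV. pd i (pd i \<phi>) x)"
  by (simp add: lap_def)

lemma test_lap: "test_fun \<phi> \<Longrightarrow> test_fun (lap \<phi>)"
  unfolding lap_eq[abs_def] by (intro test_sum test_pd) auto

lemma lap_translate: "smooth f \<Longrightarrow> lap (\<lambda>x. f (x - a)) x = lap f (x - a)"
  unfolding lap_def by (simp only: iterpd_translate)

lemma lap_zero_norm:
  assumes "test_fun \<phi>" "\<And>x. norm x \<ge> r \<Longrightarrow> \<phi> x = 0" "norm x > r"
  shows "lap \<phi> x = 0"
  unfolding lap_eq
proof (rule sum.neutral, rule ballI)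
  fix i
  show "pd i (pd i \<phi>) x = 0"
  proof (rule pd_zero_outside[of "- cball 0 r"])
    show "open (- cball 0 r :: (real ^ 'a) set)" by (simp add: open_Compl)
  qed (use assms in \<open>auto intro!: pd_zero_norm[of r \<phi>]\<close>)
qed

lemma test_bounded:
  assumes "test_fun \<phi>"
  obtains B where "B > 0" "\<And>x. \<bar>\<phi> x\<bar> \<le> B"
proof -
  let ?K = "closure {x. \<phi> x \<noteq> 0}"
  have "compact (\<phi> ` ?K)"
    using assms by (intro compact_continuous_image smooth_continuous_on) (auto simp: test_fun_def)
  then obtain b where b: "b > 0" "\<forall>y\<in>\<phi> ` ?K. norm y \<le> b"
    by (meson compact_imp_bounded bounded_pos)
  have "\<bar>\<phi> x\<bar> \<le> b" for x
  proof (cases "\<phi> x = 0")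
    case False
    then have "x \<in> ?K" using closure_subset by fastforce
    then show ?thesis using b(2) by auto
  qed (use b in auto)
  then show ?thesis using that b(1) by blast
qed

section \<open>Lipschitz bounds and consistency of the lattice Laplacian\<close>

lemma smooth_has_derivative:
  fixes f :: "real ^ 'n \<Rightarrow> real"
  assumes "f differentiable at x"
  shows "(f has_derivative (\<lambda>v. \<Sum>i\<in>UNIV. v $ i * pd i f x)) (at x)"
proof -
  let ?D = "frechet_derivative f (at x)"
  have D: "(f has_derivative ?D) (at x)" using assms by (simp add: frechet_derivative_works)
  then have lin: "linear ?D" by (rule has_derivative_linear)
  have "?D v = (\<Sum>i\<in>UNIV. v $ i * pd i f x)" for v
  proof -
    have "?D v = ?D (\<Sum>i\<in>UNIV. v $ i *\<^sub>R axis i 1)"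
      using basis_expansion[of v] by (simp add: scalar_mult_eq_scaleR)
    also have "\<dots> = (\<Sum>i\<in>UNIV. v $ i * pd i f x)"
      by (simp add: linear_sum[OF lin] linear_cmul[OF lin] pd_def)
    finally show ?thesis .
  qed
  then have "?D = (\<lambda>v. \<Sum>i\<in>UNIV. v $ i * pd i f x)" by blast
  then show ?thesis using D by simp
qed

lemma test_lipschitz:
  fixes \<phi> :: "real ^ 'n \<Rightarrow> real"
  assumes "test_fun \<phi>"
  obtains L where "L > 0" "\<And>x y. \<bar>\<phi> x - \<phi> y\<bar> \<le> L * norm (x - y)"
proof -
  have "\<forall>i. \<exists>B>0. \<forall>x. \<bar>pd i \<phi> x\<bar> \<le> B" using test_bounded[OF test_pd[OF assms]] by metis
  then obtain B where B: "\<And>i. B i > 0" "\<And>i x. \<bar>pd i \<phi> x\<bar> \<le> B i" by metis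
  define L where "L = (\<Sum>i\<in>UNIV. B i)"
  have "L > 0" unfolding L_def by (rule sum_pos) (use B in auto)
  moreover have "norm (\<phi> x - \<phi> y) \<le> L * norm (x - y)" for x y
  proof (rule differentiable_bound[where S = UNIV])
    fix x
    show "(\<phi> has_derivative (\<lambda>v. \<Sum>i\<in>UNIV. v $ i * pd i \<phi> x)) (at x within UNIV)"
      using smooth_has_derivative smooth_differentiable test_smooth assms by blast
    show "onorm (\<lambda>v. \<Sum>i\<in>UNIV. v $ i * pd i \<phi> x) \<le> L"
    proof (rule onorm_le)
      fix v :: "real ^ 'n"
      have "norm (\<Sum>i\<in>UNIV. v $ i * pd i \<phi> x) \<le> (\<Sum>i\<in>UNIV. norm v * B i)"
        by (rule order_trans[OF norm_sum], rule sum_mono)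
          (simp add: abs_mult mult_mono B component_le_norm_cart)
      then show "norm (\<Sum>i\<in>UNIV. v $ i * pd i \<phi> x) \<le> L * norm v"
        by (simp add: L_def sum_distrib_left mult.commute)
    qed
  qed auto
  ultimately show ?thesis using that by simp
qed

lemma pd_line_derivative:
  fixes f :: "real ^ 'n \<Rightarrow> real"
  assumes "f differentiable at (x + t *\<^sub>R axis i 1)"
  shows "((\<lambda>t. f (x + t *\<^sub>R axis i 1)) has_real_derivative pd i f (x + t *\<^sub>R axis i 1)) (at t)"
proof -
  let ?y = "x + t *\<^sub>R axis i 1"
  have 1: "((\<lambda>t. x + t *\<^sub>R axis i 1) has_derivative (\<lambda>s. s *\<^sub>R axis i 1)) (at t)"
    by (auto intro!: derivative_eq_intros)
  have 2: "(f has_derivative frechet_derivative f (at ?y)) (at ?y)"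
    using assms by (simp add: frechet_derivative_works)
  have "linear (frechet_derivative f (at ?y))" using 2 by (rule has_derivative_linear)
  then have "frechet_derivative f (at ?y) (s *\<^sub>R axis i 1) = pd i f ?y * s" for s
    by (simp add: linear_cmul pd_def)
  with has_derivative_compose[OF 1 2] show ?thesis
    by (simp add: has_field_derivative_def)
qed

text \<open>The symmetric remainder \<open>k\<close> vanishes at \<open>0\<close>, and its
  derivative is the increment of \<open>pd i \<phi>\<close> over \<open>[-t, t]\<close> minus a
  linear term. Two applications of the mean value theorem and the Lipschitz bound for the second
  derivative give a cubic remainder, which after division by \<open>h\<^sup>2\<close> is still of
  order \<open>h\<close>.\<close>

lemma second_difference_bound:
  fixes \<phi> :: "real ^ 'n \<Rightarrow> real"
  assumes "test_fun \<phi>"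
  obtains L where "L > 0"
    "\<And>x h. h > 0 \<Longrightarrow> \<bar>\<phi> (x + h *\<^sub>R axis i 1) + \<phi> (x - h *\<^sub>R axis i 1) - 2 * \<phi> x
       - h\<^sup>2 * pd i (pd i \<phi>) x\<bar> \<le> L * h ^ 3"
proof -
  have tp: "test_fun (pd i \<phi>)" and tpp: "test_fun (pd i (pd i \<phi>))" using assms by (simp_all add: test_pd)
  obtain L where L: "L > 0" "\<And>x y. \<bar>pd i (pd i \<phi>) x - pd i (pd i \<phi>) y\<bar> \<le> L * norm (x - y)"
    using test_lipschitz[OF tpp] by metis
  have d: "\<phi> differentiable at x" "pd i \<phi> differentiable at x" for x
    using assms tp by (simp_all add: smooth_differentiable test_smooth)
  have "\<bar>\<phi> (x + h *\<^sub>R axis i 1) + \<phi> (x - h *\<^sub>R axis i 1) - 2 * \<phi> x - h\<^sup>2 * pd i (pd i \<phi>) x\<bar> \<le> 2 * L * h ^ 3"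
    if h: "h > 0" for x h
  proof -
    let ?e = "axis i 1 :: real ^ 'n" and ?c = "pd i (pd i \<phi>) x"
    define k where "k t = \<phi> (x + t *\<^sub>R ?e) + \<phi> (x + (- t) *\<^sub>R ?e) - 2 * \<phi> x - t\<^sup>2 * ?c" for t
    define k' where "k' t = pd i \<phi> (x + t *\<^sub>R ?e) - pd i \<phi> (x + (- t) *\<^sub>R ?e) - 2 * t * ?c" for t
    have kd: "(k has_real_derivative k' t) (at t)" for t
    proof -
      have "((\<lambda>t. \<phi> (x + (- t) *\<^sub>R ?e)) has_real_derivative pd i \<phi> (x + (- t) *\<^sub>R ?e) * (- 1)) (at t)"
        by (rule DERIV_chain2[OF pd_line_derivative[OF d(1)]]) (auto intro!: derivative_eq_intros)
      then show ?thesis unfolding k_def k'_def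
        by (auto intro!: derivative_eq_intros pd_line_derivative[OF d(1)])
    qed
    have k'b: "\<bar>k' t\<bar> \<le> 2 * L * h\<^sup>2" if t: "0 < t" "t < h" for t
    proof -
      have "\<exists>z. - t < z \<and> z < t \<and> pd i \<phi> (x + t *\<^sub>R ?e) - pd i \<phi> (x + (- t) *\<^sub>R ?e)
          = (t - (- t)) * pd i (pd i \<phi>) (x + z *\<^sub>R ?e)"
        by (rule MVT2) (use t in \<open>auto intro: pd_line_derivative[OF d(2)]\<close>)
      then obtain z where z: "- t < z" "z < t"
        "pd i \<phi> (x + t *\<^sub>R ?e) - pd i \<phi> (x + (- t) *\<^sub>R ?e) = 2 * t * pd i (pd i \<phi>) (x + z *\<^sub>R ?e)" by auto
      have "k' t = 2 * t * (pd i (pd i \<phi>) (x + z *\<^sub>R ?e) - ?c)"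
        using z(3) by (simp add: k'_def algebra_simps)
      moreover have "\<bar>pd i (pd i \<phi>) (x + z *\<^sub>R ?e) - ?c\<bar> \<le> L * \<bar>z\<bar>"
        using L(2)[of "x + z *\<^sub>R ?e" x] by (simp add: norm_axis_1)
      ultimately have "\<bar>k' t\<bar> \<le> 2 * t * (L * \<bar>z\<bar>)" using t by (simp add: abs_mult)
      also have "\<dots> \<le> 2 * h * (L * h)" using t z L(1) by (intro mult_mono) auto
      finally show ?thesis by (simp add: power2_eq_square mult_ac)
    qed
    have "\<exists>z. 0 < z \<and> z < h \<and> k h - k 0 = (h - 0) * k' z"
      by (rule MVT2) (use h kd in auto)
    then obtain z where z: "0 < z" "z < h" "k h - k 0 = h * k' z" by auto
    have "k 0 = 0" by (simp add: k_def)
    then have "\<bar>k h\<bar> = h * \<bar>k' z\<bar>" using z h by (simp add: abs_mult)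
    also have "\<dots> \<le> h * (2 * L * h\<^sup>2)" using k'b[OF z(1,2)] h by (intro mult_left_mono) auto
    finally show ?thesis by (simp add: k_def power3_eq_cube power2_eq_square mult_ac)
  qed
  then show ?thesis using that[of "2 * L"] L(1) by simp
qed

text \<open>The lattice Laplacian as an operator on functions of a continuous variable, so that a
  functional on test functions can be applied to the result.\<close>

definition dlap :: "real \<Rightarrow> (real ^ 'n \<Rightarrow> real) \<Rightarrow> real ^ 'n \<Rightarrow> real" where
  "dlap h f x = 1 / (2 * real CARD('n) * h\<^sup>2) *
     (\<Sum>i\<in>UNIV. f (x + h *\<^sub>R axis i 1) + f (x - h *\<^sub>R axis i 1) - 2 * f x)"

lemma disc_lap_lpt: "disc_lap \<xi> (\<lambda>k. f (lpt \<xi> k)) k = dlap \<xi> f (lpt \<xi> k)"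
  by (simp add: disc_lap_axis dlap_def lpt_add lpt_diff lpt_axis)

lemma dlap_consistent:
  fixes \<phi> :: "real ^ 'n \<Rightarrow> real"
  assumes "test_fun \<phi>"
  obtains L where "L > 0"
    "\<And>x h. h > 0 \<Longrightarrow> \<bar>dlap h \<phi> x - lap \<phi> x / (2 * real CARD('n))\<bar> \<le> L * h"
proof -
  let ?S = "\<lambda>i x h. \<phi> (x + h *\<^sub>R axis i 1) + \<phi> (x - h *\<^sub>R axis i 1) - 2 * \<phi> x"
  have "\<forall>i. \<exists>L>0. \<forall>x h. h > 0 \<longrightarrow> \<bar>?S i x h - h\<^sup>2 * pd i (pd i \<phi>) x\<bar> \<le> L * h ^ 3"
    using second_difference_bound[OF assms] by metis
  then obtain L where L: "\<And>i. L i > 0"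
    "\<And>i x h. h > 0 \<Longrightarrow> \<bar>?S i x h - h\<^sup>2 * pd i (pd i \<phi>) x\<bar> \<le> L i * h ^ 3" by metis
  define M where "M = (\<Sum>i\<in>UNIV. L i)"
  have M: "M > 0" unfolding M_def by (rule sum_pos) (use L in auto)
  have "\<bar>dlap h \<phi> x - lap \<phi> x / (2 * real CARD('n))\<bar> \<le> M * h" if h: "h > 0" for x h
  proof -
    have "dlap h \<phi> x - lap \<phi> x / (2 * real CARD('n)) =
       (\<Sum>i\<in>UNIV. ?S i x h - h\<^sup>2 * pd i (pd i \<phi>) x) / (2 * real CARD('n) * h\<^sup>2)"
    proof -
      have "(\<Sum>i\<in>UNIV. ?S i x h - h\<^sup>2 * pd i (pd i \<phi>) x) = (\<Sum>i\<in>UNIV. ?S i x h) - h\<^sup>2 * lap \<phi> x"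
        by (simp only: lap_eq sum_subtractf sum_distrib_left)
      moreover have "a / (2 * c * h\<^sup>2) - b / (2 * c) = (a - h\<^sup>2 * b) / (2 * c * h\<^sup>2)" if "c > 0" for a b c :: real
        using that h by (simp add: field_simps)
      ultimately show ?thesis by (simp only: dlap_def) simp
    qed
    also have "\<bar>\<dots>\<bar> \<le> (M * h ^ 3) / (2 * real CARD('n) * h\<^sup>2)"
    proof -
      have "\<bar>\<Sum>i\<in>UNIV. ?S i x h - h\<^sup>2 * pd i (pd i \<phi>) x\<bar> \<le> (\<Sum>i\<in>UNIV. L i * h ^ 3)"
        by (rule order_trans[OF sum_abs], rule sum_mono) (rule L(2)[OF h])
      then show ?thesis using h
        by (simp add: abs_divide abs_mult M_def sum_distrib_right divide_right_mono)
    qed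
    also have "\<dots> = M * h / (2 * real CARD('n))"
      using h by (simp add: power3_eq_cube power2_eq_square)
    also have "\<dots> \<le> M * h / 1" using M h
    proof (intro divide_left_mono)
      have "1 \<le> real CARD('n)" using one_le_card_finite[where 'a = 'n] by linarith
      then show "1 \<le> 2 * real CARD('n)" by linarith
    qed auto
    finally show ?thesis by simp
  qed
  then show ?thesis using that[OF M] by blast
qed

section \<open>Bump functions, cutoffs and mollifiers\<close>

definition flat :: "nat \<Rightarrow> real \<Rightarrow> real" where
  "flat n t = (if t > 0 then exp (- 1 / t) / t ^ n else 0)"

lemma power_le_fact_exp:
  fixes s :: real assumes "s \<ge> 0" shows "s ^ n \<le> fact n * exp s"
proof -
  have "sum (\<lambda>n. s ^ n /\<^sub>R fact n) {n} \<le> exp s"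
    using assms exp_converges[of s] sums_summable
    by (subst sums_unique[OF exp_converges]) (intro sum_le_suminf, auto)
  then show ?thesis by (simp add: field_simps)
qed

text \<open>Apply \<open>s ^ m \<le> fact m * exp s\<close> with \<open>s = 1 / t\<close> and
  \<open>m = n + 2\<close>; the two spare powers give quadratic decay, so that the difference
  quotient at \<open>0\<close> tends to \<open>0\<close>.\<close>

lemma flat_le:
  assumes "t > 0" shows "flat n t \<le> fact (n + 2) * t\<^sup>2"
proof -
  have "(1 / t) ^ (n + 2) \<le> fact (n + 2) * exp (1 / t)" using assms by (intro power_le_fact_exp) auto
  then have "1 / t ^ n * (1 / t\<^sup>2) \<le> fact (n + 2) * exp (1 / t)"
    by (simp only: power_add power_one_over)
  then have "1 / t ^ n / exp (1 / t) \<le> fact (n + 2) * t\<^sup>2"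
    using assms by (simp only: pos_divide_le_eq exp_gt_zero times_divide_eq_right mult_1_right zero_less_power)
      (simp only: mult_ac)
  then show ?thesis using assms by (simp only: flat_def exp_minus minus_divide_left[symmetric] if_True) (simp add: divide_inverse mult.commute del: fact_Suc)
qed

lemma flat_nonneg: "flat n t \<ge> 0"
  by (simp add: flat_def)

text \<open>Dividing \<open>exp (- 1 / t)\<close> by powers of \<open>t\<close> yields a family
  whose derivatives are linear combinations of its members; smoothness then follows without treating
  each order of differentiation.\<close>

lemma flat_derivative:
  "(flat n has_real_derivative (flat (n + 2) t - real n * flat (n + 1) t)) (at t)"
proof -
  consider "t > 0" | "t < 0" | "t = 0" by linarith
  then show ?thesis
  proof cases
    case 1
    have e: "((\<lambda>t. exp (- 1 / t)) has_real_derivative exp (- 1 / t) / t\<^sup>2) (at t)"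
      using 1 by (auto intro!: derivative_eq_intros simp: power2_eq_square)
    have "((\<lambda>t. exp (- 1 / t) / t ^ n) has_real_derivative
        (exp (- 1 / t) / t\<^sup>2 * t ^ n - exp (- 1 / t) * (real n * t ^ (n - Suc 0))) / (t ^ n * t ^ n)) (at t)"
      by (rule DERIV_divide[OF e DERIV_pow]) (use 1 in auto)
    moreover have "(exp (- 1 / t) / t\<^sup>2 * t ^ n - exp (- 1 / t) * (real n * t ^ (n - Suc 0))) / (t ^ n * t ^ n)
        = flat (n + 2) t - real n * flat (n + 1) t"
    proof (cases n)
      case (Suc m)
      have "(E / t\<^sup>2 * (t * p) - E * (N * p)) / ((t * p) * (t * p)) = E / (t * (t * (t * p))) - N * (E / (t * (t * p)))"
        if "p > 0" for E N p :: real
        using 1 that by (simp add: diff_divide_distrib power2_eq_square)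
      from this[of "t ^ m" "exp (- 1 / t)" "real n"] show ?thesis using 1 Suc by (simp add: flat_def)
    qed (use 1 in \<open>simp add: flat_def power2_eq_square\<close>)
    ultimately have "((\<lambda>t. exp (- 1 / t) / t ^ n) has_real_derivative (flat (n + 2) t - real n * flat (n + 1) t)) (at t)"
      by simp
    then show ?thesis
      by (rule has_field_derivative_transform_within_open[where S = "{0<..}"]) (use 1 in \<open>auto simp: flat_def\<close>)
  next
    case 2
    have "((\<lambda>t. 0) has_real_derivative 0) (at t)" by simp
    then have "(flat n has_real_derivative 0) (at t)"
      by (rule has_field_derivative_transform_within_open[where S = "{..<0}"]) (use 2 in \<open>auto simp: flat_def\<close>)
    then show ?thesis using 2 by (simp add: flat_def)
  next
    case 3
    have "((\<lambda>h. (flat n h - flat n 0) / h) \<longlongrightarrow> 0) (at 0)"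
    proof (rule Lim_null_comparison[where g = "\<lambda>h. fact (n + 2) * \<bar>h\<bar>"])
      have "norm ((flat n h - flat n 0) / h) \<le> fact (n + 2) * \<bar>h\<bar>" for h
      proof (cases "h > 0")
        case True
        have "flat n h / h \<le> fact (n + 2) * h\<^sup>2 / h"
          using flat_le[OF True, of n] True by (intro divide_right_mono) auto
        then show ?thesis using True flat_nonneg[of n h]
          by (simp add: flat_def[of n 0] power2_eq_square del: fact_Suc)
      qed (simp add: flat_def mult_nonneg_nonpos del: fact_Suc)
      then show "\<forall>\<^sub>F h in at 0. norm ((flat n h - flat n 0) / h) \<le> fact (n + 2) * \<bar>h\<bar>" by simp
      show "((\<lambda>h::real. fact (n + 2) * \<bar>h\<bar>) \<longlongrightarrow> 0) (at 0)"
        by (auto intro!: tendsto_eq_intros simp del: fact_Suc)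
    qed
    then show ?thesis using 3 by (simp add: DERIV_def flat_def)
  qed
qed

text \<open>The class to be used with \<open>smoothI_closed\<close>: differentiating a generator of
  the third kind produces products of \<open>flat\<close> terms with coordinates, hence the closure
  under sums and products.\<close>

inductive_set bump_alg :: "real \<Rightarrow> (real ^ 'n \<Rightarrow> real) set" for r where
  const: "(\<lambda>x. c) \<in> bump_alg r"
| coord: "(\<lambda>x. x $ i) \<in> bump_alg r"
| flat: "(\<lambda>x. flat n (r\<^sup>2 - x \<bullet> x)) \<in> bump_alg r"
| add: "f \<in> bump_alg r \<Longrightarrow> g \<in> bump_alg r \<Longrightarrow> (\<lambda>x. f x + g x) \<in> bump_alg r"
| mult: "f \<in> bump_alg r \<Longrightarrow> g \<in> bump_alg r \<Longrightarrow> (\<lambda>x. f x * g x) \<in> bump_alg r"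

lemma flat_comp_derivative:
  fixes x :: "real ^ 'n"
  shows "((\<lambda>x. flat n (r\<^sup>2 - x \<bullet> x)) has_derivative
    (\<lambda>v. (flat (n + 2) (r\<^sup>2 - x \<bullet> x) + (- real n) * flat (n + 1) (r\<^sup>2 - x \<bullet> x)) * ((- 2) * (x \<bullet> v)))) (at x)"
proof -
  have 1: "((\<lambda>x. r\<^sup>2 - x \<bullet> x) has_derivative (\<lambda>v. (- 2) * (x \<bullet> v))) (at x)"
    by (auto intro!: derivative_eq_intros simp: inner_commute)
  have 2: "(flat n has_derivative (\<lambda>s. (flat (n + 2) (r\<^sup>2 - x \<bullet> x) - real n * flat (n + 1) (r\<^sup>2 - x \<bullet> x)) * s))
     (at (r\<^sup>2 - x \<bullet> x))"
    using flat_derivative unfolding has_field_derivative_def .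
  show ?thesis using has_derivative_compose[OF 1 2] by simp
qed

lemma bump_alg_closed:
  fixes f :: "real ^ 'n \<Rightarrow> real"
  assumes "f \<in> bump_alg r"
  shows "(\<forall>x. f differentiable at x) \<and> (\<forall>i. pd i f \<in> bump_alg r)"
  using assms
proof induction
  case (const c)
  have "pd i (\<lambda>x. c) = (\<lambda>x. 0)" for i :: 'n by (rule ext) (rule pd_eqI[OF has_derivative_const])
  then show ?case by (simp add: bump_alg.const)
next
  case (coord j)
  have d: "((\<lambda>x. x $ j) has_derivative (\<lambda>v. v $ j)) (at x)" for x :: "real ^ 'n"
    by (rule bounded_linear_imp_has_derivative) (rule bounded_linear_vec_nth)
  have "pd i (\<lambda>x. x $ j) = (\<lambda>x. axis i 1 $ j)" for i by (rule ext) (rule pd_eqI[OF d])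
  then show ?case using d by (auto simp: bump_alg.const differentiable_def)
next
  case (flat n)
  have "pd i (\<lambda>x. flat n (r\<^sup>2 - x \<bullet> x)) = (\<lambda>x. (flat (n + 2) (r\<^sup>2 - x \<bullet> x) + (- real n) * flat (n + 1) (r\<^sup>2 - x \<bullet> x)) * ((- 2) * (x $ i)))" for i :: 'n
    by (rule ext, subst pd_eqI[OF flat_comp_derivative]) (simp add: inner_axis)
  moreover have "(\<lambda>x. (flat (n + 2) (r\<^sup>2 - x \<bullet> x) + (- real n) * flat (n + 1) (r\<^sup>2 - x \<bullet> x)) * ((- 2) * (x $ i))) \<in> bump_alg r" for i :: 'n
    by (intro bump_alg.intros)
  moreover have "(\<lambda>x :: real ^ 'n. flat n (r\<^sup>2 - x \<bullet> x)) differentiable at x" for x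
    using flat_comp_derivative unfolding differentiable_def by blast
  ultimately show ?case by (simp only:) blast
next
  case (add f g)
  have "pd i (\<lambda>x. f x + g x) = (\<lambda>x. pd i f x + pd i g x)" for i
  proof
    fix x
    have "f differentiable at x" "g differentiable at x" using add.IH by auto
    from pd_lin[OF this, of i 1 1] show "pd i (\<lambda>x. f x + g x) x = pd i f x + pd i g x" by simp
  qed
  then show ?case using add by (auto intro: bump_alg.add)
next
  case (mult f g)
  have "pd i (\<lambda>x. f x * g x) x = f x * pd i g x + pd i f x * g x" for i x
  proof -
    have "((\<lambda>x. f x * g x) has_derivative (\<lambda>v. f x * frechet_derivative g (at x) v + frechet_derivative f (at x) v * g x)) (at x)"
      using mult.IH by (intro has_derivative_mult) (auto simp: frechet_derivative_works[symmetric])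
    from pd_eqI[OF this] show ?thesis by (simp add: pd_def)
  qed
  then have "pd i (\<lambda>x. f x * g x) = (\<lambda>x. f x * pd i g x + pd i f x * g x)" for i by blast
  moreover have "(\<lambda>x. f x * pd i g x + pd i f x * g x) \<in> bump_alg r" for i
    using mult by (intro bump_alg.add bump_alg.mult) auto
  moreover have "(\<lambda>x. f x * g x) differentiable at x" for x
    using mult.IH by (intro differentiable_mult) auto
  ultimately show ?case by (simp only:) blast
qed

definition bump :: "real \<Rightarrow> real ^ 'n \<Rightarrow> real" where
  "bump r x = flat 0 (r\<^sup>2 - x \<bullet> x)"

lemma smooth_bump: "smooth (bump r)"
proof (rule smoothI_closed[where A = "bump_alg r"])
  show "bump r \<in> bump_alg r" unfolding bump_def[abs_def] by (rule bump_alg.flat)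
qed (use bump_alg_closed in blast)+

lemma bump_nonneg: "bump r x \<ge> 0"
  by (simp add: bump_def flat_nonneg)

lemma bump_pos: "norm x < r \<Longrightarrow> bump r x > 0"
proof -
  assume "norm x < r"
  then have "(norm x)\<^sup>2 < r\<^sup>2" by (intro power_strict_mono) auto
  then show ?thesis by (simp add: bump_def flat_def power2_norm_eq_inner)
qed

lemma bump_zero: "r > 0 \<Longrightarrow> norm x \<ge> r \<Longrightarrow> bump r x = 0"
proof -
  assume "r > 0" "norm x \<ge> r"
  then have "r\<^sup>2 \<le> (norm x)\<^sup>2" by (intro power_mono) auto
  then show ?thesis by (simp add: bump_def flat_def power2_norm_eq_inner)
qed

lemma test_bump: "r > 0 \<Longrightarrow> test_fun (bump r)"
  by (rule test_funI[of _ r]) (auto simp: smooth_bump bump_zero)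

lemma bump_lower_bound:
  assumes "s < r" "s \<ge> 0"
  obtains m where "m > 0" "\<And>x :: real ^ 'n. norm x \<le> s \<Longrightarrow> bump r x \<ge> m"
proof -
  have "\<exists>x\<in>cball 0 s. \<forall>y\<in>cball 0 s. bump r (x :: real ^ 'n) \<le> bump r (y :: real ^ 'n)"
    using assms by (intro continuous_attains_inf smooth_continuous_on smooth_bump) auto
  then obtain x :: "real ^ 'n" where x: "norm x \<le> s" "\<And>y :: real ^ 'n. norm y \<le> s \<Longrightarrow> bump r x \<le> bump r y"
    by auto
  then show ?thesis using that[of "bump r x"] bump_pos[of x r] assms by auto
qed

text \<open>Only a majorant of the indicator of the ball is wanted, so a bump divided by a positive
  lower bound on the smaller ball is enough.\<close>

lemma ex_cutoff:
  obtains \<theta> :: "real ^ 'n \<Rightarrow> real" where "test_fun \<theta>" "\<And>x. \<theta> x \<ge> 0" "\<And>x. norm x \<le> R \<Longrightarrow> \<theta> x \<ge> 1"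
proof -
  \<comment> \<open>The maximum with \<open>0\<close> covers negative \<open>R\<close>, for which
    the requirement on the ball is void.\<close>
  define s where "s = max R 0"
  obtain m where m: "m > 0" "\<And>x :: real ^ 'n. norm x \<le> s \<Longrightarrow> bump (s + 1) x \<ge> m"
    using bump_lower_bound[of s "s + 1"] by (auto simp: s_def)
  show ?thesis
  proof (rule that[of "\<lambda>x. 1 / m * bump (s + 1) x"])
    show "test_fun (\<lambda>x :: real ^ 'n. 1 / m * bump (s + 1) x)" by (intro test_cmult test_bump) (simp add: s_def)
    show "1 / m * bump (s + 1) x \<ge> 0" for x :: "real ^ 'n"
      using m(1) bump_nonneg by (intro mult_nonneg_nonneg) auto
    show "1 / m * bump (s + 1) x \<ge> 1" if "norm x \<le> R" for x :: "real ^ 'n"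
      using m(1) m(2)[of x] that by (simp add: s_def)
  qed
qed

lemma integrable_bounded_support:
  fixes f :: "real ^ 'n \<Rightarrow> real"
  assumes "f \<in> borel_measurable lebesgue" "\<And>x. \<bar>f x\<bar> \<le> B" "\<And>x. norm x > r \<Longrightarrow> f x = 0"
  shows "integrable lebesgue f"
proof (rule integrableI_bounded_set[where A = "cball 0 r" and B = B])
  show "emeasure lebesgue (cball 0 r :: (real ^ 'n) set) < \<infinity>"
    using emeasure_compact_finite[of "cball 0 r :: (real ^ 'n) set"] by simp
qed (use assms in auto)

lemma test_measurable: "test_fun \<phi> \<Longrightarrow> \<phi> \<in> borel_measurable borel"
  by (intro borel_measurable_continuous_onI smooth_continuous_on test_smooth)

lemma test_measurable_leb: "test_fun \<phi> \<Longrightarrow> \<phi> \<in> borel_measurable lebesgue"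
  by (rule measurable_completion) (simp add: test_measurable)

lemma test_integrable: "test_fun \<phi> \<Longrightarrow> integrable lebesgue \<phi>"
proof -
  assume t: "test_fun \<phi>"
  obtain B where "\<And>x. \<bar>\<phi> x\<bar> \<le> B" using test_bounded[OF t] by metis
  moreover obtain r where "\<And>x. norm x \<ge> r \<Longrightarrow> \<phi> x = 0" using test_fun_support[OF t] by metis
  ultimately show ?thesis
    by (intro integrable_bounded_support[of \<phi> B r] test_measurable_leb t) auto
qed

text \<open>The bump is radial, which gives the evenness by which \<open>\<rho> (y - x)\<close> and
  \<open>\<rho> (x - y)\<close> are interchanged. Its integral is positive because the bump has a
  positive lower bound on the half ball.\<close>

lemma ex_mollifier:
  assumes "\<epsilon> > 0"
  obtains \<rho> :: "real ^ 'n \<Rightarrow> real" where "test_fun \<rho>" "\<And>x. \<rho> x \<ge> 0" "\<And>x. norm x \<ge> \<epsilon> \<Longrightarrow> \<rho> x = 0"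
    "integral\<^sup>L lebesgue \<rho> = 1" "\<And>x. \<rho> (- x) = \<rho> x"
proof -
  let ?b = "bump \<epsilon> :: real ^ 'n \<Rightarrow> real"
  define I where "I = integral\<^sup>L lebesgue ?b"
  obtain m where m: "m > 0" "\<And>x :: real ^ 'n. norm x \<le> \<epsilon> / 2 \<Longrightarrow> bump \<epsilon> x \<ge> m"
    using bump_lower_bound[of "\<epsilon> / 2" \<epsilon>] assms by auto
  have "0 < m * measure lebesgue (cball 0 (\<epsilon> / 2) :: (real ^ 'n) set)"
    using m(1) assms by (simp add: content_cball_pos)
  also have "\<dots> = integral\<^sup>L lebesgue (\<lambda>x :: real ^ 'n. m * indicator (cball 0 (\<epsilon> / 2)) x :: real)" by simp
  also have "\<dots> \<le> I"
    unfolding I_def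
  proof (rule integral_mono)
    show "integrable lebesgue ?b" by (rule test_integrable[OF test_bump[OF assms]])
    show "integrable lebesgue (\<lambda>x :: real ^ 'n. m * indicator (cball 0 (\<epsilon> / 2)) x :: real)"
      using emeasure_compact_finite[of "cball 0 (\<epsilon> / 2) :: (real ^ 'n) set"]
      by (intro integrable_mult_right integrable_real_indicator) auto
  qed (use m bump_nonneg in \<open>auto simp: indicator_def\<close>)
  finally have I: "I > 0" .
  show ?thesis
  proof (rule that[of "\<lambda>x. 1 / I * bump \<epsilon> x"])
    show "test_fun (\<lambda>x :: real ^ 'n. 1 / I * bump \<epsilon> x)" by (intro test_cmult test_bump assms)
    show "(LINT x|lebesgue. 1 / I * ?b x) = 1" using I by (simp add: I_def)
    show "1 / I * ?b x \<ge> 0" for x using I bump_nonneg by (intro mult_nonneg_nonneg) auto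
  qed (use bump_zero[OF assms] in \<open>auto simp: bump_def\<close>)
qed


section \<open>Integration by parts and singular integrals\<close>

lemma lborel_integral_translate:
  fixes f :: "real ^ 'n \<Rightarrow> real"
  assumes "f \<in> borel_measurable borel"
  shows "(LINT x|lborel. f (x + a)) = integral\<^sup>L lborel f"
    and "integrable lborel f \<Longrightarrow> integrable lborel (\<lambda>x. f (x + a))"
proof -
  have "integral\<^sup>L (distr lborel borel ((+) a)) f = (LINT x|lborel. f (a + x))"
    by (rule integral_distr) (use assms in auto)
  then show "(LINT x|lborel. f (x + a)) = integral\<^sup>L lborel f"
    by (simp only: lborel_distr_plus add.commute)
  have "integrable (distr lborel borel ((+) a)) f \<longleftrightarrow> integrable lborel (\<lambda>x. f (a + x))"
    by (rule integrable_distr_eq) (use assms in auto)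
  then show "integrable lborel f \<Longrightarrow> integrable lborel (\<lambda>x. f (x + a))"
    by (simp only: lborel_distr_plus add.commute)
qed

lemma lipschitz_measurable:
  fixes f :: "real ^ 'n \<Rightarrow> real"
  assumes "\<And>x y. \<bar>f x - f y\<bar> \<le> L * norm (x - y)"
  shows "f \<in> borel_measurable borel"
proof (rule borel_measurable_continuous_onI)
  have "L \<ge> 0"
  proof (rule ccontr)
    assume "\<not> L \<ge> 0"
    then have "L * norm (axis undefined (1::real) :: real ^ 'n) < 0" by (simp add: norm_axis_1)
    then show False using assms[of "axis undefined 1" 0] by simp
  qed
  then have "L-lipschitz_on UNIV f" using assms by (intro lipschitz_onI) (auto simp: dist_norm)
  then show "continuous_on UNIV f" by (rule lipschitz_on_continuous_on)
qed

lemma integrable_bounded_support_borel: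
  fixes f :: "real ^ 'n \<Rightarrow> real"
  assumes "f \<in> borel_measurable borel" "\<And>x. \<bar>f x\<bar> \<le> B" "\<And>x. norm x > r \<Longrightarrow> f x = 0"
  shows "integrable lborel f"
proof (rule integrableI_bounded_set[where A = "cball 0 r" and B = B])
  show "emeasure lborel (cball 0 r :: (real ^ 'n) set) < \<infinity>"
    using emeasure_compact_finite[of "cball 0 r :: (real ^ 'n) set"] by simp
qed (use assms in auto)

text \<open>The difference quotients of a compactly supported Lipschitz function have integral zero by
  translation invariance, and they converge dominatedly to the derivative.\<close>

lemma integral_line_derivative_zero:
  fixes f g :: "real ^ 'n \<Rightarrow> real"
  assumes f: "\<And>x y. \<bar>f x - f y\<bar> \<le> L * norm (x - y)" and f0: "\<And>x. norm x \<ge> r \<Longrightarrow> f x = 0"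
    and e: "norm e = 1" and g: "g \<in> borel_measurable borel"
    and d: "AE x in lborel. ((\<lambda>t. f (x + t *\<^sub>R e)) has_real_derivative g x) (at 0)"
  shows "integrable lborel g" "integral\<^sup>L lborel g = 0"
proof -
  define h where "h n = 1 / real (Suc n)" for n
  define s where "s n x = (f (x + h n *\<^sub>R e) - f x) / h n" for n x
  have h: "h n > 0" "h n \<le> 1" for n by (auto simp: h_def)
  have h0: "h \<longlonglongrightarrow> 0" unfolding h_def[abs_def] by (rule LIMSEQ_Suc[OF lim_1_over_n])
  have fm[measurable]: "f \<in> borel_measurable borel" using f by (rule lipschitz_measurable)
  have sm: "s n \<in> borel_measurable lborel" for n unfolding s_def by measurable
  have gm: "g \<in> borel_measurable lborel" using g by simp
  have lim: "AE x in lborel. (\<lambda>n. s n x) \<longlonglongrightarrow> g x"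
    using d
  proof eventually_elim
    case (elim x)
    then have "((\<lambda>t. (f (x + t *\<^sub>R e) - f x) / t) \<longlongrightarrow> g x) (at 0)"
      by (simp add: DERIV_def)
    moreover have "filterlim h (at 0) sequentially"
      using h0 h(1) by (auto simp: filterlim_at less_imp_neq[symmetric] intro!: always_eventually)
    ultimately show ?case unfolding s_def by (rule filterlim_compose)
  qed
  have bd: "\<bar>s n x\<bar> \<le> L * indicator (cball 0 (r + 1)) x" for n x
  proof (cases "x \<in> cball 0 (r + 1)")
    case True
    have "\<bar>f (x + h n *\<^sub>R e) - f x\<bar> \<le> L * h n"
      using f[of "x + h n *\<^sub>R e" x] e h[of n] by simp
    then show ?thesis using True h[of n] by (simp add: s_def abs_divide field_simps)
  next
    case False
    then have "norm x > r + 1" by simp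
    moreover have "norm x - norm (h n *\<^sub>R e) \<le> norm (x + h n *\<^sub>R e)" by (rule norm_diff_ineq)
    then have "norm x - 1 \<le> norm (x + h n *\<^sub>R e)" using e h[of n] by simp
    ultimately show ?thesis using f0[of x] f0[of "x + h n *\<^sub>R e"] False by (simp add: s_def)
  qed
  have w: "integrable lborel (\<lambda>x :: real ^ 'n. L * indicator (cball 0 (r + 1)) x)"
    using emeasure_compact_finite[of "cball 0 (r + 1) :: (real ^ 'n) set"]
    by (intro integrable_mult_right integrable_real_indicator) auto
  have bd': "AE x in lborel. norm (s n x) \<le> L * indicator (cball 0 (r + 1)) x" for n
    using bd by simp
  show "integrable lborel g"
    by (rule integrable_dominated_convergence[OF gm sm w lim bd'])
  have L: "L \<ge> 0" using f[of "e" 0] e by simp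
  have fi: "integrable lborel f"
  proof (rule integrable_bounded_support_borel[OF fm, where B = "2 * L * (\<bar>r\<bar> + 1)" and r = r])
    fix x show "\<bar>f x\<bar> \<le> 2 * L * (\<bar>r\<bar> + 1)"
    proof (cases "norm x \<ge> r")
      case False
      \<comment> \<open>The point \<open>\<bar>r\<bar> *\<^sub>R e\<close> is a zero of
        \<open>f\<close> at bounded distance from \<open>x\<close>, so the Lipschitz condition alone
        bounds \<open>f\<close>.\<close>
      have "f (\<bar>r\<bar> *\<^sub>R e) = 0" using e by (intro f0) simp
      then have "\<bar>f x\<bar> \<le> L * norm (x - \<bar>r\<bar> *\<^sub>R e)" using f[of x "\<bar>r\<bar> *\<^sub>R e"] by simp
      also have "\<dots> \<le> L * (2 * (\<bar>r\<bar> + 1))"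
        using norm_triangle_ineq4[of x "\<bar>r\<bar> *\<^sub>R e"] e False L by (intro mult_left_mono) auto
      finally show ?thesis by (simp only: mult_ac)
    qed (use f0 L in auto)
  qed (use f0 in auto)
  have "integral\<^sup>L lborel (s n) = 0" for n
  proof -
    have "(LINT x|lborel. s n x) = ((LINT x|lborel. f (x + h n *\<^sub>R e)) - (LINT x|lborel. f x)) / h n"
      unfolding s_def using lborel_integral_translate(2)[OF fm fi] fi by simp
    then show ?thesis by (simp only: lborel_integral_translate(1)[OF fm]) simp
  qed
  moreover have "(\<lambda>n. integral\<^sup>L lborel (s n)) \<longlonglongrightarrow> integral\<^sup>L lborel g"
    by (rule integral_dominated_convergence[OF gm sm w lim bd'])
  ultimately show "integral\<^sup>L lborel g = 0" by (simp add: LIMSEQ_const_iff)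
qed

section \<open>Locally Lipschitz functions and integration by parts\<close>

definition loc_lip :: "(real ^ 'n \<Rightarrow> real) \<Rightarrow> bool" where
  "loc_lip H \<longleftrightarrow> (\<forall>r. \<exists>L\<ge>0. \<forall>x y. norm x \<le> r \<longrightarrow> norm y \<le> r \<longrightarrow> \<bar>H x - H y\<bar> \<le> L * norm (x - y))"

lemma loc_lip_translate:
  assumes "loc_lip H" shows "loc_lip (\<lambda>x. H (x - a))"
  unfolding loc_lip_def
proof
  fix r
  obtain L where L: "L \<ge> 0" "\<And>x y. norm x \<le> r + norm a \<Longrightarrow> norm y \<le> r + norm a \<Longrightarrow> \<bar>H x - H y\<bar> \<le> L * norm (x - y)"
    using assms unfolding loc_lip_def by metis
  have "\<bar>H (x - a) - H (y - a)\<bar> \<le> L * norm (x - y)" if "norm x \<le> r" "norm y \<le> r" for x y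
    using L(2)[of "x - a" "y - a"] that norm_triangle_ineq4[of x a] norm_triangle_ineq4[of y a] by simp
  then show "\<exists>L\<ge>0. \<forall>x y. norm x \<le> r \<longrightarrow> norm y \<le> r \<longrightarrow> \<bar>H (x - a) - H (y - a)\<bar> \<le> L * norm (x - y)"
    using L(1) by blast
qed

lemma loc_lip_bounded:
  assumes "loc_lip H"
  obtains M where "M \<ge> 0" "\<And>x. norm x \<le> r \<Longrightarrow> \<bar>H x\<bar> \<le> M"
proof -
  define s where "s = \<bar>r\<bar>"
  obtain L where L: "L \<ge> 0" "\<And>x y. norm x \<le> s \<Longrightarrow> norm y \<le> s \<Longrightarrow> \<bar>H x - H y\<bar> \<le> L * norm (x - y)"
    using assms unfolding loc_lip_def by metis
  have s: "s \<ge> 0" by (simp add: s_def)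
  have "\<bar>H x\<bar> \<le> \<bar>H 0\<bar> + L * s" if "norm x \<le> r" for x
  proof -
    have x: "norm x \<le> s" using that by (simp add: s_def)
    have "\<bar>H x - H 0\<bar> \<le> L * norm x" using L(2)[of x 0] x s by simp
    also have "\<dots> \<le> L * s" using x L(1) by (rule mult_left_mono)
    finally show ?thesis by linarith
  qed
  then show ?thesis using that[of "\<bar>H 0\<bar> + L * s"] L(1) s by simp
qed

lemma loc_lip_continuous:
  fixes H :: "real ^ 'n \<Rightarrow> real"
  assumes "loc_lip H" shows "continuous_on UNIV H"
proof (rule continuous_at_imp_continuous_on, rule ballI)
  fix x :: "real ^ 'n"
  obtain L where L: "L \<ge> 0" "\<And>y z. norm y \<le> norm x + 1 \<Longrightarrow> norm z \<le> norm x + 1 \<Longrightarrow> \<bar>H y - H z\<bar> \<le> L * norm (y - z)"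
    using assms unfolding loc_lip_def by metis
  have "L-lipschitz_on (ball x 1) H"
  proof (rule lipschitz_onI)
    fix y z assume "y \<in> ball x 1" "z \<in> ball x 1"
    then have "norm y \<le> norm x + 1" "norm z \<le> norm x + 1"
      using norm_triangle_ineq2[of y x] norm_triangle_ineq2[of z x]
      by (auto simp: dist_norm norm_minus_commute)
    then show "dist (H y) (H z) \<le> L * dist y z" using L(2)[of y z] by (simp add: dist_norm)
  qed fact
  then have "continuous_on (ball x 1) H" by (rule lipschitz_on_continuous_on)
  then show "isCont H x" by (simp add: continuous_on_eq_continuous_at)
qed

lemma loc_lip_measurable: "loc_lip H \<Longrightarrow> H \<in> borel_measurable borel"
  by (intro borel_measurable_continuous_onI loc_lip_continuous)

text \<open>Product rule for increments. One of the two points may be assumed to lie in the ball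
  outside which \<open>u\<close> vanishes, and only there is \<open>H\<close> controlled; if the
  other point lies outside, the term with the increment of \<open>H\<close> drops out.\<close>

lemma lipschitz_mult_compact:
  fixes u H :: "real ^ 'n \<Rightarrow> real"
  assumes u: "test_fun u" and H: "loc_lip H"
  obtains L r where "\<And>x y. \<bar>u x * H x - u y * H y\<bar> \<le> L * norm (x - y)" "\<And>x. norm x \<ge> r \<Longrightarrow> u x = 0"
proof -
  obtain r where r: "\<And>x. norm x \<ge> r \<Longrightarrow> u x = 0" using test_fun_support[OF u] by metis
  obtain L where L: "L \<ge> 0" "\<And>x y. norm x \<le> r \<Longrightarrow> norm y \<le> r \<Longrightarrow> \<bar>H x - H y\<bar> \<le> L * norm (x - y)"
    using H unfolding loc_lip_def by metis
  obtain M where M: "M \<ge> 0" "\<And>x. norm x \<le> r \<Longrightarrow> \<bar>H x\<bar> \<le> M" using loc_lip_bounded[OF H] by metis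
  obtain K where K: "K > 0" "\<And>x y. \<bar>u x - u y\<bar> \<le> K * norm (x - y)" using test_lipschitz[OF u] by metis
  obtain B where B: "B > 0" "\<And>x. \<bar>u x\<bar> \<le> B" using test_bounded[OF u] by metis
  let ?C = "K * M + B * L"
  have C: "?C \<ge> 0" using K(1) M(1) B(1) L(1) by simp
  have one: "\<bar>u x * H x - u y * H y\<bar> \<le> ?C * norm (x - y)" if x: "norm x \<le> r" for x y
  proof (cases "norm y \<le> r")
    case True
    have "u x * H x - u y * H y = (u x - u y) * H x + u y * (H x - H y)" by (simp add: algebra_simps)
    also have "\<bar>\<dots>\<bar> \<le> \<bar>u x - u y\<bar> * \<bar>H x\<bar> + \<bar>u y\<bar> * \<bar>H x - H y\<bar>"
      by (rule order_trans[OF abs_triangle_ineq]) (simp add: abs_mult)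
    also have "\<dots> \<le> K * norm (x - y) * M + B * (L * norm (x - y))"
      using K B M L x True by (intro add_mono mult_mono) auto
    finally show ?thesis by (simp add: algebra_simps)
  next
    case False
    then have "u x * H x - u y * H y = (u x - u y) * H x" using r by simp
    then have "\<bar>u x * H x - u y * H y\<bar> \<le> K * norm (x - y) * M"
      using K M x by (simp add: abs_mult mult_mono)
    also have "\<dots> \<le> K * norm (x - y) * M + B * (L * norm (x - y))" using B L by simp
    finally show ?thesis by (simp add: algebra_simps)
  qed
  show ?thesis
  proof (rule that[OF _ r])
    fix x y
    show "\<bar>u x * H x - u y * H y\<bar> \<le> ?C * norm (x - y)"
    proof (cases "norm x \<le> r")
      case False
      show ?thesis
      proof (cases "norm y \<le> r")
        case True
        then show ?thesis using one[of y x] by (simp add: norm_minus_commute abs_minus_commute)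
      next
        case False
        then show ?thesis using r[of x] r[of y] \<open>\<not> norm x \<le> r\<close> C by simp
      qed
    qed (rule one)
  qed
qed

text \<open>Apply \<open>integral_line_derivative_zero\<close> to the product of \<open>u\<close>
  and \<open>H\<close>, which is globally Lipschitz with bounded support. The derivative of
  \<open>H\<close> is asked for only almost everywhere, since the gradient of the truncated kernel
  has a kink on a sphere.\<close>

lemma integral_by_parts:
  fixes u H H' :: "real ^ 'n \<Rightarrow> real"
  assumes u: "test_fun u" and H: "loc_lip H" and H'[measurable]: "H' \<in> borel_measurable borel"
    and d: "AE x in lborel. ((\<lambda>t. H (x + t *\<^sub>R axis i 1)) has_real_derivative H' x) (at 0)"
  shows "integrable lborel (\<lambda>x. pd i u x * H x)" "integrable lborel (\<lambda>x. u x * H' x)"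
    "(LINT x|lborel. u x * H' x) = - (LINT x|lborel. pd i u x * H x)"
proof -
  obtain L r where L: "\<And>x y. \<bar>u x * H x - u y * H y\<bar> \<le> L * norm (x - y)" and r: "\<And>x. norm x \<ge> r \<Longrightarrow> u x = 0"
    using lipschitz_mult_compact[OF u H] by metis
  have [measurable]: "u \<in> borel_measurable borel" "pd i u \<in> borel_measurable borel" "H \<in> borel_measurable borel"
    using u H by (simp_all add: test_measurable test_pd loc_lip_measurable)
  let ?g = "\<lambda>x. pd i u x * H x + u x * H' x"
  have dd: "AE x in lborel. ((\<lambda>t. u (x + t *\<^sub>R axis i 1) * H (x + t *\<^sub>R axis i 1)) has_real_derivative ?g x) (at 0)"
    using d
  proof eventually_elim
    case (elim x)
    have "((\<lambda>t. u (x + t *\<^sub>R axis i 1)) has_real_derivative pd i u (x + 0 *\<^sub>R axis i 1)) (at 0)"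
      by (rule pd_line_derivative) (simp add: smooth_differentiable test_smooth u)
    from DERIV_mult[OF this elim] show ?case by (simp add: mult.commute)
  qed
  have gm: "?g \<in> borel_measurable borel" by measurable
  have g0: "u x * H x = 0" if "norm x \<ge> r" for x using r[OF that] by simp
  note z = integral_line_derivative_zero[OF L g0 _ gm dd]
  have gi: "integrable lborel ?g" and g_zero: "integral\<^sup>L lborel ?g = 0"
    using z by (simp_all add: norm_axis_1)
  obtain B where B: "B > 0" "\<And>x. \<bar>pd i u x\<bar> \<le> B" using test_bounded[OF test_pd[OF u]] by metis
  obtain M where M: "M \<ge> 0" "\<And>x. norm x \<le> r \<Longrightarrow> \<bar>H x\<bar> \<le> M" using loc_lip_bounded[OF H] by metis
  have pz: "pd i u x = 0" if "norm x > r" for x using pd_zero_norm[of r u x i] r that by blast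
  show 1: "integrable lborel (\<lambda>x. pd i u x * H x)"
  proof (rule integrable_bounded_support_borel[where B = "B * M" and r = r])
    fix x show "\<bar>pd i u x * H x\<bar> \<le> B * M"
    proof (cases "norm x > r")
      case True
      then show ?thesis using pz B(1) M(1) by simp
    next
      case False
      then show ?thesis using B M(1) M(2)[of x] by (simp add: abs_mult mult_mono)
    qed
  qed (use pz in auto)
  have "integrable lborel (\<lambda>x. ?g x - pd i u x * H x)" using gi 1 by (rule Bochner_Integration.integrable_diff)
  then show 2: "integrable lborel (\<lambda>x. u x * H' x)" by simp
  show "(LINT x|lborel. u x * H' x) = - (LINT x|lborel. pd i u x * H x)"
    using g_zero Bochner_Integration.integral_add[OF 1 2] by simp
qed

text \<open>Integrating first in \<open>x\<close>, translation invariance bounds the inner integral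
  by \<open>A\<close> times the integral of the modulus of \<open>k\<close> times
  \<open>\<bar>b y\<bar>\<close>, which is integrable in \<open>y\<close>. This licenses the
  exchange of integrals in the pairing of a potential.\<close>

lemma integrable_conv_pair:
  fixes k a b :: "real ^ 'n \<Rightarrow> real"
  assumes k: "integrable lborel k" and b: "integrable lborel b"
    and a[measurable]: "a \<in> borel_measurable borel" and A: "\<And>x. \<bar>a x\<bar> \<le> A"
  shows "integrable (lborel \<Otimes>\<^sub>M lborel) (\<lambda>(y, x). k (x - y) * a x * b y)"
proof -
  have [measurable]: "k \<in> borel_measurable borel" "b \<in> borel_measurable borel"
    using k b borel_measurable_integrable by fastforce+
  have kt: "integrable lborel (\<lambda>x. k (x - y))" for y
    using lborel_integral_translate(2)[of k "- y"] k by simp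
  have i1: "integrable lborel (\<lambda>x. k (x - y) * a x)" for y
    using A by (intro Bochner_Integration.integrable_bound[OF integrable_mult_right[OF kt, of A y]])
      (auto simp: abs_mult mult.commute intro!: mult_mono order_trans[OF A])
  have A0: "A \<ge> 0" using A[of 0] by linarith
  show ?thesis
  proof (rule lborel_pair.Fubini_integrable)
    show "AE y in lborel. integrable lborel (\<lambda>x. case (y, x) of (y, x) \<Rightarrow> k (x - y) * a x * b y)"
      using i1 by simp
    show "integrable lborel (\<lambda>y. LINT x|lborel. norm (case (y, x) of (y, x) \<Rightarrow> k (x - y) * a x * b y))"
    proof (rule Bochner_Integration.integrable_bound)
      let ?K = "A * (LINT x|lborel. \<bar>k x\<bar>)"
      show "integrable lborel (\<lambda>y. ?K * b y)" using b by simp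
      show "(\<lambda>y. LINT x|lborel. norm (case (y, x) of (y, x) \<Rightarrow> k (x - y) * a x * b y)) \<in> borel_measurable lborel"
        by measurable
      have "(LINT x|lborel. \<bar>k (x - y) * a x * b y\<bar>) \<le> ?K * \<bar>b y\<bar>" for y
      proof -
        have "(LINT x|lborel. \<bar>k (x - y) * a x * b y\<bar>) \<le> (LINT x|lborel. A * \<bar>b y\<bar> * \<bar>k (x - y)\<bar>)"
        proof (rule integral_mono)
          show "integrable lborel (\<lambda>x. \<bar>k (x - y) * a x * b y\<bar>)" using i1[of y] by simp
          show "integrable lborel (\<lambda>x. A * \<bar>b y\<bar> * \<bar>k (x - y)\<bar>)" using kt[of y] by simp
          fix x
          have "\<bar>a x\<bar> * (\<bar>b y\<bar> * \<bar>k (x - y)\<bar>) \<le> A * (\<bar>b y\<bar> * \<bar>k (x - y)\<bar>)"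
            using A by (rule mult_right_mono) simp
          then show "\<bar>k (x - y) * a x * b y\<bar> \<le> A * \<bar>b y\<bar> * \<bar>k (x - y)\<bar>" by (simp add: abs_mult mult_ac)
        qed
        also have "\<dots> = A * \<bar>b y\<bar> * (LINT x|lborel. \<bar>k (x + - y)\<bar>)" by simp
        also have "(LINT x|lborel. \<bar>k (x + - y)\<bar>) = (LINT x|lborel. \<bar>k x\<bar>)"
          by (rule lborel_integral_translate(1)[of "\<lambda>x. \<bar>k x\<bar>"]) measurable
        finally show ?thesis by (simp add: mult_ac)
      qed
      then show "AE y in lborel. norm (LINT x|lborel. norm (case (y, x) of (y, x) \<Rightarrow> k (x - y) * a x * b y)) \<le> norm (?K * b y)"
        using A0 by (simp add: abs_mult integral_nonneg_AE)
    qed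
  qed measurable
qed

lemma ball_borel [measurable]: "ball (x :: real ^ 'n) r \<in> sets borel"
  by simp

text \<open>Dyadic shells replace polar coordinates: in the shell of radii between
  \<open>r (Suc j)\<close> and \<open>r j\<close> the integrand is at most
  \<open>2 ^ ((d - 1) * (j + 1))\<close>, while the volume is at most a constant times
  \<open>r j ^ d\<close>; the products form a geometric series of ratio one half.\<close>

lemma integrable_inverse_norm_power:
  assumes "CARD('n) \<ge> 2"
  shows "integrable lborel (\<lambda>x :: real ^ 'n. indicator (ball 0 1) x / norm x ^ (CARD('n) - 1))"
proof (rule integrableI_bounded)
  let ?d = "CARD('n)"
  let ?c = "\<lambda>j :: nat. 2 ^ (?d - 1) * (2 ^ (?d - 1)) ^ j :: real"
  define r where "r j = (1 / 2 :: real) ^ j" for j :: nat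
  have d: "?d \<ge> 2" by fact
  have pt: "ennreal (norm (indicator (ball 0 1) x / norm x ^ (?d - 1)))
      \<le> (\<Sum>j. ennreal (?c j) * indicator (ball 0 (r j)) x)" for x :: "real ^ 'n"
  proof (cases "x \<in> ball 0 1 \<and> x \<noteq> 0")
    case False
    \<comment> \<open>At the origin the quotient is \<open>1 / 0 = 0\<close>, the exponent
      \<open>CARD('n) - 1\<close> being positive.\<close>
    then show ?thesis
      using d by (cases "x = 0") (auto simp: power_0_left)
  next
    case True
    then have x: "0 < norm x" "norm x < 1" by auto
    have "\<exists>j. r (Suc j) \<le> norm x \<and> norm x < r j"
    proof -
      obtain n where n: "r n < norm x" unfolding r_def using real_arch_pow_inv[OF x(1), of "1/2"] by auto
      define m where "m = (LEAST m. r m \<le> norm x)"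
      have m: "r m \<le> norm x" unfolding m_def by (rule LeastI[of _ n]) (use n in simp)
      have "m \<noteq> 0" using m x by (cases m) (auto simp: r_def)
      then obtain j where j: "m = Suc j" using not0_implies_Suc by blast
      have "\<not> r j \<le> norm x" using not_less_Least[of j "\<lambda>m. r m \<le> norm x"] j by (simp add: m_def)
      then show ?thesis using m j by auto
    qed
    then obtain j where j: "r (Suc j) \<le> norm x" "norm x < r j" by blast
    have "1 / norm x \<le> 1 / r (Suc j)" using j x by (intro divide_left_mono) (auto simp: r_def)
    then have "(1 / norm x) ^ (?d - 1) \<le> (1 / r (Suc j)) ^ (?d - 1)" using x by (intro power_mono) auto
    also have "(1 / r (Suc j)) ^ (?d - 1) = ?c j"
      by (simp add: r_def power_one_over power_mult_distrib power_mult[symmetric] mult.commute)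
    finally have "ennreal (norm (indicator (ball 0 1) x / norm x ^ (?d - 1))) \<le> ennreal (?c j) * indicator (ball 0 (r j)) x"
      using True j by (simp add: power_one_over)
    also have "\<dots> \<le> (\<Sum>j. ennreal (?c j) * indicator (ball 0 (r j)) x)"
    proof -
      have "F j \<le> suminf F" for F :: "nat \<Rightarrow> ennreal" using sum_le_suminf[of F "{j}"] by simp
      then show ?thesis .
    qed
    finally show ?thesis .
  qed
  have "(\<integral>\<^sup>+x. ennreal (norm (indicator (ball 0 1) (x :: real ^ 'n) / norm x ^ (?d - 1))) \<partial>lborel)
      \<le> (\<integral>\<^sup>+x. (\<Sum>j. ennreal (?c j) * indicator (ball 0 (r j)) (x :: real ^ 'n)) \<partial>lborel)"
    by (rule nn_integral_mono) (rule pt)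
  also have "\<dots> = (\<Sum>j. \<integral>\<^sup>+x. ennreal (?c j) * indicator (ball 0 (r j)) (x :: real ^ 'n) \<partial>lborel)"
    by (rule nn_integral_suminf) measurable
  also have "\<dots> = (\<Sum>j. ennreal (?c j) * emeasure lborel (ball 0 (r j) :: (real ^ 'n) set))"
    by (simp add: nn_integral_cmult_indicator)
  also have "\<dots> = (\<Sum>j. ennreal (2 ^ (?d - 1) * unit_ball_vol ?d * (1 / 2) ^ j))"
  proof (rule arg_cong[of _ _ suminf], rule ext)
    fix j
    have "?c j * (unit_ball_vol ?d * r j ^ ?d) = 2 ^ (?d - 1) * unit_ball_vol ?d * (1 / 2) ^ j"
    proof -
      have "(2 ^ (?d - 1)) ^ j * r j ^ ?d = (1 / 2) ^ j"
      proof -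
        have "r j ^ ?d = r j ^ (?d - 1) * r j" using d by (simp flip: power_Suc2)
        moreover have "r j ^ (?d - 1) = ((1 / 2) ^ (?d - 1)) ^ j"
          by (simp add: r_def power_mult[symmetric] mult.commute)
        moreover have "(2 ^ (?d - 1)) ^ j * ((1 / 2) ^ (?d - 1)) ^ j = (1 :: real)"
          by (simp add: power_mult_distrib[symmetric])
        ultimately show ?thesis by (simp add: r_def)
      qed
      then show ?thesis by (simp add: mult_ac)
    qed
    then show "ennreal (?c j) * emeasure lborel (ball 0 (r j) :: (real ^ 'n) set) =
        ennreal (2 ^ (?d - 1) * unit_ball_vol ?d * (1 / 2) ^ j)"
      by (subst emeasure_ball) (auto simp: r_def ennreal_mult'[symmetric])
  qed
  also have "\<dots> < \<infinity>"
  proof -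
    have "summable (\<lambda>j. 2 ^ (?d - 1) * unit_ball_vol ?d * (1 / 2 :: real) ^ j)"
      by (intro summable_mult summable_geometric) simp
    then have "(\<Sum>j. ennreal (2 ^ (?d - 1) * unit_ball_vol ?d * (1 / 2) ^ j)) =
        ennreal (\<Sum>j. 2 ^ (?d - 1) * unit_ball_vol ?d * (1 / 2) ^ j)"
      by (intro suminf_ennreal2) auto
    then show ?thesis by simp
  qed
  finally show "(\<integral>\<^sup>+x. ennreal (norm (indicator (ball 0 1) (x :: real ^ 'n) / norm x ^ (?d - 1))) \<partial>lborel) < \<infinity>" .
qed measurable


section \<open>The truncated Newton kernel\<close>

text \<open>Reciprocal of the surface area of the unit sphere, which is the dimension times the
  volume of the unit ball.\<close>

definition kap :: "('n::finite) itself \<Rightarrow> real" where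
  "kap _ = 1 / (real CARD('n) * measure lborel (ball (0::real ^ 'n) 1))"

definition nprof :: "('n::finite) itself \<Rightarrow> real \<Rightarrow> real" where
  "nprof _ r = (if CARD('n) = 2 then - ln r / (2 * pi) else r powr (2 - real CARD('n)) /
     ((real CARD('n) - 2) * real CARD('n) * measure lborel (ball (0::real ^ 'n) 1)))"

lemma newton_kernel_nprof: "newton_kernel z = nprof TYPE('n) (norm z)" for z :: "real ^ 'n"
  by (simp add: newton_kernel_def nprof_def)

lemma measure_unit_ball: "measure lborel (ball (0::real ^ 'n) 1) = unit_ball_vol (real CARD('n))"
  by (simp add: content_ball)

lemma kap_pos: "kap TYPE('n::finite) > 0"
  by (simp add: kap_def measure_unit_ball)

lemma powr_neg_nat: "r > 0 \<Longrightarrow> r powr (- real n) = 1 / r ^ n"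
  by (simp add: powr_minus powr_realpow divide_inverse)

text \<open>The planar logarithm and the power law in higher dimensions have derivatives of the same
  form, so the truncation at radius \<open>\<epsilon>\<close> can be analysed without distinguishing
  dimensions.\<close>

lemma nprof_deriv:
  assumes d: "CARD('n::finite) \<ge> 2" and r: "r > 0"
  shows "(nprof TYPE('n) has_real_derivative - kap TYPE('n) / r ^ (CARD('n) - 1)) (at r)"
proof (cases "CARD('n) = 2")
  case True
  have "((\<lambda>r. - ln r / (2 * pi)) has_real_derivative - kap TYPE('n) / r ^ (CARD('n) - 1)) (at r)"
    using r True by (auto intro!: derivative_eq_intros simp: kap_def measure_unit_ball unit_ball_vol_2)
  then show ?thesis using True by (simp add: nprof_def[abs_def])
next
  case False
  define d where "d = real CARD('n)"
  define w where "w = measure lborel (ball (0::real ^ 'n) 1)"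
  have d2: "d > 2" using False assms unfolding d_def by linarith
  have w: "w > 0" by (simp add: w_def measure_unit_ball)
  have e: "1 / r ^ (CARD('n) - 1) = r powr (1 - d)"
  proof -
    have "1 - d = - real (CARD('n) - 1)" using assms by (simp add: d_def of_nat_diff)
    then show ?thesis using r by (simp only: powr_neg_nat)
  qed
  have "((\<lambda>r. r powr (2 - d)) has_real_derivative (2 - d) * r powr (2 - d - 1)) (at r)"
    by (rule has_real_derivative_powr[OF r])
  then have "((\<lambda>r. r powr (2 - d) / ((d - 2) * d * w)) has_real_derivative
      (2 - d) * r powr (2 - d - 1) / ((d - 2) * d * w)) (at r)"
    by (rule DERIV_cdivide)
  moreover have "(2 - d) * r powr (2 - d - 1) / ((d - 2) * d * w) = - kap TYPE('n) / r ^ (CARD('n) - 1)"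
  proof -
    have "- kap TYPE('n) / r ^ (CARD('n) - 1) = - kap TYPE('n) * (1 / r ^ (CARD('n) - 1))" by simp
    also have "\<dots> = - (1 / (d * w)) * r powr (1 - d)" by (simp only: e kap_def d_def w_def)
    also have "\<dots> = (2 - d) * r powr (2 - d - 1) / ((d - 2) * d * w)"
      using d2 w by (simp add: divide_simps) (simp add: algebra_simps)
    finally show ?thesis by simp
  qed
  ultimately show ?thesis using False by (simp add: nprof_def[abs_def] d_def w_def)
qed

lemma lipschitz_on_halfline:
  fixes f f' :: "real \<Rightarrow> real"
  assumes "\<And>x. x \<ge> \<epsilon> \<Longrightarrow> (f has_real_derivative f' x) (at x)" "\<And>x. x \<ge> \<epsilon> \<Longrightarrow> \<bar>f' x\<bar> \<le> C"
    "a \<ge> \<epsilon>" "b \<ge> \<epsilon>"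
  shows "\<bar>f a - f b\<bar> \<le> C * \<bar>a - b\<bar>"
  using field_differentiable_bound[of "{\<epsilon>..}" f f' C a b] assms
  by (auto simp: has_field_derivative_at_within)

text \<open>Inside the ball of radius \<open>\<epsilon>\<close> the kernel is continued by its tangent paraboloid. This makes
  it a \<open>C\<^sup>1\<^sup>,\<^sup>1\<close> function: the potential of the uniform unit mass on that ball.\<close>

definition tprof :: "('n::finite) itself \<Rightarrow> real \<Rightarrow> real \<Rightarrow> real" where
  "tprof T \<epsilon> r = (if r \<ge> \<epsilon> then nprof T r
     else nprof T \<epsilon> + kap T * (\<epsilon>\<^sup>2 - r\<^sup>2) / (2 * \<epsilon> ^ CARD('n)))"

definition trunc_kernel :: "real \<Rightarrow> real ^ 'n \<Rightarrow> real" where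
  "trunc_kernel \<epsilon> z = tprof TYPE('n) \<epsilon> (norm z)"

text \<open>The paraboloid is steepest at radius \<open>\<epsilon>\<close>, where it has the slope
  of the kernel, and the kernel becomes flatter outside. One constant thus serves on both sides, and
  radii separated by \<open>\<epsilon>\<close> are compared through
  \<open>\<epsilon>\<close>.\<close>

lemma tprof_lipschitz:
  assumes d: "CARD('n::finite) \<ge> 2" and \<epsilon>: "\<epsilon> > 0" and rs: "r \<ge> 0" "s \<ge> 0"
  shows "\<bar>tprof TYPE('n) \<epsilon> r - tprof TYPE('n) \<epsilon> s\<bar> \<le> kap TYPE('n) / \<epsilon> ^ (CARD('n) - 1) * \<bar>r - s\<bar>"
proof -
  let ?C = "kap TYPE('n) / \<epsilon> ^ (CARD('n) - 1)" and ?p = "tprof TYPE('n) \<epsilon>"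
  let ?q = "\<lambda>r. nprof TYPE('n) \<epsilon> + kap TYPE('n) * (\<epsilon>\<^sup>2 - r\<^sup>2) / (2 * \<epsilon> ^ CARD('n))"
  have outer: "\<bar>?p a - ?p b\<bar> \<le> ?C * \<bar>a - b\<bar>" if "a \<ge> \<epsilon>" "b \<ge> \<epsilon>" for a b
  proof -
    have "\<bar>nprof TYPE('n) a - nprof TYPE('n) b\<bar> \<le> ?C * \<bar>a - b\<bar>"
    proof (rule lipschitz_on_halfline[OF _ _ that])
      fix x assume x: "x \<ge> \<epsilon>"
      show "(nprof TYPE('n) has_real_derivative - kap TYPE('n) / x ^ (CARD('n) - 1)) (at x)"
        using nprof_deriv[OF d] x \<epsilon> by simp
      show "\<bar>- kap TYPE('n) / x ^ (CARD('n) - 1)\<bar> \<le> ?C"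
        using x \<epsilon> kap_pos[where 'n = 'n]
        by (auto simp: abs_divide intro!: divide_left_mono power_mono)
    qed
    then show ?thesis using that by (simp add: tprof_def)
  qed
  have pq: "?p a = ?q a" if "a \<le> \<epsilon>" for a
    using that by (cases "a = \<epsilon>") (auto simp: tprof_def)
  have inner: "\<bar>?p a - ?p b\<bar> \<le> ?C * \<bar>a - b\<bar>" if "a \<le> \<epsilon>" "b \<le> \<epsilon>" "a \<ge> 0" "b \<ge> 0" for a b
  proof -
    define c where "c = kap TYPE('n) / (2 * \<epsilon> ^ CARD('n))"
    have c: "c > 0" using kap_pos[where 'n = 'n] \<epsilon> by (simp add: c_def)
    have "?p a - ?p b = c * ((b + a) * (b - a))"
      unfolding pq[OF that(1)] pq[OF that(2)] c_def by (simp add: power2_eq_square diff_divide_distrib algebra_simps)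
    then have "\<bar>?p a - ?p b\<bar> = c * ((b + a) * \<bar>a - b\<bar>)"
      using c that by (simp add: abs_mult abs_minus_commute)
    also have "\<dots> \<le> c * ((2 * \<epsilon>) * \<bar>a - b\<bar>)"
      using c that by (intro mult_left_mono mult_right_mono) auto
    also have "\<dots> = ?C * \<bar>a - b\<bar>"
    proof -
      have "\<epsilon> ^ CARD('n) = \<epsilon> * \<epsilon> ^ (CARD('n) - 1)" using d by (simp flip: power_Suc)
      then show ?thesis using \<epsilon> by (simp add: c_def)
    qed
    finally show ?thesis .
  qed
  have mixed: "\<bar>?p a - ?p b\<bar> \<le> ?C * \<bar>a - b\<bar>" if "0 \<le> a" "a \<le> \<epsilon>" "\<epsilon> \<le> b" for a b
  proof -
    have "\<bar>?p a - ?p b\<bar> \<le> \<bar>?p a - ?p \<epsilon>\<bar> + \<bar>?p \<epsilon> - ?p b\<bar>" by linarith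
    also have "\<dots> \<le> ?C * \<bar>a - \<epsilon>\<bar> + ?C * \<bar>\<epsilon> - b\<bar>"
      using that \<epsilon> by (intro add_mono inner outer) auto
    also have "\<dots> = ?C * (\<bar>a - \<epsilon>\<bar> + \<bar>\<epsilon> - b\<bar>)" by (simp only: distrib_left)
    also have "\<bar>a - \<epsilon>\<bar> + \<bar>\<epsilon> - b\<bar> = \<bar>a - b\<bar>" using that by simp
    finally show ?thesis .
  qed
  consider "r \<ge> \<epsilon> \<and> s \<ge> \<epsilon>" | "r \<le> \<epsilon> \<and> s \<le> \<epsilon>" | "r \<le> \<epsilon> \<and> \<epsilon> \<le> s" | "s \<le> \<epsilon> \<and> \<epsilon> \<le> r" by linarith
  then show ?thesis
  proof cases
    case 4
    then show ?thesis using mixed[of s r] rs by (simp add: abs_minus_commute)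
  qed (use outer inner mixed rs in auto)
qed

lemma loc_lip_trunc_kernel:
  assumes d: "CARD('n) \<ge> 2" and \<epsilon>: "\<epsilon> > 0"
  shows "loc_lip (trunc_kernel \<epsilon> :: real ^ 'n \<Rightarrow> real)"
  unfolding loc_lip_def
proof
  let ?C = "kap TYPE('n) / \<epsilon> ^ (CARD('n) - 1)"
  have C: "?C \<ge> 0" using kap_pos[where 'n = 'n] \<epsilon> by simp
  have "\<bar>trunc_kernel \<epsilon> x - trunc_kernel \<epsilon> y\<bar> \<le> ?C * norm (x - y)" for x y :: "real ^ 'n"
  proof -
    have "\<bar>trunc_kernel \<epsilon> x - trunc_kernel \<epsilon> y\<bar> \<le> ?C * \<bar>norm x - norm y\<bar>"
      unfolding trunc_kernel_def by (rule tprof_lipschitz[OF d \<epsilon>]) auto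
    also have "\<dots> \<le> ?C * norm (x - y)" using C by (intro mult_left_mono norm_triangle_ineq3)
    finally show ?thesis .
  qed
  then show "\<exists>L\<ge>0. \<forall>x y :: real ^ 'n. norm x \<le> r \<longrightarrow> norm y \<le> r \<longrightarrow>
      \<bar>trunc_kernel \<epsilon> x - trunc_kernel \<epsilon> y\<bar> \<le> L * norm (x - y)" for r
    using C by blast
qed

text \<open>The maximum fuses the gradient of the kernel outside the ball with the linear gradient
  of the paraboloid inside, and makes visible that they agree on the sphere of radius
  \<open>\<epsilon>\<close>.\<close>

definition trunc_grad :: "real \<Rightarrow> 'n \<Rightarrow> real ^ 'n \<Rightarrow> real" where
  "trunc_grad \<epsilon> i z = - kap TYPE('n) * (z $ i / (max (norm z) \<epsilon>) ^ CARD('n))"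

text \<open>The power \<open>1 / s ^ d\<close> is Lipschitz for \<open>s \<ge> \<epsilon>\<close>,
  the maximum with \<open>\<epsilon>\<close> does not increase distances, and the factor
  \<open>z $ i\<close> is bounded on bounded sets; the last point makes the constant depend on
  \<open>r\<close>.\<close>

lemma loc_lip_trunc_grad:
  assumes \<epsilon>: "\<epsilon> > 0"
  shows "loc_lip (trunc_grad \<epsilon> i :: real ^ 'n \<Rightarrow> real)"
  unfolding loc_lip_def
proof
  fix r :: real
  let ?d = "CARD('n)"
  define m where "m z = 1 / (max (norm z) \<epsilon>) ^ ?d" for z :: "real ^ 'n"
  define C where "C = real ?d / \<epsilon> ^ (?d + 1)"
  have C: "C \<ge> 0" using \<epsilon> by (simp add: C_def)
  have m1: "\<bar>m z\<bar> \<le> 1 / \<epsilon> ^ ?d" for z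
    using \<epsilon> by (auto simp: m_def abs_divide intro!: divide_left_mono power_mono)
  have m2: "\<bar>m x - m y\<bar> \<le> C * norm (x - y)" for x y
  proof -
    have "\<bar>1 / (max (norm x) \<epsilon>) ^ ?d - 1 / (max (norm y) \<epsilon>) ^ ?d\<bar> \<le> C * \<bar>max (norm x) \<epsilon> - max (norm y) \<epsilon>\<bar>"
    proof (rule lipschitz_on_halfline[where f = "\<lambda>s. 1 / s ^ ?d" and f' = "\<lambda>s. - (real ?d * s ^ (?d - Suc 0)) / (s ^ ?d * s ^ ?d)" and \<epsilon> = \<epsilon>])
      fix s assume s: "s \<ge> \<epsilon>"
      show "((\<lambda>s. 1 / s ^ ?d) has_real_derivative - (real ?d * s ^ (?d - Suc 0)) / (s ^ ?d * s ^ ?d)) (at s)"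
      proof -
        have a: "((\<lambda>s. 1) has_real_derivative 0) (at s)" by simp
        have b: "((\<lambda>s. s ^ ?d) has_real_derivative real ?d * s ^ (?d - Suc 0)) (at s)" by (rule DERIV_pow)
        show ?thesis using DERIV_divide[OF a b] s \<epsilon> by simp
      qed
      have "s ^ ?d = s * s ^ (?d - Suc 0)" by (simp flip: power_Suc)
      then have "real ?d * s ^ (?d - Suc 0) / (s ^ ?d * s ^ ?d) = real ?d / s ^ (?d + 1)"
        using s \<epsilon> by simp
      moreover have "real ?d / s ^ (?d + 1) \<le> C"
        unfolding C_def using s \<epsilon> by (intro divide_left_mono power_mono mult_pos_pos zero_less_power) auto
      ultimately show "\<bar>- (real ?d * s ^ (?d - Suc 0)) / (s ^ ?d * s ^ ?d)\<bar> \<le> C"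
        using s \<epsilon> by (simp add: abs_divide)
    qed auto
    also have "\<dots> \<le> C * norm (x - y)"
      using C norm_triangle_ineq3[of x y] by (intro mult_left_mono) (auto simp: max_def)
    finally show ?thesis by (simp add: m_def)
  qed
  have tg: "trunc_grad \<epsilon> i z = - kap TYPE('n) * (z $ i * m z)" for z
    by (simp add: trunc_grad_def m_def)
  let ?L = "kap TYPE('n) * (1 / \<epsilon> ^ ?d + \<bar>r\<bar> * C)"
  have "\<bar>trunc_grad \<epsilon> i x - trunc_grad \<epsilon> i y\<bar> \<le> ?L * norm (x - y)" if "norm x \<le> r" "norm y \<le> r" for x y
  proof -
    have "x $ i * m x - y $ i * m y = (x - y) $ i * m x + y $ i * (m x - m y)" by (simp add: algebra_simps)
    also have "\<bar>\<dots>\<bar> \<le> \<bar>(x - y) $ i\<bar> * \<bar>m x\<bar> + \<bar>y $ i\<bar> * \<bar>m x - m y\<bar>"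
      by (rule order_trans[OF abs_triangle_ineq]) (simp add: abs_mult)
    also have "\<dots> \<le> norm (x - y) * (1 / \<epsilon> ^ ?d) + \<bar>r\<bar> * (C * norm (x - y))"
      using component_le_norm_cart[of "x - y" i] order_trans[OF component_le_norm_cart[of y i] that(2)]
      by (intro add_mono mult_mono m1 m2) auto
    finally have "\<bar>x $ i * m x - y $ i * m y\<bar> \<le> (1 / \<epsilon> ^ ?d + \<bar>r\<bar> * C) * norm (x - y)"
      by (simp add: algebra_simps)
    then have "kap TYPE('n) * \<bar>x $ i * m x - y $ i * m y\<bar> \<le> kap TYPE('n) * ((1 / \<epsilon> ^ ?d + \<bar>r\<bar> * C) * norm (x - y))"
      using kap_pos[where 'n = 'n] by (intro mult_left_mono) auto
    moreover have "trunc_grad \<epsilon> i x - trunc_grad \<epsilon> i y = - kap TYPE('n) * (x $ i * m x - y $ i * m y)"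
      unfolding tg by (simp add: algebra_simps)
    then have "\<bar>trunc_grad \<epsilon> i x - trunc_grad \<epsilon> i y\<bar> = kap TYPE('n) * \<bar>x $ i * m x - y $ i * m y\<bar>"
      using kap_pos[where 'n = 'n] by (simp add: abs_mult)
    ultimately show ?thesis by (simp only: mult.assoc)
  qed
  moreover have "?L \<ge> 0" using kap_pos[where 'n = 'n] \<epsilon> C by simp
  ultimately show "\<exists>L\<ge>0. \<forall>x y. norm x \<le> r \<longrightarrow> norm y \<le> r \<longrightarrow>
      \<bar>trunc_grad \<epsilon> i x - trunc_grad \<epsilon> i y\<bar> \<le> L * norm (x - y)" by blast
qed

section \<open>Derivatives of the truncated kernel along coordinate lines\<close>

lemma norm_line_deriv:
  fixes x :: "real ^ 'n"
  assumes "x \<noteq> 0"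
  shows "((\<lambda>t. norm (x + t *\<^sub>R axis i 1)) has_real_derivative x $ i / norm x) (at 0)"
proof -
  have 1: "((\<lambda>t. x + t *\<^sub>R axis i 1) has_derivative (\<lambda>s. s *\<^sub>R axis i 1)) (at 0)"
    by (auto intro!: derivative_eq_intros)
  have "(norm has_derivative (\<lambda>v. v \<bullet> sgn (x + 0 *\<^sub>R axis i 1))) (at (x + 0 *\<^sub>R axis i 1))"
    by (rule has_derivative_norm) (use assms in auto)
  note D = has_derivative_compose[OF 1 this]
  show ?thesis
    unfolding has_field_derivative_def
    by (rule has_derivative_eq_rhs[OF D]) (simp add: fun_eq_iff sgn_div_norm inner_axis' divide_inverse)
qed

lemma open_line_norm: "open {t. a < norm (x + t *\<^sub>R v)}" "open {t. norm (x + t *\<^sub>R v) < a}"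
  by (intro open_Collect_less continuous_intros)+

lemma norm_sq_line: "(norm (x + t *\<^sub>R axis i 1))\<^sup>2 = (norm x)\<^sup>2 + 2 * t * x $ i + t\<^sup>2" for x :: "real ^ 'n"
  by (simp only: power2_norm_eq_inner)
    (simp add: inner_add_left inner_add_right inner_axis inner_axis' inner_axis_axis power2_eq_square algebra_simps)

lemma trunc_kernel_line_deriv:
  fixes x :: "real ^ 'n"
  assumes d: "CARD('n) \<ge> 2" and \<epsilon>: "\<epsilon> > 0" and x: "norm x \<noteq> \<epsilon>"
  shows "((\<lambda>t. trunc_kernel \<epsilon> (x + t *\<^sub>R axis i 1)) has_real_derivative trunc_grad \<epsilon> i x) (at 0)"
proof (cases "norm x > \<epsilon>")
  case True
  then have x0: "x \<noteq> 0" "norm x > 0" using \<epsilon> by auto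
  have "(nprof TYPE('n) has_real_derivative - kap TYPE('n) / norm x ^ (CARD('n) - 1)) (at (norm (x + 0 *\<^sub>R axis i 1)))"
    using nprof_deriv[OF d x0(2)] by simp
  from DERIV_chain2[OF this norm_line_deriv[OF x0(1)]]
  have "((\<lambda>t. nprof TYPE('n) (norm (x + t *\<^sub>R axis i 1))) has_real_derivative
      - kap TYPE('n) / norm x ^ (CARD('n) - 1) * (x $ i / norm x)) (at 0)" .
  moreover have "- kap TYPE('n) / norm x ^ (CARD('n) - 1) * (x $ i / norm x) = trunc_grad \<epsilon> i x"
  proof -
    have "norm x ^ CARD('n) = norm x ^ (CARD('n) - 1) * norm x" using d by (simp flip: power_Suc2)
    then show ?thesis using True by (simp add: trunc_grad_def max_def)
  qed
  ultimately have "((\<lambda>t. nprof TYPE('n) (norm (x + t *\<^sub>R axis i 1))) has_real_derivative trunc_grad \<epsilon> i x) (at 0)"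
    by simp
  then show ?thesis
    by (rule has_field_derivative_transform_within_open[OF _ open_line_norm(1)[of \<epsilon> x "axis i 1"]])
      (use True in \<open>auto simp: trunc_kernel_def tprof_def\<close>)
next
  case False
  then have lt: "norm x < \<epsilon>" using x by simp
  have "((\<lambda>t. nprof TYPE('n) \<epsilon> + kap TYPE('n) * (\<epsilon>\<^sup>2 - ((norm x)\<^sup>2 + 2 * t * x $ i + t\<^sup>2)) / (2 * \<epsilon> ^ CARD('n)))
      has_real_derivative trunc_grad \<epsilon> i x) (at 0)"
    using lt \<epsilon> by (auto intro!: derivative_eq_intros simp: trunc_grad_def max_def)
  then show ?thesis
    by (rule has_field_derivative_transform_within_open[OF _ open_line_norm(2)[of x "axis i 1" \<epsilon>]])
      (use lt in \<open>auto simp: trunc_kernel_def tprof_def norm_sq_line\<close>)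
qed

text \<open>Outside the ball this is the quotient rule left unsimplified, so that it matches the
  derivative computed by \<open>DERIV_divide\<close>. The value on the sphere, a null set, is
  immaterial.\<close>

definition trunc_hess :: "real \<Rightarrow> 'n \<Rightarrow> real ^ 'n \<Rightarrow> real" where
  "trunc_hess \<epsilon> i z = - kap TYPE('n) * (if norm z < \<epsilon> then 1 / \<epsilon> ^ CARD('n) else
     (norm z ^ CARD('n) - z $ i * (real CARD('n) * norm z ^ (CARD('n) - 1) * (z $ i / norm z))) /
       (norm z ^ CARD('n) * norm z ^ CARD('n)))"

lemma trunc_grad_line_deriv:
  fixes x :: "real ^ 'n"
  assumes \<epsilon>: "\<epsilon> > 0" and x: "norm x \<noteq> \<epsilon>"
  shows "((\<lambda>t. trunc_grad \<epsilon> i (x + t *\<^sub>R axis i 1)) has_real_derivative trunc_hess \<epsilon> i x) (at 0)"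
proof (cases "norm x > \<epsilon>")
  case True
  then have x0: "x \<noteq> 0" "norm x > 0" using \<epsilon> by auto
  have p: "((\<lambda>t. norm (x + t *\<^sub>R axis i 1) ^ CARD('n)) has_real_derivative
      real CARD('n) * norm x ^ (CARD('n) - 1) * (x $ i / norm x)) (at 0)"
  proof -
    have b: "((\<lambda>r. r ^ CARD('n)) has_real_derivative real CARD('n) * norm x ^ (CARD('n) - 1))
        (at (norm (x + 0 *\<^sub>R axis i 1)))"
      using DERIV_pow[of "CARD('n)" "norm x" UNIV] by simp
    show ?thesis by (rule DERIV_chain2[OF b norm_line_deriv[OF x0(1)]])
  qed
  have n: "((\<lambda>t. x $ i + t) has_real_derivative 1) (at 0)" by (auto intro!: derivative_eq_intros)
  have q: "((\<lambda>t. - kap TYPE('n) * ((x $ i + t) / norm (x + t *\<^sub>R axis i 1) ^ CARD('n))) has_real_derivative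
      trunc_hess \<epsilon> i x) (at 0)"
    using DERIV_cmult[OF DERIV_divide[OF n p], of "- kap TYPE('n)"] x0 True
    by (simp add: trunc_hess_def)
  show ?thesis
    by (rule has_field_derivative_transform_within_open[OF q open_line_norm(1)[of \<epsilon> x "axis i 1"]])
      (use True in \<open>auto simp: trunc_grad_def max_def axis_def\<close>)
next
  case False
  then have lt: "norm x < \<epsilon>" using x by simp
  have q: "((\<lambda>t. - kap TYPE('n) * ((x $ i + t) / \<epsilon> ^ CARD('n))) has_real_derivative trunc_hess \<epsilon> i x) (at 0)"
    using lt \<epsilon> by (auto intro!: derivative_eq_intros simp: trunc_hess_def)
  show ?thesis
    by (rule has_field_derivative_transform_within_open[OF q open_line_norm(2)[of x "axis i 1" \<epsilon>]])
      (use lt in \<open>auto simp: trunc_grad_def max_def axis_def\<close>)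
qed

text \<open>Outside the ball the kernel is harmonic, the squared coordinates adding up to the
  squared norm. Inside, \<open>CARD('n)\<close> equal terms cancel the dimension in
  \<open>kap\<close> and leave minus the uniform probability density of the ball.\<close>

lemma sum_trunc_hess:
  fixes z :: "real ^ 'n"
  assumes \<epsilon>: "\<epsilon> > 0" and d: "CARD('n) \<ge> 2"
  shows "(\<Sum>i\<in>UNIV. trunc_hess \<epsilon> i z) =
    - (1 / (measure lborel (ball (0::real ^ 'n) 1) * \<epsilon> ^ CARD('n))) * indicator (ball 0 \<epsilon>) z"
proof (cases "norm z < \<epsilon>")
  case True
  then show ?thesis by (simp add: trunc_hess_def kap_def)
next
  case False
  then have z: "norm z > 0" using \<epsilon> by linarith
  have e: "norm z ^ CARD('n) = norm z ^ (CARD('n) - 1) * norm z" using d by (simp flip: power_Suc2)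
  have "(\<Sum>i\<in>UNIV. norm z ^ CARD('n) - z $ i * (real CARD('n) * norm z ^ (CARD('n) - 1) * (z $ i / norm z))) =
      real CARD('n) * norm z ^ CARD('n) - (real CARD('n) * norm z ^ (CARD('n) - 1) / norm z) * (\<Sum>i\<in>UNIV. (z $ i)\<^sup>2)"
    by (simp add: sum_subtractf sum_distrib_left sum_divide_distrib power2_eq_square mult_ac)
  also have "\<dots> = 0"
    unfolding norm_vec_sq[symmetric] e using z by (simp add: power2_eq_square)
  finally have "(\<Sum>i\<in>UNIV. (norm z ^ CARD('n) - z $ i * (real CARD('n) * norm z ^ (CARD('n) - 1) * (z $ i / norm z))) /
       (norm z ^ CARD('n) * norm z ^ CARD('n))) = 0"
    by (simp add: sum_divide_distrib[symmetric])
  then have "(\<Sum>i\<in>UNIV. trunc_hess \<epsilon> i z) = 0"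
    unfolding trunc_hess_def using False by (simp only: if_False sum_distrib_left[symmetric] mult_zero_right)
  then show ?thesis using False by simp
qed

lemma trunc_hess_measurable [measurable]: "trunc_hess \<epsilon> i \<in> borel_measurable borel"
  unfolding trunc_hess_def by measurable

lemma AE_norm_neq: "AE x in lborel. norm (x - y) \<noteq> \<epsilon>" for y :: "real ^ 'n"
proof -
  have "sphere y \<epsilon> \<in> null_sets lborel"
    using negligible_sphere[of y \<epsilon>] by (auto simp: null_sets_completion_iff negligible_iff_null_sets)
  then show ?thesis
    by (rule AE_I') (auto simp: dist_norm norm_minus_commute)
qed

lemma line_translate: "(x + t *\<^sub>R v) - y = (x - y) + t *\<^sub>R v" for x :: "real ^ 'n"
  by simp

text \<open>Two integrations by parts per coordinate. They are available because the truncated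
  kernel and its gradient are both locally Lipschitz and are differentiable off a single
  sphere.\<close>

lemma integral_trunc_kernel_lap:
  fixes \<phi> :: "real ^ 'n \<Rightarrow> real"
  assumes d: "CARD('n) \<ge> 2" and \<epsilon>: "\<epsilon> > 0" and \<phi>: "test_fun \<phi>"
  shows "(LINT x|lborel. trunc_kernel \<epsilon> (x - y) * lap \<phi> x) =
    - (LINT x|lborel. indicator (ball y \<epsilon>) x * \<phi> x) / (measure lborel (ball (0::real ^ 'n) 1) * \<epsilon> ^ CARD('n))"
proof -
  have tp: "test_fun (pd i \<phi>)" for i using \<phi> by (rule test_pd)
  have [measurable]: "trunc_grad \<epsilon> i \<in> borel_measurable borel" for i :: 'n
    by (rule loc_lip_measurable[OF loc_lip_trunc_grad[OF \<epsilon>]])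
  have d1: "AE x in lborel. ((\<lambda>t. trunc_kernel \<epsilon> (x + t *\<^sub>R axis i 1 - y)) has_real_derivative trunc_grad \<epsilon> i (x - y)) (at 0)" for i
    using AE_norm_neq[of y \<epsilon>] unfolding line_translate
    by eventually_elim (rule trunc_kernel_line_deriv[OF d \<epsilon>])
  have d2: "AE x in lborel. ((\<lambda>t. trunc_grad \<epsilon> i (x + t *\<^sub>R axis i 1 - y)) has_real_derivative trunc_hess \<epsilon> i (x - y)) (at 0)" for i
    using AE_norm_neq[of y \<epsilon>] unfolding line_translate
    by eventually_elim (rule trunc_grad_line_deriv[OF \<epsilon>])
  note p1 = integral_by_parts[OF tp loc_lip_translate[OF loc_lip_trunc_kernel[OF d \<epsilon>]] _ d1]
  note p2 = integral_by_parts[OF \<phi> loc_lip_translate[OF loc_lip_trunc_grad[OF \<epsilon>]] _ d2]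
  have i1: "integrable lborel (\<lambda>x. pd i (pd i \<phi>) x * trunc_kernel \<epsilon> (x - y))" for i by (rule p1) measurable
  have i2: "integrable lborel (\<lambda>x. \<phi> x * trunc_hess \<epsilon> i (x - y))" for i by (rule p2) measurable
  have e1: "(LINT x|lborel. pd i (pd i \<phi>) x * trunc_kernel \<epsilon> (x - y)) = - (LINT x|lborel. pd i \<phi> x * trunc_grad \<epsilon> i (x - y))" for i
    by (subst p1(3)) auto
  have e2: "(LINT x|lborel. \<phi> x * trunc_hess \<epsilon> i (x - y)) = - (LINT x|lborel. pd i \<phi> x * trunc_grad \<epsilon> i (x - y))" for i
    by (rule p2(3)) measurable
  have "(LINT x|lborel. trunc_kernel \<epsilon> (x - y) * lap \<phi> x) =
      (LINT x|lborel. (\<Sum>i\<in>UNIV. pd i (pd i \<phi>) x * trunc_kernel \<epsilon> (x - y)))"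
    by (simp add: lap_eq sum_distrib_left mult.commute)
  also have "\<dots> = (\<Sum>i\<in>UNIV. LINT x|lborel. pd i (pd i \<phi>) x * trunc_kernel \<epsilon> (x - y))"
    by (rule Bochner_Integration.integral_sum) (rule i1)
  also have "\<dots> = (\<Sum>i\<in>UNIV. LINT x|lborel. \<phi> x * trunc_hess \<epsilon> i (x - y))"
    by (simp only: e1 e2)
  also have "\<dots> = (LINT x|lborel. (\<Sum>i\<in>UNIV. \<phi> x * trunc_hess \<epsilon> i (x - y)))"
    by (rule Bochner_Integration.integral_sum[symmetric]) (rule i2)
  also have "\<dots> = (LINT x|lborel. - (1 / (measure lborel (ball (0::real ^ 'n) 1) * \<epsilon> ^ CARD('n))) * (indicator (ball y \<epsilon>) x * \<phi> x))"
    by (simp only: sum_distrib_left[symmetric] sum_trunc_hess[OF \<epsilon> d])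
      (auto intro!: Bochner_Integration.integral_cong simp: indicator_def dist_norm norm_minus_commute)
  also have "\<dots> = - (LINT x|lborel. indicator (ball y \<epsilon>) x * \<phi> x) / (measure lborel (ball (0::real ^ 'n) 1) * \<epsilon> ^ CARD('n))"
    by simp
  finally show ?thesis .
qed

text \<open>One shape of bound for all dimensions: \<open>ln r \<le> r\<close> and
  \<open>- ln r \<le> 1 / r\<close> in the plane, and \<open>r\<close> times the singular term
  otherwise. The singularity is overestimated by at most one power, which remains locally
  integrable.\<close>

lemma nprof_bound:
  assumes d: "CARD('n::finite) \<ge> 2"
  obtains C where "C > 0" "\<And>r. r > 0 \<Longrightarrow> \<bar>nprof TYPE('n) r\<bar> \<le> C * (1 / r ^ (CARD('n) - 1) + r)"
proof (cases "CARD('n) = 2")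
  case True
  have "\<bar>nprof TYPE('n) r\<bar> \<le> 1 / (2 * pi) * (1 / r ^ (CARD('n) - 1) + r)" if r: "r > 0" for r
  proof -
    have "ln r \<le> r" using ln_le_minus_one[OF r] by linarith
    moreover have "- ln r \<le> 1 / r" using ln_le_minus_one[of "1 / r"] r by (simp add: ln_div)
    ultimately have "\<bar>ln r\<bar> \<le> 1 / r + r" using r by (auto simp: abs_if add_increasing add_increasing2)
    then show ?thesis using True by (simp add: nprof_def divide_right_mono)
  qed
  then show ?thesis using that[of "1 / (2 * pi)"] by simp
next
  case False
  define D where "D = (real CARD('n) - 2) * real CARD('n) * measure lborel (ball (0::real ^ 'n) 1)"
  have "real CARD('n) > 2" using False d by linarith
  then have D: "D > 0" by (simp add: D_def measure_unit_ball)
  have "\<bar>nprof TYPE('n) r\<bar> \<le> 1 / D * (1 / r ^ (CARD('n) - 1) + r)" if r: "r > 0" for r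
  proof -
    have e: "r powr (2 - real CARD('n)) = 1 / r ^ (CARD('n) - 1) * r"
    proof -
      have "2 - real CARD('n) = - real (CARD('n) - 1) + 1" using d by (simp add: of_nat_diff)
      then have "r powr (2 - real CARD('n)) = r powr (- real (CARD('n) - 1)) * r powr 1" by (simp only: powr_add)
      then show ?thesis using r by (simp only: powr_neg_nat powr_one_eq_one) simp
    qed
    have "1 / r ^ (CARD('n) - 1) * r \<le> 1 / r ^ (CARD('n) - 1) + r"
    proof (cases "r \<le> 1")
      case True
      then have "1 / r ^ (CARD('n) - 1) * r \<le> 1 / r ^ (CARD('n) - 1) * 1" using r by (intro mult_left_mono) auto
      then show ?thesis using r by linarith
    next
      case False
      then have "1 / r ^ (CARD('n) - 1) \<le> 1" by (simp add: one_le_power)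
      then have "1 / r ^ (CARD('n) - 1) * r \<le> 1 * r" using r by (intro mult_right_mono) auto
      then show ?thesis using r by (simp add: add_increasing)
    qed
    then have "(1 / r ^ (CARD('n) - 1) * r) / D \<le> (1 / r ^ (CARD('n) - 1) + r) / D"
      using D by (intro divide_right_mono) auto
    moreover have "nprof TYPE('n) r = (1 / r ^ (CARD('n) - 1) * r) / D"
      using False by (simp only: nprof_def D_def[symmetric] e if_False)
    moreover have "(1 / r ^ (CARD('n) - 1) * r) / D \<ge> 0" using r D by simp
    ultimately show ?thesis by simp
  qed
  then show ?thesis using that[of "1 / D"] D by simp
qed

text \<open>The bound is uniform in \<open>\<epsilon> \<le> 1\<close> and so dominates when the
  truncation is removed. For \<open>norm z < \<epsilon>\<close> both parts of the paraboloid are of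
  size \<open>1 / \<epsilon> ^ (d - 1)\<close>, which does not exceed the same power of
  \<open>1 / norm z\<close>.\<close>

lemma trunc_kernel_bound:
  assumes d: "CARD('n) \<ge> 2"
  obtains C where "C > 0"
    "\<And>z :: real ^ 'n. z \<noteq> 0 \<Longrightarrow> \<bar>newton_kernel z\<bar> \<le> C * (1 / norm z ^ (CARD('n) - 1) + norm z)"
    "\<And>z :: real ^ 'n. \<And>\<epsilon>. z \<noteq> 0 \<Longrightarrow> 0 < \<epsilon> \<Longrightarrow> \<epsilon> \<le> 1 \<Longrightarrow>
       \<bar>trunc_kernel \<epsilon> z\<bar> \<le> C * (1 / norm z ^ (CARD('n) - 1) + norm z)"
proof -
  obtain C where C: "C > 0" "\<And>r. r > 0 \<Longrightarrow> \<bar>nprof TYPE('n) r\<bar> \<le> C * (1 / r ^ (CARD('n) - 1) + r)"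
    using nprof_bound[OF d] by metis
  define D where "D = 2 * C + kap TYPE('n)"
  have D: "D > 0" "C \<le> D" using C(1) kap_pos[where 'n = 'n] by (auto simp: D_def)
  have 1: "\<bar>nprof TYPE('n) (norm z)\<bar> \<le> D * (1 / norm z ^ (CARD('n) - 1) + norm z)" if "z \<noteq> 0" for z :: "real ^ 'n"
  proof -
    have "\<bar>nprof TYPE('n) (norm z)\<bar> \<le> C * (1 / norm z ^ (CARD('n) - 1) + norm z)" using C(2)[of "norm z"] that by simp
    also have "\<dots> \<le> D * (1 / norm z ^ (CARD('n) - 1) + norm z)" using D by (intro mult_right_mono) auto
    finally show ?thesis .
  qed
  have 2: "\<bar>trunc_kernel \<epsilon> z\<bar> \<le> D * (1 / norm z ^ (CARD('n) - 1) + norm z)"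
    if z: "z \<noteq> 0" and \<epsilon>: "0 < \<epsilon>" "\<epsilon> \<le> 1" for z :: "real ^ 'n" and \<epsilon>
  proof (cases "norm z \<ge> \<epsilon>")
    case True
    then show ?thesis using 1[OF z] by (simp add: trunc_kernel_def tprof_def)
  next
    case False
    let ?P = "1 / \<epsilon> ^ (CARD('n) - 1)"
    have P1: "1 \<le> ?P" using \<epsilon> by (simp add: power_le_one)
    have PP: "?P \<le> 1 / norm z ^ (CARD('n) - 1)"
      using z False \<epsilon> by (intro divide_left_mono power_mono mult_pos_pos zero_less_power) auto
    have "\<bar>nprof TYPE('n) \<epsilon>\<bar> \<le> C * (?P + \<epsilon>)" by (rule C(2)[OF \<epsilon>(1)])
    also have "\<dots> \<le> C * (2 * ?P)" 
    proof (rule mult_left_mono)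
      show "?P + \<epsilon> \<le> 2 * ?P" using P1 \<epsilon> by linarith
    qed (use C(1) in simp)
    finally have a: "\<bar>nprof TYPE('n) \<epsilon>\<bar> \<le> 2 * C * ?P" by (simp only: mult_ac)
    have b: "\<bar>kap TYPE('n) * (\<epsilon>\<^sup>2 - (norm z)\<^sup>2) / (2 * \<epsilon> ^ CARD('n))\<bar> \<le> kap TYPE('n) * ?P"
    proof -
      have sq: "(norm z)\<^sup>2 \<le> \<epsilon>\<^sup>2" using False by (intro power_mono) auto
      then have "\<bar>kap TYPE('n) * (\<epsilon>\<^sup>2 - (norm z)\<^sup>2) / (2 * \<epsilon> ^ CARD('n))\<bar> =
          kap TYPE('n) * (\<epsilon>\<^sup>2 - (norm z)\<^sup>2) / (2 * \<epsilon> ^ CARD('n))"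
        using kap_pos[where 'n = 'n] \<epsilon> by simp
      also have "\<dots> \<le> kap TYPE('n) * (2 * \<epsilon>) / (2 * \<epsilon> ^ CARD('n))"
      proof -
        have "\<epsilon>\<^sup>2 \<le> \<epsilon>" using \<epsilon> by (simp add: power2_eq_square mult_le_cancel_left1)
        then have "\<epsilon>\<^sup>2 - (norm z)\<^sup>2 \<le> 2 * \<epsilon>" using \<epsilon> zero_le_power2[of "norm z"] by linarith
        then show ?thesis using kap_pos[where 'n = 'n] \<epsilon> by (intro divide_right_mono mult_left_mono) auto
      qed
      also have "\<dots> = kap TYPE('n) * ?P"
      proof -
        have "\<epsilon> ^ CARD('n) = \<epsilon> * \<epsilon> ^ (CARD('n) - 1)" using d by (simp flip: power_Suc)
        then show ?thesis using \<epsilon> by simp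
      qed
      finally show ?thesis .
    qed
    have "\<bar>trunc_kernel \<epsilon> z\<bar> \<le> \<bar>nprof TYPE('n) \<epsilon>\<bar> + \<bar>kap TYPE('n) * (\<epsilon>\<^sup>2 - (norm z)\<^sup>2) / (2 * \<epsilon> ^ CARD('n))\<bar>"
      using False by (simp add: trunc_kernel_def tprof_def del: abs_divide)
    also have "\<dots> \<le> D * ?P" unfolding D_def distrib_right using a b by (rule add_mono)
    also have "\<dots> \<le> D * (1 / norm z ^ (CARD('n) - 1) + norm z)" using D PP by (intro mult_left_mono) (auto simp: add_increasing2)
    finally show ?thesis .
  qed
  show ?thesis using that[OF D(1)] 1 2 by (simp add: newton_kernel_nprof)
qed


section \<open>The Newtonian potential\<close>

lemma newton_kernel_measurable [measurable]: "newton_kernel \<in> borel_measurable borel"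
  unfolding newton_kernel_def[abs_def] by measurable

text \<open>Holds by the conventions \<open>ln 0 = 0\<close> and \<open>0 powr x = 0\<close>; the
  kernel bounds thus extend to the pole.\<close>

lemma newton_kernel_0 [simp]: "newton_kernel 0 = 0"
  by (simp add: newton_kernel_def)

lemma integrable_kernel_bound:
  assumes d: "CARD('n) \<ge> 2"
  shows "integrable lborel (\<lambda>z :: real ^ 'n. indicator (ball 0 r) z * (1 / norm z ^ (CARD('n) - 1) + norm z))"
proof (rule Bochner_Integration.integrable_bound)
  let ?g = "\<lambda>z :: real ^ 'n. indicator (ball 0 1) z / norm z ^ (CARD('n) - 1) + (1 + \<bar>r\<bar>) * indicator (ball 0 r) z"
  have "integrable lborel (indicator (ball 0 r) :: real ^ 'n \<Rightarrow> real)"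
    using emeasure_bounded_finite[of "ball 0 r :: (real ^ 'n) set"] by (intro integrable_real_indicator) auto
  then show "integrable lborel ?g"
    by (intro Bochner_Integration.integrable_add integrable_inverse_norm_power[OF d] integrable_mult_right)
  have le: "indicator (ball 0 r) z * (1 / norm z ^ (CARD('n) - 1) + norm z) \<le> ?g z" for z :: "real ^ 'n"
  proof (cases "norm z < r")
    case True
    show ?thesis
    proof (cases "norm z < 1")
      case False
      then have "1 \<le> norm z ^ (CARD('n) - 1)" by (intro one_le_power) simp
      then have "1 / norm z ^ (CARD('n) - 1) \<le> 1" by simp
      then have "1 / norm z ^ (CARD('n) - 1) + norm z \<le> 1 + \<bar>r\<bar>" using True by linarith
      then show ?thesis using True False by simp
    qed (use True in auto)
  qed auto
  have nn: "0 \<le> indicator (ball 0 r) z * (1 / norm z ^ (CARD('n) - 1) + norm z)" for z :: "real ^ 'n" by simp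
  have "norm L \<le> norm g" if "0 \<le> L" "L \<le> g" for L g :: real using that by simp
  from this[OF nn le]
  show "AE z in lborel. norm (indicator (ball 0 r) z * (1 / norm z ^ (CARD('n) - 1) + norm z)) \<le> norm (?g z)"
    by (rule AE_I2)
qed measurable

lemma newton_kernel_loc_integrable:
  assumes d: "CARD('n) \<ge> 2"
  shows "integrable lborel (\<lambda>z :: real ^ 'n. indicator (ball 0 r) z * newton_kernel z)"
proof -
  obtain C where C: "C > 0"
    "\<And>z :: real ^ 'n. z \<noteq> 0 \<Longrightarrow> \<bar>newton_kernel z\<bar> \<le> C * (1 / norm z ^ (CARD('n) - 1) + norm z)"
    using trunc_kernel_bound[OF d] by metis
  have "\<bar>newton_kernel z\<bar> \<le> C * (1 / norm z ^ (CARD('n) - 1) + norm z)" for z :: "real ^ 'n"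
    using C by (cases "z = 0") auto
  then show ?thesis
    using C(1)
    by (intro Bochner_Integration.integrable_bound[OF integrable_mult_right[OF integrable_kernel_bound[OF d, of r], of C]])
      (auto simp: indicator_def abs_mult intro!: AE_I2 order_trans[OF _ abs_ge_self])
qed

text \<open>The denominator is the volume of the ball, and by the Lipschitz condition the mean over
  a ball of radius \<open>\<epsilon>\<close> deviates from the value at the centre by at most
  \<open>L * \<epsilon>\<close>.\<close>

lemma ball_average_tendsto:
  fixes \<phi> :: "real ^ 'n \<Rightarrow> real"
  assumes \<phi>: "test_fun \<phi>"
  shows "(\<lambda>n. (LINT x|lborel. indicator (ball y (1 / real (Suc n))) x * \<phi> x) /
     (measure lborel (ball (0::real ^ 'n) 1) * (1 / real (Suc n)) ^ CARD('n))) \<longlonglongrightarrow> \<phi> y"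
proof -
  obtain L where L: "L > 0" "\<And>x y. \<bar>\<phi> x - \<phi> y\<bar> \<le> L * norm (x - y)" using test_lipschitz[OF \<phi>] by metis
  have [measurable]: "\<phi> \<in> borel_measurable borel" using \<phi> by (rule test_measurable)
  have *: "\<bar>(LINT x|lborel. indicator (ball y \<epsilon>) x * \<phi> x) / (measure lborel (ball (0::real ^ 'n) 1) * \<epsilon> ^ CARD('n)) - \<phi> y\<bar> \<le> L * \<epsilon>"
    if \<epsilon>: "\<epsilon> > 0" for \<epsilon>
  proof -
    let ?M = "measure lborel (ball y \<epsilon>)"
    have M: "?M = measure lborel (ball (0::real ^ 'n) 1) * \<epsilon> ^ CARD('n)"
      using content_ball[of \<epsilon> y] \<epsilon> by (simp add: measure_unit_ball)
    have Mpos: "?M > 0" using \<epsilon> by (simp add: content_ball_pos)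
    have ib: "integrable lborel (indicator (ball y \<epsilon>) :: real ^ 'n \<Rightarrow> real)"
      using emeasure_bounded_finite[of "ball y \<epsilon>"] by (intro integrable_real_indicator) auto
    have ip: "integrable lborel (\<lambda>x. indicator (ball y \<epsilon>) x * \<phi> x)"
    proof -
      obtain B where B: "B > 0" "\<And>x. \<bar>\<phi> x\<bar> \<le> B" using test_bounded[OF \<phi>] by metis
      show ?thesis
        using B by (intro Bochner_Integration.integrable_bound[OF integrable_mult_right[OF ib, of B]])
          (auto simp: indicator_def intro!: AE_I2 order_trans[OF B(2)])
    qed
    have "(LINT x|lborel. indicator (ball y \<epsilon>) x * \<phi> x) - ?M * \<phi> y =
        (LINT x|lborel. indicator (ball y \<epsilon>) x * \<phi> x - \<phi> y * indicator (ball y \<epsilon>) x)"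
      using ip ib by (subst Bochner_Integration.integral_diff) auto
    also have "\<bar>\<dots>\<bar> \<le> (LINT x|lborel. L * \<epsilon> * indicator (ball y \<epsilon>) x)"
    proof (rule order_trans[OF integral_abs_bound], rule integral_mono)
      show "integrable lborel (\<lambda>x. \<bar>indicator (ball y \<epsilon>) x * \<phi> x - \<phi> y * indicator (ball y \<epsilon>) x\<bar>)"
        using ip ib by auto
      show "integrable lborel (\<lambda>x. L * \<epsilon> * indicator (ball y \<epsilon>) x)" using ib by auto
      fix x
      show "\<bar>indicator (ball y \<epsilon>) x * \<phi> x - \<phi> y * indicator (ball y \<epsilon>) x\<bar> \<le> L * \<epsilon> * indicator (ball y \<epsilon>) x"
      proof (cases "x \<in> ball y \<epsilon>")
        case True
        then have "L * norm (x - y) \<le> L * \<epsilon>" using L(1) by (simp add: dist_norm norm_minus_commute)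
        then show ?thesis using L(2)[of x y] True by simp
      qed simp
    qed
    also have "\<dots> = L * \<epsilon> * ?M" using ib by simp
    finally have "\<bar>(LINT x|lborel. indicator (ball y \<epsilon>) x * \<phi> x) - ?M * \<phi> y\<bar> \<le> L * \<epsilon> * ?M" .
    moreover have "(LINT x|lborel. indicator (ball y \<epsilon>) x * \<phi> x) / ?M - \<phi> y =
        ((LINT x|lborel. indicator (ball y \<epsilon>) x * \<phi> x) - ?M * \<phi> y) / ?M"
      using Mpos by (simp add: diff_divide_distrib)
    ultimately show ?thesis unfolding M[symmetric] using Mpos by (simp add: abs_divide pos_divide_le_eq)
  qed
  have "(\<lambda>n. L * (1 / real (Suc n))) \<longlonglongrightarrow> L * 0"
    by (intro tendsto_mult tendsto_const LIMSEQ_Suc[OF lim_1_over_n])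
  then have lim: "(\<lambda>n. L * (1 / real (Suc n))) \<longlonglongrightarrow> 0" by (simp only: mult_zero_right)
  have "(\<lambda>n. (LINT x|lborel. indicator (ball y (1 / real (Suc n))) x * \<phi> x) /
     (measure lborel (ball (0::real ^ 'n) 1) * (1 / real (Suc n)) ^ CARD('n)) - \<phi> y) \<longlonglongrightarrow> 0"
  proof (rule Lim_null_comparison[OF always_eventually lim], rule allI)
    show "norm ((LINT x|lborel. indicator (ball y (1 / real (Suc n))) x * \<phi> x) /
     (measure lborel (ball (0::real ^ 'n) 1) * (1 / real (Suc n)) ^ CARD('n)) - \<phi> y) \<le> L * (1 / real (Suc n))" for n
      using *[of "1 / real (Suc n)"] by (simp only: real_norm_def zero_less_divide_1_iff of_nat_0_less_iff zero_less_Suc)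
  qed
  then show ?thesis by (simp only: LIM_zero_iff)
qed

text \<open>Off the pole the truncated kernel eventually coincides with the full one, and the
  uniform bound permits dominated convergence; on the other side stand averages of
  \<open>\<phi>\<close> over shrinking balls.\<close>

lemma newton_kernel_fundamental:
  fixes \<phi> :: "real ^ 'n \<Rightarrow> real"
  assumes d: "CARD('n) \<ge> 2" and \<phi>: "test_fun \<phi>"
  shows "(LINT x|lborel. newton_kernel (x - y) * lap \<phi> x) = - \<phi> y"
proof -
  define h where "h n = 1 / real (Suc n)" for n
  have h: "h n > 0" "h n \<le> 1" for n by (auto simp: h_def)
  have h0: "h \<longlonglongrightarrow> 0" unfolding h_def[abs_def] by (rule LIMSEQ_Suc[OF lim_1_over_n])
  obtain C where C: "C > 0"
    "\<And>z :: real ^ 'n. \<And>\<epsilon>. z \<noteq> 0 \<Longrightarrow> 0 < \<epsilon> \<Longrightarrow> \<epsilon> \<le> 1 \<Longrightarrow>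
       \<bar>trunc_kernel \<epsilon> z\<bar> \<le> C * (1 / norm z ^ (CARD('n) - 1) + norm z)"
    using trunc_kernel_bound[OF d] by metis
  obtain r where r: "r > 0" "\<And>x. norm x \<ge> r \<Longrightarrow> lap \<phi> x = 0" using test_fun_support[OF test_lap[OF \<phi>]] by metis
  obtain B where B: "B > 0" "\<And>x. \<bar>lap \<phi> x\<bar> \<le> B" using test_bounded[OF test_lap[OF \<phi>]] by metis
  define k where "k z = indicator (ball 0 (r + norm y)) z * (1 / norm z ^ (CARD('n) - 1) + norm z)" for z :: "real ^ 'n"
  have k: "integrable lborel k" unfolding k_def by (rule integrable_kernel_bound[OF d])
  have km: "k \<in> borel_measurable borel" unfolding k_def by measurable
  have kt: "integrable lborel (\<lambda>x. k (x - y))"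
    using lborel_integral_translate(2)[OF km k, of "- y"] by simp
  have [measurable]: "lap \<phi> \<in> borel_measurable borel" by (rule test_measurable[OF test_lap[OF \<phi>]])
  have [measurable]: "(trunc_kernel (h n) :: real ^ 'n \<Rightarrow> real) \<in> borel_measurable borel" for n
    by (rule loc_lip_measurable[OF loc_lip_trunc_kernel[OF d h(1)]])
  have ne: "AE x in lborel. x \<noteq> y" by (rule AE_lborel_singleton)
  have "(\<lambda>n. LINT x|lborel. trunc_kernel (h n) (x - y) * lap \<phi> x) \<longlonglongrightarrow> (LINT x|lborel. newton_kernel (x - y) * lap \<phi> x)"
  proof (rule integral_dominated_convergence)
    show "integrable lborel (\<lambda>x. C * B * k (x - y))" using kt by simp
    show "AE x in lborel. (\<lambda>n. trunc_kernel (h n) (x - y) * lap \<phi> x) \<longlonglongrightarrow> newton_kernel (x - y) * lap \<phi> x"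
      using ne
    proof eventually_elim
      case (elim x)
      then have "norm (x - y) > 0" by simp
      then have "eventually (\<lambda>n. h n < norm (x - y)) sequentially" by (rule order_tendstoD(2)[OF h0])
      then have "eventually (\<lambda>n. trunc_kernel (h n) (x - y) * lap \<phi> x = newton_kernel (x - y) * lap \<phi> x) sequentially"
        by eventually_elim (simp add: trunc_kernel_def tprof_def newton_kernel_nprof)
      then show ?case by (rule tendsto_eventually)
    qed
    show "AE x in lborel. norm (trunc_kernel (h n) (x - y) * lap \<phi> x) \<le> C * B * k (x - y)" for n
      using ne
    proof eventually_elim
      case (elim x)
      show ?case
      proof (cases "norm x < r")
        case True
        then have "norm (x - y) < r + norm y" using norm_triangle_ineq4[of x y] by linarith
        then have "C * (1 / norm (x - y) ^ (CARD('n) - 1) + norm (x - y)) = C * k (x - y)" by (simp add: k_def)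
        moreover have "\<bar>trunc_kernel (h n) (x - y)\<bar> \<le> C * (1 / norm (x - y) ^ (CARD('n) - 1) + norm (x - y))"
          using C(2)[of "x - y" "h n"] elim h by simp
        ultimately have "\<bar>trunc_kernel (h n) (x - y)\<bar> * \<bar>lap \<phi> x\<bar> \<le> C * k (x - y) * B"
          using B by (intro mult_mono) auto
        then show ?thesis by (simp add: abs_mult mult_ac)
      next
        case False
        have "k z \<ge> 0" for z by (simp add: k_def)
        then show ?thesis using r(2)[of x] False C(1) B(1) by simp
      qed
    qed
  qed measurable
  moreover have "(\<lambda>n. LINT x|lborel. trunc_kernel (h n) (x - y) * lap \<phi> x) \<longlonglongrightarrow> - \<phi> y"
    unfolding integral_trunc_kernel_lap[OF d h(1) \<phi>] minus_divide_left[symmetric]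
    unfolding h_def by (intro tendsto_minus ball_average_tendsto \<phi>)
  ultimately show ?thesis by (rule LIMSEQ_unique)
qed

text \<open>Fubini is applied on a product of Borel measures, while \<open>\<sigma>\<close> is only
  Lebesgue measurable. Setting the Borel version to \<open>0\<close> where it violates the bound or
  the support changes it on a null set at most.\<close>

lemma bounded_borel_version:
  fixes \<sigma> :: "real ^ 'n \<Rightarrow> real"
  assumes \<sigma>: "\<sigma> \<in> borel_measurable lebesgue" and S: "\<And>x. \<bar>\<sigma> x\<bar> \<le> S" and s: "\<And>x. norm x > s \<Longrightarrow> \<sigma> x = 0"
  obtains b where "b \<in> borel_measurable borel" "AE x in lborel. \<sigma> x = b x"
    "\<And>x. \<bar>b x\<bar> \<le> S" "\<And>x. norm x > s \<Longrightarrow> b x = 0"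
proof -
  obtain g where g: "g \<in> borel_measurable lborel" "AE x in lborel. \<sigma> x = g x"
    using completion_ex_borel_measurable_real[OF \<sigma>] by auto
  have [measurable]: "g \<in> borel_measurable borel" using g(1) by simp
  define b where "b x = (if norm x \<le> s \<and> \<bar>g x\<bar> \<le> S then g x else 0)" for x
  have "b \<in> borel_measurable borel" unfolding b_def by measurable
  moreover have "AE x in lborel. \<sigma> x = b x"
    using g(2)
  proof eventually_elim
    case (elim x)
    then show ?case using S[of x] s[of x] by (auto simp: b_def)
  qed
  moreover have "\<bar>b x\<bar> \<le> S" for x using S[of x] by (auto simp: b_def)
  moreover have "b x = 0" if "norm x > s" for x using that by (auto simp: b_def)
  ultimately show ?thesis using that by blast
qed

lemma lebesgue_integral_AE_borel:
  fixes f g :: "real ^ 'n \<Rightarrow> real"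
  assumes "f \<in> borel_measurable lebesgue" "g \<in> borel_measurable borel" "AE x in lborel. f x = g x"
  shows "integral\<^sup>L lebesgue f = integral\<^sup>L lborel g"
proof -
  have gl: "g \<in> borel_measurable lborel" using assms(2) by simp
  have "integral\<^sup>L lebesgue f = integral\<^sup>L lebesgue g"
    by (rule Bochner_Integration.integral_cong_AE[OF assms(1) measurable_completion[OF gl] AE_completion[OF assms(3)]])
  also have "\<dots> = integral\<^sup>L lborel g" by (rule integral_completion[OF gl])
  finally show ?thesis .
qed

lemma borel_imp_lebesgue: "f \<in> borel_measurable borel \<Longrightarrow> f \<in> borel_measurable lebesgue"
  by (rule measurable_completion) simp

text \<open>Here \<open>a\<close> is merely bounded and Borel, so that it can be a test function, a
  Laplacian or the indicator of a ball. The inner integral \<open>c\<close> is left abstract, to be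
  filled in by \<open>newton_kernel_fundamental\<close>.\<close>

lemma newton_pot_pairing:
  fixes \<sigma> a :: "real ^ 'n \<Rightarrow> real"
  assumes d: "CARD('n) \<ge> 2"
    and \<sigma>: "\<sigma> \<in> borel_measurable lebesgue" and S: "\<And>x. \<bar>\<sigma> x\<bar> \<le> S" and s: "\<And>x. norm x > s \<Longrightarrow> \<sigma> x = 0"
    and a[measurable]: "a \<in> borel_measurable borel" and A: "\<And>x. \<bar>a x\<bar> \<le> A" and r: "\<And>x. norm x > r \<Longrightarrow> a x = 0"
  shows "integrable lebesgue (\<lambda>x. newton_pot \<sigma> x * a x)"
    and "(\<And>y. (LINT x|lborel. newton_kernel (x - y) * a x) = c y) \<Longrightarrow> c \<in> borel_measurable borel \<Longrightarrow>
      (LINT x|lebesgue. newton_pot \<sigma> x * a x) = 2 * real CARD('n) * (LINT y|lebesgue. c y * \<sigma> y)"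
proof -
  let ?D = "2 * real CARD('n)"
  obtain b where b[measurable]: "b \<in> borel_measurable borel" and ae: "AE x in lborel. \<sigma> x = b x"
    and bS: "\<And>x. \<bar>b x\<bar> \<le> S" and bs: "\<And>x. norm x > s \<Longrightarrow> b x = 0"
    using bounded_borel_version[where \<sigma> = \<sigma> and S = S and s = s, OF \<sigma> S s] by blast
  \<comment> \<open>Differences of points of the two supports have norm below this radius, so
    cutting the kernel does not change the integrand and makes the kernel integrable.\<close>
  define k where "k z = indicator (ball 0 (\<bar>r\<bar> + \<bar>s\<bar> + 1)) z * newton_kernel z" for z :: "real ^ 'n"
  have ki: "integrable lborel k" unfolding k_def by (rule newton_kernel_loc_integrable[OF d])
  have bi: "integrable lborel b" by (rule integrable_bounded_support_borel[OF b bS bs])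
  have kk: "newton_kernel (x - y) * a x * b y = k (x - y) * a x * b y" for x y
  proof (cases "norm x \<le> r \<and> norm y \<le> s")
    case True
    then have "norm (x - y) < \<bar>r\<bar> + \<bar>s\<bar> + 1" using norm_triangle_ineq4[of x y] by linarith
    then show ?thesis by (simp add: k_def)
  next
    case False
    then show ?thesis using r[of x] bs[of y] by auto
  qed
  have pot: "newton_pot \<sigma> x = ?D * (LINT y|lborel. newton_kernel (x - y) * b y)" for x
  proof -
    have m: "(\<lambda>y. newton_kernel (x - y)) \<in> borel_measurable borel" by measurable
    have "(LINT y|lebesgue. newton_kernel (x - y) * \<sigma> y) = (LINT y|lborel. newton_kernel (x - y) * b y)"
    proof (rule lebesgue_integral_AE_borel)
      show "(\<lambda>y. newton_kernel (x - y) * \<sigma> y) \<in> borel_measurable lebesgue"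
        by (intro borel_measurable_times borel_imp_lebesgue m \<sigma>)
      show "AE y in lborel. newton_kernel (x - y) * \<sigma> y = newton_kernel (x - y) * b y"
        using ae by eventually_elim simp
    qed measurable
    then show ?thesis by (simp add: newton_pot_def)
  qed
  have pota: "newton_pot \<sigma> x * a x = ?D * (LINT y|lborel. newton_kernel (x - y) * a x * b y)" for x
  proof -
    have "(LINT y|lborel. newton_kernel (x - y) * a x * b y) = (LINT y|lborel. a x * (newton_kernel (x - y) * b y))"
      by (simp add: mult_ac)
    also have "\<dots> = a x * (LINT y|lborel. newton_kernel (x - y) * b y)" by (rule integral_mult_right_zero)
    finally show ?thesis by (simp add: pot)
  qed
  have pair: "integrable (lborel \<Otimes>\<^sub>M lborel) (\<lambda>(y, x). newton_kernel (x - y) * a x * b y)"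
    unfolding kk by (rule integrable_conv_pair[OF ki bi a A])
  have int: "integrable lborel (\<lambda>x. newton_pot \<sigma> x * a x)"
    unfolding pota using lborel_pair.integrable_snd[OF pair] by simp
  then show "integrable lebesgue (\<lambda>x. newton_pot \<sigma> x * a x)"
    by (subst integrable_completion) (rule borel_measurable_integrable)
  show "(LINT x|lebesgue. newton_pot \<sigma> x * a x) = ?D * (LINT y|lebesgue. c y * \<sigma> y)"
    if c: "\<And>y. (LINT x|lborel. newton_kernel (x - y) * a x) = c y" and cm: "c \<in> borel_measurable borel"
  proof -
    have "(LINT x|lebesgue. newton_pot \<sigma> x * a x) = (LINT x|lborel. newton_pot \<sigma> x * a x)"
      by (rule integral_completion) (rule borel_measurable_integrable[OF int])
    also have "\<dots> = ?D * (LINT x|lborel. LINT y|lborel. newton_kernel (x - y) * a x * b y)"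
      unfolding pota by (rule integral_mult_right_zero)
    also have "(LINT x|lborel. LINT y|lborel. newton_kernel (x - y) * a x * b y) =
        (LINT y|lborel. LINT x|lborel. newton_kernel (x - y) * a x * b y)"
      by (rule lborel_pair.Fubini_integral[OF pair])
    also have "\<dots> = (LINT y|lborel. c y * b y)" by (simp add: c)
    also have "\<dots> = (LINT y|lebesgue. c y * \<sigma> y)"
    proof (rule lebesgue_integral_AE_borel[symmetric])
      show "(\<lambda>y. c y * \<sigma> y) \<in> borel_measurable lebesgue"
        by (intro borel_measurable_times borel_imp_lebesgue cm \<sigma>)
      show "AE y in lborel. c y * \<sigma> y = c y * b y" using ae by eventually_elim simp
    qed (use cm in measurable)
    finally show ?thesis .
  qed
qed

lemma newton_pot_lap:
  fixes \<sigma> \<phi> :: "real ^ 'n \<Rightarrow> real"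
  assumes d: "CARD('n) \<ge> 2"
    and \<sigma>: "\<sigma> \<in> borel_measurable lebesgue" and S: "\<And>x. \<bar>\<sigma> x\<bar> \<le> S" and s: "\<And>x. norm x > s \<Longrightarrow> \<sigma> x = 0"
    and \<phi>: "test_fun \<phi>"
  shows "(LINT x|lebesgue. newton_pot \<sigma> x * lap \<phi> x) = - 2 * real CARD('n) * (LINT x|lebesgue. \<sigma> x * \<phi> x)"
proof -
  have l: "test_fun (lap \<phi>)" using \<phi> by (rule test_lap)
  obtain r where r: "\<And>x. norm x \<ge> r \<Longrightarrow> lap \<phi> x = 0" using test_fun_support[OF l] by metis
  obtain B where B: "\<And>x. \<bar>lap \<phi> x\<bar> \<le> B" using test_bounded[OF l] by metis
  have "(LINT x|lebesgue. newton_pot \<sigma> x * lap \<phi> x) = 2 * real CARD('n) * (LINT y|lebesgue. - \<phi> y * \<sigma> y)"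
  proof (rule newton_pot_pairing(2)[where s = s and r = r, OF d \<sigma> S s test_measurable[OF l] B])
    show "lap \<phi> x = 0" if "norm x > r" for x using r that by simp
    show "(\<lambda>y. - \<phi> y) \<in> borel_measurable borel" using test_measurable[OF \<phi>] by simp
  qed (simp_all add: newton_kernel_fundamental[OF d \<phi>])
  then show ?thesis by (simp add: mult.commute)
qed


section \<open>Riemann sums over lattice cells\<close>

text \<open>Index of the half-open cell containing \<open>x\<close>. Unlike the closed boxes in
  \<open>cell_avg\<close>, these cells partition the space, so that a lattice function becomes a
  step function.\<close>

definition cellidx :: "real \<Rightarrow> real ^ 'n \<Rightarrow> int ^ 'n" where
  "cellidx \<xi> x = (\<chi> i. \<lfloor>x $ i / \<xi> + 1 / 2\<rfloor>)"

lemma cellidx_iff: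
  "cellidx \<xi> x = k \<longleftrightarrow> (\<forall>i. real_of_int (k $ i) \<le> x $ i / \<xi> + 1 / 2 \<and> x $ i / \<xi> + 1 / 2 < real_of_int (k $ i) + 1)"
  unfolding cellidx_def vec_eq_iff by (simp add: floor_eq_iff)

lemma One_vec_nth: "(One :: real ^ 'n) $ i = 1"
proof -
  have "(One :: real ^ 'n) \<bullet> axis i 1 = 1" by (rule inner_sum_Basis) (simp add: axis_in_Basis_iff)
  then show ?thesis
    using inner_axis[of "One :: real ^ 'n" i 1] by (simp only: inner_real_def mult_1_right)
qed

lemma sum_Basis_nth: "(\<Sum>x\<in>Basis. (x :: real ^ 'n) $ i) = 1"
  using One_vec_nth[of i] by simp

abbreviation cell_box :: "real \<Rightarrow> int ^ 'n \<Rightarrow> (real ^ 'n) set" where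
  "cell_box \<xi> k \<equiv> cbox (lpt \<xi> k - (\<xi> / 2) *\<^sub>R One) (lpt \<xi> k + (\<xi> / 2) *\<^sub>R One)"

lemma mem_cell_box:
  "x \<in> cell_box \<xi> k \<longleftrightarrow> (\<forall>i. \<bar>x $ i - \<xi> * real_of_int (k $ i)\<bar> \<le> \<xi> / 2)"
proof -
  have "l - h \<le> x \<and> x \<le> l + h \<longleftrightarrow> \<bar>x - l\<bar> \<le> h" for l h x :: real unfolding abs_le_iff by linarith
  then show ?thesis
    by (simp only: mem_box_cart vector_minus_component vector_add_component vector_scaleR_component
        One_vec_nth lpt_nth real_scaleR_def mult_1_right)
qed

lemma cellidx_mem:
  assumes "\<xi> > 0" shows "x \<in> cell_box \<xi> (cellidx \<xi> x)"
  unfolding mem_cell_box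
proof
  fix i
  let ?k = "real_of_int (cellidx \<xi> x $ i)"
  have "?k \<le> x $ i / \<xi> + 1 / 2" "x $ i / \<xi> + 1 / 2 < ?k + 1"
    using cellidx_iff[of \<xi> x "cellidx \<xi> x"] by auto
  then have "\<bar>x $ i / \<xi> - ?k\<bar> \<le> 1 / 2" unfolding abs_le_iff by linarith
  then have "\<bar>x $ i / \<xi> - ?k\<bar> * \<xi> \<le> 1 / 2 * \<xi>" using assms by (intro mult_right_mono) auto
  moreover have "\<bar>x $ i / \<xi> - ?k\<bar> * \<xi> = \<bar>(x $ i / \<xi> - ?k) * \<xi>\<bar>" using assms by (simp add: abs_mult)
  moreover have "(x $ i / \<xi> - ?k) * \<xi> = x $ i - \<xi> * ?k" using assms by (simp add: field_simps)
  ultimately show "\<bar>x $ i - \<xi> * ?k\<bar> \<le> \<xi> / 2" by simp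
qed

lemma cell_box_dist:
  fixes x :: "real ^ 'n"
  assumes "\<xi> > 0" "x \<in> cell_box \<xi> k"
  shows "norm (x - lpt \<xi> k) \<le> real CARD('n) * \<xi>"
proof -
  have "norm (x - lpt \<xi> k) \<le> (\<Sum>i\<in>UNIV. \<bar>(x - lpt \<xi> k) $ i\<bar>)" by (rule norm_le_l1_cart)
  also have "\<dots> \<le> (\<Sum>i\<in>(UNIV :: 'n set). \<xi>)"
  proof (rule sum_mono)
    fix i
    have "\<bar>x $ i - \<xi> * real_of_int (k $ i)\<bar> \<le> \<xi> / 2" using assms(2) unfolding mem_cell_box by blast
    then show "\<bar>(x - lpt \<xi> k) $ i\<bar> \<le> \<xi>" using assms(1) by simp
  qed
  finally show ?thesis by simp
qed

lemma cellidx_dist: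
  fixes x :: "real ^ 'n"
  shows "\<xi> > 0 \<Longrightarrow> norm (x - lpt \<xi> (cellidx \<xi> x)) \<le> real CARD('n) * \<xi>"
  by (rule cell_box_dist[OF _ cellidx_mem])

lemma cell_sets: "{x :: real ^ 'n. cellidx \<xi> x = k} \<in> sets borel"
proof -
  have m: "(\<lambda>x :: real ^ 'n. x $ i) \<in> borel_measurable borel" for i
    by (intro borel_measurable_continuous_onI continuous_intros)
  have "{x :: real ^ 'n. cellidx \<xi> x = k} = (\<Inter>i\<in>UNIV. {x. real_of_int (k $ i) \<le> x $ i / \<xi> + 1 / 2 \<and> x $ i / \<xi> + 1 / 2 < real_of_int (k $ i) + 1})"
    by (auto simp: cellidx_iff)
  also have "\<dots> \<in> sets borel"
  proof (rule sets.finite_INT)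
    fix i
    note m[of i, measurable]
    show "{x :: real ^ 'n. real_of_int (k $ i) \<le> x $ i / \<xi> + 1 / 2 \<and> x $ i / \<xi> + 1 / 2 < real_of_int (k $ i) + 1} \<in> sets borel"
      by measurable
  qed auto
  finally show ?thesis .
qed

lemma cell_box_sides:
  fixes k :: "int ^ 'n"
  assumes "\<xi> > 0"
  defines "l \<equiv> lpt \<xi> k - (\<xi> / 2) *\<^sub>R One" and "u \<equiv> lpt \<xi> k + (\<xi> / 2) *\<^sub>R One"
  shows "\<forall>b\<in>Basis. l \<bullet> b \<le> u \<bullet> b" "(\<Prod>b\<in>Basis. (u - l) \<bullet> b) = \<xi> ^ CARD('n)"
proof -
  have e: "(u - l) \<bullet> b = \<xi>" if "b \<in> Basis" for b
    unfolding l_def u_def by (simp only: inner_diff_left inner_add_left inner_scaleR_left inner_sum_Basis[OF that])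
  then show "(\<Prod>b\<in>Basis. (u - l) \<bullet> b) = \<xi> ^ CARD('n)" by simp
  show "\<forall>b\<in>Basis. l \<bullet> b \<le> u \<bullet> b"
  proof
    fix b :: "real ^ 'n" assume "b \<in> Basis"
    then have "u \<bullet> b - l \<bullet> b = \<xi>" using e by (simp add: inner_diff_left)
    then show "l \<bullet> b \<le> u \<bullet> b" using assms(1) by linarith
  qed
qed

text \<open>The half-open cell lies between the open and the closed box, whose volumes
  agree.\<close>

lemma emeasure_cell:
  fixes k :: "int ^ 'n"
  assumes \<xi>: "\<xi> > 0"
  shows "emeasure lborel {x. cellidx \<xi> x = k} = ennreal (\<xi> ^ CARD('n))"
proof (rule antisym)
  let ?l = "lpt \<xi> k - (\<xi> / 2) *\<^sub>R One" and ?u = "lpt \<xi> k + (\<xi> / 2) *\<^sub>R One"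
  note le = cell_box_sides(1)[OF \<xi>, of k] and p = cell_box_sides(2)[OF \<xi>, of k]
  have "{x. cellidx \<xi> x = k} \<subseteq> cell_box \<xi> k" using cellidx_mem[OF \<xi>] by auto
  then have "emeasure lborel {x. cellidx \<xi> x = k} \<le> emeasure lborel (cell_box \<xi> k)"
    by (rule emeasure_mono) simp
  also have "\<dots> = ennreal (\<xi> ^ CARD('n))" unfolding emeasure_lborel_cbox_eq if_P[OF le] p ..
  finally show "emeasure lborel {x. cellidx \<xi> x = k} \<le> ennreal (\<xi> ^ CARD('n))" .
  have "box ?l ?u \<subseteq> {x. cellidx \<xi> x = k}"
  proof
    fix x assume "x \<in> box ?l ?u"
    then have "\<xi> * real_of_int (k $ i) - \<xi> / 2 < x $ i \<and> x $ i < \<xi> * real_of_int (k $ i) + \<xi> / 2" for i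
      by (auto simp: mem_box_cart sum_Basis_nth)
    then show "x \<in> {x. cellidx \<xi> x = k}" using \<xi> by (auto simp: cellidx_iff field_simps less_imp_le)
  qed
  then have "emeasure lborel (box ?l ?u) \<le> emeasure lborel {x. cellidx \<xi> x = k}"
    by (rule emeasure_mono) (simp add: cell_sets)
  moreover have "emeasure lborel (box ?l ?u) = ennreal (\<xi> ^ CARD('n))" unfolding emeasure_lborel_box_eq if_P[OF le] p ..
  ultimately show "ennreal (\<xi> ^ CARD('n)) \<le> emeasure lborel {x. cellidx \<xi> x = k}" by simp
qed

text \<open>Lattice sums weighted by the cell volume become integrals, so their limits reduce to
  pointwise convergence and domination of step functions.\<close>

lemma step_integral:
  fixes g :: "int ^ 'n \<Rightarrow> real"
  assumes \<xi>: "\<xi> > 0" and A: "finite A" "\<And>k. k \<notin> A \<Longrightarrow> g k = 0"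
  shows "(\<lambda>x. g (cellidx \<xi> x)) \<in> borel_measurable borel"
    and "integrable lborel (\<lambda>x. g (cellidx \<xi> x))"
    and "(LINT x|lborel. g (cellidx \<xi> x)) = \<xi> ^ CARD('n) * (\<Sum>k\<in>A. g k)"
proof -
  let ?C = "\<lambda>k :: int ^ 'n. {x. cellidx \<xi> x = k}"
  have eq: "(\<lambda>x. g (cellidx \<xi> x)) = (\<lambda>x. \<Sum>k\<in>A. g k * indicator (?C k) x)"
  proof
    fix x
    have "(\<Sum>k\<in>A. g k * indicator (?C k) x) = (\<Sum>k\<in>A. if k = cellidx \<xi> x then g k else 0)"
      by (rule sum.cong) (auto simp: indicator_def)
    also have "\<dots> = g (cellidx \<xi> x)" using A by (simp add: sum.delta)
    finally show "g (cellidx \<xi> x) = (\<Sum>k\<in>A. g k * indicator (?C k) x)" by simp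
  qed
  have i: "integrable lborel (\<lambda>x. g k * indicator (?C k) x)" for k
    using emeasure_cell[OF \<xi>, of k] cell_sets[of \<xi> k]
    by (intro integrable_mult_right integrable_real_indicator) auto
  show int: "integrable lborel (\<lambda>x. g (cellidx \<xi> x))"
    unfolding eq by (rule Bochner_Integration.integrable_sum) (rule i)
  then show "(\<lambda>x. g (cellidx \<xi> x)) \<in> borel_measurable borel" using borel_measurable_integrable by fastforce
  have v: "(LINT x|lborel. g k * indicator (?C k) x) = g k * \<xi> ^ CARD('n)" for k
    using emeasure_cell[OF \<xi>, of k] \<xi> by (simp add: measure_def)
  show "(LINT x|lborel. g (cellidx \<xi> x)) = \<xi> ^ CARD('n) * (\<Sum>k\<in>A. g k)"
    unfolding eq Bochner_Integration.integral_sum[OF i] v sum_distrib_left by (simp only: mult.commute)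
qed

text \<open>The disjoint cells belonging to points of the lattice ball lie in a slightly larger
  ball. Enlarging by means of \<open>X\<close>, a bound for all mesh sizes, keeps the estimate
  uniform.\<close>

lemma lat_ball_card_le:
  assumes \<xi>: "\<xi> > 0" "\<xi> \<le> X"
  shows "\<xi> ^ CARD('n) * real (card (lat_ball \<xi> R :: (int ^ 'n) set))
    \<le> measure lborel (cball (0 :: real ^ 'n) (R + real CARD('n) * X))"
proof -
  let ?B = "lat_ball \<xi> R :: (int ^ 'n) set"
  let ?S = "cball (0 :: real ^ 'n) (R + real CARD('n) * X)"
  have f: "finite ?B" by (rule finite_lat_ball[OF \<xi>(1)])
  have st: "k \<notin> ?B \<Longrightarrow> (indicator ?B k :: real) = 0" for k by simp
  note s = step_integral[of \<xi> ?B "indicator ?B", OF \<xi>(1) f st]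
  have "\<xi> ^ CARD('n) * real (card ?B) = (LINT x|lborel. indicator ?B (cellidx \<xi> (x :: real ^ 'n)))"
    using s(3) f by simp
  also have "\<dots> \<le> (LINT x|lborel. indicator ?S x)"
  proof (rule integral_mono[OF s(2)])
    show "integrable lborel (indicator ?S :: real ^ 'n \<Rightarrow> real)"
      using emeasure_compact_finite[of ?S] by (intro integrable_real_indicator) auto
    fix x :: "real ^ 'n"
    show "indicator ?B (cellidx \<xi> x) \<le> (indicator ?S x :: real)"
    proof (cases "cellidx \<xi> x \<in> ?B")
      case True
      then have "norm (lpt \<xi> (cellidx \<xi> x)) < R" by (simp add: lat_ball_def)
      moreover have "real CARD('n) * \<xi> \<le> real CARD('n) * X" using \<xi> by (intro mult_left_mono) auto
      ultimately have "norm x \<le> R + real CARD('n) * X"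
        using cellidx_dist[OF \<xi>(1), of x] norm_triangle_sub[of x "lpt \<xi> (cellidx \<xi> x)"] by linarith
      then show ?thesis by (simp add: indicator_def)
    qed simp
  qed
  also have "\<dots> = measure lborel ?S" by simp
  finally show ?thesis .
qed

text \<open>One estimate for two purposes: \<open>c = 0\<close> gives the uniform bound on the
  averages, and \<open>c = \<sigma> x\<close> their convergence at points of continuity.\<close>

lemma cell_avg_dist:
  fixes \<sigma> :: "real ^ 'n \<Rightarrow> real"
  assumes \<xi>: "\<xi> > 0" and \<sigma>: "integrable lebesgue \<sigma>"
    and e: "\<And>y. y \<in> cell_box \<xi> k \<Longrightarrow> \<bar>\<sigma> y - c\<bar> \<le> e"
  shows "\<bar>cell_avg \<sigma> \<xi> k - c\<bar> \<le> e"
proof -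
  let ?Q = "cell_box \<xi> k" and ?p = "\<xi> ^ CARD('n)"
  have p: "?p > 0" using \<xi> by simp
  have mQ: "measure lebesgue ?Q = ?p"
  proof -
    let ?l = "lpt \<xi> k - (\<xi> / 2) *\<^sub>R One" and ?u = "lpt \<xi> k + (\<xi> / 2) *\<^sub>R One"
    have "measure lborel ?Q = (\<Prod>b\<in>Basis. (?u - ?l) \<bullet> b)"
      unfolding measure_lborel_cbox_eq if_P[OF cell_box_sides(1)[OF \<xi>, of k]] ..
    also have "\<dots> = ?p" by (rule cell_box_sides(2)[OF \<xi>])
    finally show ?thesis by simp
  qed
  have iQ: "integrable lebesgue (indicator ?Q :: real ^ 'n \<Rightarrow> real)"
    using emeasure_compact_finite[of ?Q] by (intro integrable_real_indicator) auto
  have iS: "integrable lebesgue (\<lambda>y. indicator ?Q y * \<sigma> y)"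
  proof (rule Bochner_Integration.integrable_bound[OF \<sigma>])
    show "(\<lambda>y. indicator ?Q y * \<sigma> y) \<in> borel_measurable lebesgue"
      by (intro borel_measurable_times borel_measurable_integrable[OF iQ] borel_measurable_integrable[OF \<sigma>])
  qed (auto simp: indicator_def)
  have "cell_avg \<sigma> \<xi> k = (LINT y|lebesgue. indicator ?Q y * \<sigma> y) / ?p"
    by (simp only: cell_avg_def set_lebesgue_integral_def powr_neg_nat[OF \<xi>] real_scaleR_def times_divide_eq_left mult_1_left)
  moreover have "(LINT y|lebesgue. indicator ?Q y * c) = ?p * c" unfolding mQ[symmetric] by simp
  moreover have "(LINT y|lebesgue. indicator ?Q y * \<sigma> y - indicator ?Q y * c) =
      (LINT y|lebesgue. indicator ?Q y * \<sigma> y) - (LINT y|lebesgue. indicator ?Q y * c)"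
    by (rule Bochner_Integration.integral_diff[OF iS integrable_mult_left[OF iQ]])
  ultimately have eq: "cell_avg \<sigma> \<xi> k - c = (LINT y|lebesgue. indicator ?Q y * \<sigma> y - indicator ?Q y * c) / ?p"
    using p \<xi> by (simp only: diff_divide_distrib) simp
  have le: "\<bar>LINT y|lebesgue. indicator ?Q y * \<sigma> y - indicator ?Q y * c\<bar> \<le> (LINT y|lebesgue. e * indicator ?Q y)"
  proof (rule order_trans[OF integral_abs_bound], rule integral_mono)
    show "integrable lebesgue (\<lambda>y. \<bar>indicator ?Q y * \<sigma> y - indicator ?Q y * c\<bar>)"
      using iS iQ by (intro integrable_abs Bochner_Integration.integrable_diff integrable_mult_left) auto
    show "integrable lebesgue (\<lambda>y. e * indicator ?Q y)" using iQ by (rule integrable_mult_right)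
  qed (use e in \<open>auto simp: indicator_def\<close>)
  have m: "(LINT y|lebesgue. indicator ?Q y) = ?p"
    using mQ by (simp only: Bochner_Integration.integral_indicator space_completion space_lborel space_borel Int_UNIV_right)
  have "(LINT y|lebesgue. e * indicator ?Q y) = e * (LINT y|lebesgue. indicator ?Q y)"
    by (rule integral_mult_right_zero)
  then have "(LINT y|lebesgue. e * indicator ?Q y) = e * ?p" by (simp only: m)
  then show ?thesis using le p unfolding eq abs_divide by (simp only: abs_of_pos pos_divide_le_eq)
qed

lemma isCont_cell_avg_tendsto:
  fixes \<sigma> :: "real ^ 'n \<Rightarrow> real"
  assumes \<sigma>: "integrable lebesgue \<sigma>" and c: "isCont \<sigma> x"
    and \<xi>: "\<And>n. \<xi> n > 0" "\<xi> \<longlonglongrightarrow> 0"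
  shows "(\<lambda>n. cell_avg \<sigma> (\<xi> n) (cellidx (\<xi> n) x)) \<longlonglongrightarrow> \<sigma> x"
proof (rule LIMSEQ_I)
  fix e :: real assume e: "e > 0"
  obtain \<delta> where \<delta>: "\<delta> > 0" "\<And>y. norm (y - x) < \<delta> \<Longrightarrow> \<bar>\<sigma> y - \<sigma> x\<bar> < e / 2"
    using c e unfolding continuous_at_eps_delta by (metis half_gt_zero dist_norm real_norm_def)
  \<comment> \<open>A point of the cell and \<open>x\<close> itself each lie within
    \<open>d * \<xi>\<close> of the centre of the cell, whence the factor two.\<close>
  have "(\<lambda>n. 2 * real CARD('n) * \<xi> n) \<longlonglongrightarrow> 2 * real CARD('n) * 0" by (intro tendsto_intros \<xi>)
  then have "eventually (\<lambda>n. 2 * real CARD('n) * \<xi> n < \<delta>) sequentially"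
    using \<delta>(1) order_tendstoD(2) by fastforce
  then obtain N where N: "\<And>n. n \<ge> N \<Longrightarrow> 2 * real CARD('n) * \<xi> n < \<delta>" by (auto simp: eventually_sequentially)
  have "norm (cell_avg \<sigma> (\<xi> n) (cellidx (\<xi> n) x) - \<sigma> x) < e" if n: "n \<ge> N" for n
  proof -
    have "\<bar>cell_avg \<sigma> (\<xi> n) (cellidx (\<xi> n) x) - \<sigma> x\<bar> \<le> e / 2"
    proof (rule cell_avg_dist[OF \<xi>(1) \<sigma>])
      fix y assume y: "y \<in> cell_box (\<xi> n) (cellidx (\<xi> n) x)"
      have "norm (y - x) \<le> norm (y - lpt (\<xi> n) (cellidx (\<xi> n) x)) + norm (lpt (\<xi> n) (cellidx (\<xi> n) x) - x)"
        using norm_triangle_ineq[of "y - lpt (\<xi> n) (cellidx (\<xi> n) x)" "lpt (\<xi> n) (cellidx (\<xi> n) x) - x"] by simp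
      also have "\<dots> \<le> real CARD('n) * \<xi> n + real CARD('n) * \<xi> n"
        using cell_box_dist[OF \<xi>(1) y] cellidx_dist[OF \<xi>(1)[of n], of x]
          norm_minus_commute[of x "lpt (\<xi> n) (cellidx (\<xi> n) x)"] by linarith
      finally have "norm (y - x) < \<delta>" using N[OF n] by linarith
      then show "\<bar>\<sigma> y - \<sigma> x\<bar> \<le> e / 2" using \<delta>(2)[of y] by simp
    qed
    then show ?thesis using e by simp
  qed
  then show "\<exists>N. \<forall>n\<ge>N. norm (cell_avg \<sigma> (\<xi> n) (cellidx (\<xi> n) x) - \<sigma> x) < e" by blast
qed

section \<open>Limits of lattice sums and mollified densities\<close>

lemma lpt_cellidx_tendsto:
  fixes x :: "real ^ 'n"
  assumes \<xi>: "\<And>n. \<xi> n > 0" "\<xi> \<longlonglongrightarrow> 0"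
  shows "(\<lambda>n. lpt (\<xi> n) (cellidx (\<xi> n) x)) \<longlonglongrightarrow> x"
proof -
  have "(\<lambda>n. real CARD('n) * \<xi> n) \<longlonglongrightarrow> real CARD('n) * 0" by (intro tendsto_intros \<xi>)
  then have "(\<lambda>n. real CARD('n) * \<xi> n) \<longlonglongrightarrow> 0" by simp
  then have "(\<lambda>n. lpt (\<xi> n) (cellidx (\<xi> n) x) - x) \<longlonglongrightarrow> 0"
    by (rule Lim_null_comparison[rotated])
      (use cellidx_dist[OF \<xi>(1), of x] in \<open>auto simp: norm_minus_commute\<close>)
  then show ?thesis by (simp only: LIM_zero_iff)
qed

text \<open>Dominated convergence for the associated step functions; the bound \<open>X\<close> on
  the mesh places all their supports in one ball.\<close>

lemma lattice_sum_tendsto: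
  fixes g :: "nat \<Rightarrow> int ^ 'n \<Rightarrow> real" and F :: "real ^ 'n \<Rightarrow> real"
  assumes \<xi>: "\<And>n. \<xi> n > 0" "\<And>n. \<xi> n \<le> X"
    and F: "F \<in> borel_measurable lebesgue"
    and g: "\<And>n k. \<bar>g n k\<bar> \<le> B" "\<And>n k. k \<notin> lat_ball (\<xi> n) R \<Longrightarrow> g n k = 0"
    and lim: "AE x in lebesgue. (\<lambda>n. g n (cellidx (\<xi> n) x)) \<longlonglongrightarrow> F x"
  shows "integrable lebesgue F"
    and "(\<lambda>n. \<xi> n ^ CARD('n) * (\<Sum>k\<in>lat_ball (\<xi> n) R. g n k)) \<longlonglongrightarrow> integral\<^sup>L lebesgue F"
proof -
  let ?S = "cball (0 :: real ^ 'n) (R + real CARD('n) * X)"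
  note s = step_integral[OF \<xi>(1) finite_lat_ball[OF \<xi>(1)] g(2)]
  have m: "(\<lambda>x. g n (cellidx (\<xi> n) x)) \<in> borel_measurable lebesgue" for n
    by (rule borel_imp_lebesgue) (rule s(1))
  have w: "integrable lebesgue (\<lambda>x. B * indicator ?S x)"
    using emeasure_compact_finite[of ?S] by (intro integrable_mult_right integrable_real_indicator) auto
  have bd: "\<bar>g n (cellidx (\<xi> n) x)\<bar> \<le> B * indicator ?S x" for n x
  proof (cases "cellidx (\<xi> n) x \<in> lat_ball (\<xi> n) R")
    case True
    then have "norm (lpt (\<xi> n) (cellidx (\<xi> n) x)) < R" by (simp add: lat_ball_def)
    moreover have "real CARD('n) * \<xi> n \<le> real CARD('n) * X" using \<xi> by (intro mult_left_mono) auto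
    ultimately have "norm x \<le> R + real CARD('n) * X"
      using cellidx_dist[OF \<xi>(1)[of n], of x] norm_triangle_sub[of x "lpt (\<xi> n) (cellidx (\<xi> n) x)"] by linarith
    then show ?thesis using g(1) by (simp add: indicator_def)
  next
    case False
    have "B \<ge> 0" using g(1)[of 0 0] by linarith
    then show ?thesis using g(2)[OF False] by (simp add: indicator_def)
  qed
  have bd': "AE x in lebesgue. norm (g n (cellidx (\<xi> n) x)) \<le> B * indicator ?S x" for n
    using bd by simp
  show "integrable lebesgue F" by (rule integrable_dominated_convergence[OF F m w lim bd'])
  have "(\<lambda>n. LINT x|lebesgue. g n (cellidx (\<xi> n) x)) \<longlonglongrightarrow> integral\<^sup>L lebesgue F"
    by (rule integral_dominated_convergence[OF F m w lim bd'])
  moreover have "(LINT x|lebesgue. g n (cellidx (\<xi> n) x)) = \<xi> n ^ CARD('n) * (\<Sum>k\<in>lat_ball (\<xi> n) R. g n k)" for n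
    by (subst integral_completion) (use s in auto)
  ultimately show "(\<lambda>n. \<xi> n ^ CARD('n) * (\<Sum>k\<in>lat_ball (\<xi> n) R. g n k)) \<longlonglongrightarrow> integral\<^sup>L lebesgue F" by simp
qed

text \<open>The argument \<open>y - z\<close> makes this the pairing of \<open>\<sigma>\<close> with
  the translate of \<open>\<rho>\<close> centred at \<open>z\<close>, exactly the quantity that the
  obstacle condition produces when tested with that translate.\<close>

definition mollify :: "(real ^ 'n \<Rightarrow> real) \<Rightarrow> (real ^ 'n \<Rightarrow> real) \<Rightarrow> real ^ 'n \<Rightarrow> real" where
  "mollify \<sigma> \<rho> z = (LINT y|lebesgue. \<sigma> y * \<rho> (y - z))"

lemma lebesgue_integral_translate:
  fixes f :: "real ^ 'n \<Rightarrow> real"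
  assumes "f \<in> borel_measurable borel"
  shows "(LINT x|lebesgue. f (x - a)) = integral\<^sup>L lebesgue f"
proof -
  have "(LINT x|lebesgue. f (x - a)) = (LINT x|lborel. f (x - a))"
    by (rule integral_completion) (use assms in measurable)
  also have "\<dots> = integral\<^sup>L lborel f" using lborel_integral_translate(1)[OF assms, of "- a"] by simp
  also have "\<dots> = integral\<^sup>L lebesgue f" by (rule integral_completion[symmetric]) (use assms in simp)
  finally show ?thesis .
qed

lemma integrable_mult_test:
  assumes "integrable lebesgue \<sigma>" "test_fun \<phi>"
  shows "integrable lebesgue (\<lambda>y. \<sigma> y * \<phi> (y - z))"
proof -
  obtain B where B: "B > 0" "\<And>x. \<bar>\<phi> x\<bar> \<le> B" using test_bounded[OF assms(2)] by metis
  show ?thesis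
  proof (rule Bochner_Integration.integrable_bound[OF integrable_mult_right[OF assms(1), of B]])
    show "(\<lambda>y. \<sigma> y * \<phi> (y - z)) \<in> borel_measurable lebesgue"
      by (intro borel_measurable_times borel_measurable_integrable[OF assms(1)]
          test_measurable_leb[OF test_translate[OF assms(2)]])
    have "\<bar>\<sigma> y\<bar> * \<bar>\<phi> (y - z)\<bar> \<le> \<bar>\<sigma> y\<bar> * B" for y using B(2) by (intro mult_left_mono) auto
    then show "AE y in lebesgue. norm (\<sigma> y * \<phi> (y - z)) \<le> norm (B * \<sigma> y)"
      using B(1) by (intro AE_I2) (simp add: abs_mult mult.commute)
  qed
qed

lemma mollify_lipschitz:
  assumes \<sigma>: "integrable lebesgue \<sigma>" and \<rho>: "test_fun \<rho>"
  obtains L where "\<And>z z'. \<bar>mollify \<sigma> \<rho> z - mollify \<sigma> \<rho> z'\<bar> \<le> L * norm (z - z')"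
proof -
  obtain L where L: "L > 0" "\<And>x y. \<bar>\<rho> x - \<rho> y\<bar> \<le> L * norm (x - y)" using test_lipschitz[OF \<rho>] by metis
  have "\<bar>mollify \<sigma> \<rho> z - mollify \<sigma> \<rho> z'\<bar> \<le> (L * (LINT y|lebesgue. \<bar>\<sigma> y\<bar>)) * norm (z - z')" for z z'
  proof -
    have "mollify \<sigma> \<rho> z - mollify \<sigma> \<rho> z' = (LINT y|lebesgue. \<sigma> y * \<rho> (y - z) - \<sigma> y * \<rho> (y - z'))"
      unfolding mollify_def
      by (rule Bochner_Integration.integral_diff[symmetric]) (rule integrable_mult_test[OF assms])+
    also have "\<bar>\<dots>\<bar> \<le> (LINT y|lebesgue. (L * norm (z - z')) * \<bar>\<sigma> y\<bar>)"
    proof (rule order_trans[OF integral_abs_bound], rule integral_mono)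
      show "integrable lebesgue (\<lambda>y. \<bar>\<sigma> y * \<rho> (y - z) - \<sigma> y * \<rho> (y - z')\<bar>)"
        by (intro integrable_abs Bochner_Integration.integrable_diff integrable_mult_test assms)
      show "integrable lebesgue (\<lambda>y. (L * norm (z - z')) * \<bar>\<sigma> y\<bar>)" using \<sigma> by auto
      fix y
      have "\<bar>\<sigma> y\<bar> * \<bar>\<rho> (y - z) - \<rho> (y - z')\<bar> \<le> \<bar>\<sigma> y\<bar> * (L * norm (z - z'))"
        using L(2)[of "y - z" "y - z'"] by (intro mult_left_mono) (auto simp: norm_minus_commute)
      then show "\<bar>\<sigma> y * \<rho> (y - z) - \<sigma> y * \<rho> (y - z')\<bar> \<le> (L * norm (z - z')) * \<bar>\<sigma> y\<bar>"
        by (simp add: abs_mult right_diff_distrib[symmetric] mult.commute)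
    qed
    finally show ?thesis by (simp add: mult_ac)
  qed
  then show ?thesis using that by blast
qed

text \<open>Counterpart of \<open>cell_avg_dist\<close> for weighted averages: \<open>c = 0\<close>
  yields bounds and supports, \<open>c = \<sigma> x\<close> convergence.\<close>

lemma mollify_dist:
  fixes \<sigma> \<rho> :: "real ^ 'n \<Rightarrow> real"
  assumes \<sigma>: "integrable lebesgue \<sigma>" and \<rho>: "test_fun \<rho>" "\<And>x. \<rho> x \<ge> 0" "integral\<^sup>L lebesgue \<rho> = 1"
    and r: "\<And>x. norm x \<ge> r \<Longrightarrow> \<rho> x = 0"
    and e: "\<And>y. norm (y - z) < r \<Longrightarrow> \<bar>\<sigma> y - c\<bar> \<le> e"
  shows "\<bar>mollify \<sigma> \<rho> z - c\<bar> \<le> e"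
proof -
  have t: "(LINT y|lebesgue. \<rho> (y - z)) = 1" by (simp only: lebesgue_integral_translate[OF test_measurable[OF \<rho>(1)]] \<rho>(3))
  have i: "integrable lebesgue (\<lambda>y. \<rho> (y - z))" by (rule test_integrable[OF test_translate[OF \<rho>(1)]])
  have "mollify \<sigma> \<rho> z - c = (LINT y|lebesgue. \<sigma> y * \<rho> (y - z)) - (LINT y|lebesgue. c * \<rho> (y - z))"
    using t by (simp add: mollify_def)
  also have "\<dots> = (LINT y|lebesgue. \<sigma> y * \<rho> (y - z) - c * \<rho> (y - z))"
    by (rule Bochner_Integration.integral_diff[symmetric])
      (rule integrable_mult_test[OF \<sigma> \<rho>(1)], rule integrable_mult_right[OF i])
  also have "\<bar>\<dots>\<bar> \<le> (LINT y|lebesgue. e * \<rho> (y - z))"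
  proof (rule order_trans[OF integral_abs_bound], rule integral_mono)
    show "integrable lebesgue (\<lambda>y. \<bar>\<sigma> y * \<rho> (y - z) - c * \<rho> (y - z)\<bar>)"
      by (intro integrable_abs Bochner_Integration.integrable_diff integrable_mult_test[OF \<sigma> \<rho>(1)]
          integrable_mult_right[OF i])
    show "integrable lebesgue (\<lambda>y. e * \<rho> (y - z))" using i by auto
    fix y
    show "\<bar>\<sigma> y * \<rho> (y - z) - c * \<rho> (y - z)\<bar> \<le> e * \<rho> (y - z)"
    proof (cases "norm (y - z) < r")
      case True
      have "\<bar>\<sigma> y - c\<bar> * \<rho> (y - z) \<le> e * \<rho> (y - z)" using e[OF True] \<rho>(2) by (rule mult_right_mono)
      then show ?thesis using \<rho>(2)[of "y - z"] by (simp add: left_diff_distrib[symmetric] abs_mult)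
    next
      case False
      then show ?thesis using r[of "y - z"] by simp
    qed
  qed
  also have "\<dots> = e" using t by simp
  finally show ?thesis .
qed

lemma mollify_zero:
  fixes \<sigma> \<rho> :: "real ^ 'n \<Rightarrow> real"
  assumes "integrable lebesgue \<sigma>" "test_fun \<rho>" "\<And>x. \<rho> x \<ge> 0" "integral\<^sup>L lebesgue \<rho> = 1"
    "\<And>x. norm x \<ge> r \<Longrightarrow> \<rho> x = 0" "\<And>x. norm x > s \<Longrightarrow> \<sigma> x = 0" "norm z \<ge> s + r"
  shows "mollify \<sigma> \<rho> z = 0"
proof -
  have "\<bar>mollify \<sigma> \<rho> z - 0\<bar> \<le> 0"
  proof (rule mollify_dist[OF assms(1-5)])
    fix y assume "norm (y - z) < r"
    then have "norm y > s" using assms(7) norm_triangle_ineq2[of z y] by (simp add: norm_minus_commute)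
    then show "\<bar>\<sigma> y - 0\<bar> \<le> 0" using assms(6) by simp
  qed
  then show ?thesis by simp
qed

locale density =
  fixes \<sigma> :: "real ^ 'n \<Rightarrow> real" and \<xi> :: "nat \<Rightarrow> real" and R S :: real
  assumes \<sigma>_meas: "\<sigma> \<in> borel_measurable lebesgue"
    and \<sigma>_bound: "\<And>x. \<bar>\<sigma> x\<bar> \<le> S"
    and \<sigma>_supp: "\<And>x. norm x > R \<Longrightarrow> \<sigma> x = 0"
    and \<sigma>_cont: "AE x in lebesgue. isCont \<sigma> x"
    and \<xi>_pos: "\<And>n. \<xi> n > 0" and \<xi>_dec: "decseq \<xi>" and \<xi>_lim: "\<xi> \<longlonglongrightarrow> 0"
    and R_pos: "R > 0"
    and avg_supp: "\<And>n k. k \<notin> lat_ball (\<xi> n) R \<Longrightarrow> cell_avg \<sigma> (\<xi> n) k = 0"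
begin

lemma \<xi>_le: "\<xi> n \<le> \<xi> 0"
  using \<xi>_dec by (simp add: decseq_def)

lemma \<sigma>_int: "integrable lebesgue \<sigma>"
  by (rule integrable_bounded_support[OF \<sigma>_meas \<sigma>_bound \<sigma>_supp])

lemma S_nonneg: "S \<ge> 0"
  using \<sigma>_bound[of 0] by linarith

lemma avg_bound: "\<bar>cell_avg \<sigma> (\<xi> n) k\<bar> \<le> S"
  using cell_avg_dist[OF \<xi>_pos \<sigma>_int, of n k 0 S] \<sigma>_bound by simp

text \<open>Almost everywhere continuity enters here: at points of continuity the cell averages and
  the sampled values of \<open>\<phi>\<close> both converge.\<close>

lemma avg_pairing_tendsto:
  assumes \<phi>: "test_fun \<phi>"
  shows "(\<lambda>n. \<xi> n ^ CARD('n) * (\<Sum>k\<in>lat_ball (\<xi> n) R. cell_avg \<sigma> (\<xi> n) k * \<phi> (lpt (\<xi> n) k)))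
    \<longlonglongrightarrow> (LINT x|lebesgue. \<sigma> x * \<phi> x)"
proof -
  obtain B where B: "B > 0" "\<And>x. \<bar>\<phi> x\<bar> \<le> B" using test_bounded[OF \<phi>] by metis
  show ?thesis
  proof (rule lattice_sum_tendsto(2)[OF \<xi>_pos \<xi>_le])
    show "(\<lambda>x. \<sigma> x * \<phi> x) \<in> borel_measurable lebesgue"
      by (intro borel_measurable_times \<sigma>_meas test_measurable_leb \<phi>)
    show "\<bar>cell_avg \<sigma> (\<xi> n) k * \<phi> (lpt (\<xi> n) k)\<bar> \<le> S * B" for n k
      unfolding abs_mult using avg_bound B S_nonneg by (intro mult_mono) auto
    show "AE x in lebesgue. (\<lambda>n. cell_avg \<sigma> (\<xi> n) (cellidx (\<xi> n) x) * \<phi> (lpt (\<xi> n) (cellidx (\<xi> n) x))) \<longlonglongrightarrow> \<sigma> x * \<phi> x"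
      using \<sigma>_cont
    proof eventually_elim
      case (elim x)
      have "isCont \<phi> x" using \<phi> by (simp add: differentiable_imp_continuous_within smooth_differentiable test_smooth)
      then have "(\<lambda>n. \<phi> (lpt (\<xi> n) (cellidx (\<xi> n) x))) \<longlonglongrightarrow> \<phi> x"
        by (rule isCont_tendsto_compose) (rule lpt_cellidx_tendsto[OF \<xi>_pos \<xi>_lim])
      then show ?case by (intro tendsto_mult isCont_cell_avg_tendsto[OF \<sigma>_int elim \<xi>_pos \<xi>_lim])
    qed
  qed (simp add: avg_supp)
qed

text \<open>The radius \<open>R + r\<close> covers the supports of the averages and of the mollified
  density. The limit no longer involves the lattice, so it can be made small by the choice of the
  mollifier alone.\<close>

lemma avg_mollify_tendsto:
  assumes \<rho>: "test_fun \<rho>" "\<And>x. \<rho> x \<ge> 0" "integral\<^sup>L lebesgue \<rho> = 1" and r: "r > 0" "\<And>x. norm x \<ge> r \<Longrightarrow> \<rho> x = 0"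
  shows "(\<lambda>n. \<xi> n ^ CARD('n) * (\<Sum>k\<in>lat_ball (\<xi> n) (R + r). \<bar>cell_avg \<sigma> (\<xi> n) k - mollify \<sigma> \<rho> (lpt (\<xi> n) k)\<bar>))
    \<longlonglongrightarrow> (LINT x|lebesgue. \<bar>\<sigma> x - mollify \<sigma> \<rho> x\<bar>)"
proof -
  obtain L where L: "\<And>z z'. \<bar>mollify \<sigma> \<rho> z - mollify \<sigma> \<rho> z'\<bar> \<le> L * norm (z - z')"
    using mollify_lipschitz[OF \<sigma>_int \<rho>(1)] by metis
  have mb: "\<bar>mollify \<sigma> \<rho> z\<bar> \<le> S" for z
    using mollify_dist[OF \<sigma>_int \<rho> r(2), where z = z and c = 0 and e = S] \<sigma>_bound by simp
  have mm: "mollify \<sigma> \<rho> \<in> borel_measurable borel" by (rule lipschitz_measurable[OF L])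
  show ?thesis
  proof (rule lattice_sum_tendsto(2)[OF \<xi>_pos \<xi>_le])
    show "(\<lambda>x. \<bar>\<sigma> x - mollify \<sigma> \<rho> x\<bar>) \<in> borel_measurable lebesgue"
      by (intro borel_measurable_abs borel_measurable_diff \<sigma>_meas borel_imp_lebesgue mm)
    show "\<bar>\<bar>cell_avg \<sigma> (\<xi> n) k - mollify \<sigma> \<rho> (lpt (\<xi> n) k)\<bar>\<bar> \<le> 2 * S" for n k
      using avg_bound[of n k] mb[of "lpt (\<xi> n) k"] by linarith
    show "\<bar>cell_avg \<sigma> (\<xi> n) k - mollify \<sigma> \<rho> (lpt (\<xi> n) k)\<bar> = 0" if "k \<notin> lat_ball (\<xi> n) (R + r)" for n k
    proof -
      have k: "norm (lpt (\<xi> n) k) \<ge> R + r" using that by (simp add: lat_ball_def)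
      have "cell_avg \<sigma> (\<xi> n) k = 0" using k r(1) by (intro avg_supp) (simp add: lat_ball_def)
      moreover have "mollify \<sigma> \<rho> (lpt (\<xi> n) k) = 0" by (rule mollify_zero[OF \<sigma>_int \<rho> r(2) \<sigma>_supp k])
      ultimately show ?thesis by simp
    qed
    show "AE x in lebesgue. (\<lambda>n. \<bar>cell_avg \<sigma> (\<xi> n) (cellidx (\<xi> n) x) - mollify \<sigma> \<rho> (lpt (\<xi> n) (cellidx (\<xi> n) x))\<bar>)
        \<longlonglongrightarrow> \<bar>\<sigma> x - mollify \<sigma> \<rho> x\<bar>"
      using \<sigma>_cont
    proof eventually_elim
      case (elim x)
      have "(\<lambda>n. lpt (\<xi> n) (cellidx (\<xi> n) x) - x) \<longlonglongrightarrow> 0"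
        using lpt_cellidx_tendsto[OF \<xi>_pos \<xi>_lim, of x] by (simp only: LIM_zero_iff)
      then have "(\<lambda>n. L * norm (lpt (\<xi> n) (cellidx (\<xi> n) x) - x)) \<longlonglongrightarrow> L * norm (0 :: real ^ 'n)"
        by (intro tendsto_mult tendsto_const tendsto_norm)
      then have lz: "(\<lambda>n. L * norm (lpt (\<xi> n) (cellidx (\<xi> n) x) - x)) \<longlonglongrightarrow> 0" by simp
      have "(\<lambda>n. mollify \<sigma> \<rho> (lpt (\<xi> n) (cellidx (\<xi> n) x)) - mollify \<sigma> \<rho> x) \<longlonglongrightarrow> 0"
        by (rule Lim_null_comparison[OF _ lz]) (simp add: L)
      then have "(\<lambda>n. mollify \<sigma> \<rho> (lpt (\<xi> n) (cellidx (\<xi> n) x))) \<longlonglongrightarrow> mollify \<sigma> \<rho> x"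
        by (simp only: LIM_zero_iff)
      then show ?case
        by (intro tendsto_rabs tendsto_diff isCont_cell_avg_tendsto[OF \<sigma>_int elim \<xi>_pos \<xi>_lim])
    qed
  qed
qed

text \<open>Mollified densities converge at points of continuity and are dominated on a fixed ball,
  hence converge in mean. A single mollifier far along the sequence has both a small radius and a
  small error.\<close>

lemma ex_mollifier_L1:
  assumes "\<delta> > 0"
  obtains \<rho> r where "test_fun \<rho>" "\<And>x. \<rho> x \<ge> 0" "integral\<^sup>L lebesgue \<rho> = 1" "r > 0" "r < \<delta>"
    "\<And>x. norm x \<ge> r \<Longrightarrow> \<rho> x = 0" "\<And>x. \<rho> (- x) = \<rho> x" "(LINT x|lebesgue. \<bar>\<sigma> x - mollify \<sigma> \<rho> x\<bar>) < \<delta>"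
proof -
  define h where "h j = 1 / real (Suc j)" for j
  have h: "h j > 0" "h j \<le> 1" for j by (auto simp: h_def)
  have h0: "h \<longlonglongrightarrow> 0" unfolding h_def[abs_def] by (rule LIMSEQ_Suc[OF lim_1_over_n])
  have "\<forall>j. \<exists>\<rho> :: real ^ 'n \<Rightarrow> real. test_fun \<rho> \<and> (\<forall>x. \<rho> x \<ge> 0) \<and> integral\<^sup>L lebesgue \<rho> = 1 \<and>
      (\<forall>x. norm x \<ge> h j \<longrightarrow> \<rho> x = 0) \<and> (\<forall>x. \<rho> (- x) = \<rho> x)"
  proof
    fix j
    obtain \<rho> :: "real ^ 'n \<Rightarrow> real" where "test_fun \<rho>" "\<And>x. \<rho> x \<ge> 0" "\<And>x. norm x \<ge> h j \<Longrightarrow> \<rho> x = 0"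
      "integral\<^sup>L lebesgue \<rho> = 1" "\<And>x. \<rho> (- x) = \<rho> x"
      using ex_mollifier[OF h(1)[of j]] by blast
    then show "\<exists>\<rho> :: real ^ 'n \<Rightarrow> real. test_fun \<rho> \<and> (\<forall>x. \<rho> x \<ge> 0) \<and> integral\<^sup>L lebesgue \<rho> = 1 \<and>
      (\<forall>x. norm x \<ge> h j \<longrightarrow> \<rho> x = 0) \<and> (\<forall>x. \<rho> (- x) = \<rho> x)" by blast
  qed
  then obtain \<rho> :: "nat \<Rightarrow> real ^ 'n \<Rightarrow> real" where \<rho>: "\<And>j. test_fun (\<rho> j)" "\<And>j x. \<rho> j x \<ge> 0"
    "\<And>j. integral\<^sup>L lebesgue (\<rho> j) = 1" and \<rho>0: "\<And>j x. norm x \<ge> h j \<Longrightarrow> \<rho> j x = 0" and \<rho>s: "\<And>j x. \<rho> j (- x) = \<rho> j x"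
    by metis
  have mm: "mollify \<sigma> (\<rho> j) \<in> borel_measurable lebesgue" for j
  proof -
    obtain L where L: "\<And>z z'. \<bar>mollify \<sigma> (\<rho> j) z - mollify \<sigma> (\<rho> j) z'\<bar> \<le> L * norm (z - z')"
      using mollify_lipschitz[OF \<sigma>_int \<rho>(1)] by metis
    show ?thesis by (rule borel_imp_lebesgue[OF lipschitz_measurable[OF L]])
  qed
  have "(\<lambda>j. LINT x|lebesgue. \<bar>\<sigma> x - mollify \<sigma> (\<rho> j) x\<bar>) \<longlonglongrightarrow> (LINT x|(lebesgue :: (real ^ 'n) measure). (0 :: real))"
  proof (rule integral_dominated_convergence)
    show "(\<lambda>x. \<bar>\<sigma> x - mollify \<sigma> (\<rho> j) x\<bar>) \<in> borel_measurable lebesgue" for j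
      by (intro borel_measurable_abs borel_measurable_diff \<sigma>_meas mm)
    show "integrable lebesgue (\<lambda>x :: real ^ 'n. (2 * S) * indicator (cball 0 (R + 1)) x)"
      using emeasure_compact_finite[of "cball 0 (R + 1) :: (real ^ 'n) set"]
      by (intro integrable_mult_right integrable_real_indicator) auto
    have "\<bar>\<sigma> x - mollify \<sigma> (\<rho> j) x\<bar> \<le> (2 * S) * indicator (cball 0 (R + 1)) x" for j x
    proof (cases "norm x \<le> R + 1")
      case True
      have "\<bar>mollify \<sigma> (\<rho> j) x\<bar> \<le> S"
        using mollify_dist[where \<rho> = "\<rho> j" and r = "h j" and z = x and c = 0 and e = S, OF \<sigma>_int \<rho> \<rho>0] \<sigma>_bound by simp
      then show ?thesis using True \<sigma>_bound[of x] by simp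
    next
      case False
      then have "R + h j \<le> norm x" using h[of j] by linarith
      then have "mollify \<sigma> (\<rho> j) x = 0"
        by (intro mollify_zero[where \<rho> = "\<rho> j" and r = "h j" and s = R]) (simp_all add: \<sigma>_int \<rho> \<rho>0 \<sigma>_supp)
      then show ?thesis using False \<sigma>_supp[of x] by simp
    qed
    then show "AE x in lebesgue. norm \<bar>\<sigma> x - mollify \<sigma> (\<rho> j) x\<bar> \<le> (2 * S) * indicator (cball 0 (R + 1)) x" for j
      by simp
    show "AE x in lebesgue. (\<lambda>j. \<bar>\<sigma> x - mollify \<sigma> (\<rho> j) x\<bar>) \<longlonglongrightarrow> 0"
      using \<sigma>_cont
    proof eventually_elim
      case (elim x)
      show ?case
      proof (rule LIMSEQ_I)
        fix e :: real assume e: "e > 0"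
        obtain d where d: "d > 0" "\<And>y. norm (y - x) < d \<Longrightarrow> \<bar>\<sigma> y - \<sigma> x\<bar> < e / 2"
          using elim e unfolding continuous_at_eps_delta by (metis half_gt_zero dist_norm real_norm_def)
        have "eventually (\<lambda>j. h j < d) sequentially" by (rule order_tendstoD(2)[OF h0 d(1)])
        then obtain N where N: "\<And>j. j \<ge> N \<Longrightarrow> h j < d" by (auto simp: eventually_sequentially)
        have "\<bar>mollify \<sigma> (\<rho> j) x - \<sigma> x\<bar> \<le> e / 2" if "j \<ge> N" for j
          
        proof (rule mollify_dist[where \<rho> = "\<rho> j" and r = "h j", OF \<sigma>_int \<rho> \<rho>0])
          fix y assume "norm (y - x) < h j"
          then have "norm (y - x) < d" using N[OF that] by linarith
          then show "\<bar>\<sigma> y - \<sigma> x\<bar> \<le> e / 2" using d(2)[of y] by simp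
        qed
        moreover have "norm (\<bar>a - b\<bar> - 0) < e" if "\<bar>b - a\<bar> \<le> e / 2" for a b using that e unfolding real_norm_def by linarith
        ultimately have "norm (\<bar>\<sigma> x - mollify \<sigma> (\<rho> j) x\<bar> - 0) < e" if "j \<ge> N" for j using that by blast
        then show "\<exists>N. \<forall>j\<ge>N. norm (\<bar>\<sigma> x - mollify \<sigma> (\<rho> j) x\<bar> - 0) < e" by blast
      qed
    qed
  qed simp
  then have lim: "(\<lambda>j. LINT x|lebesgue. \<bar>\<sigma> x - mollify \<sigma> (\<rho> j) x\<bar>) \<longlonglongrightarrow> 0" by simp
  have "eventually (\<lambda>j. h j < \<delta> \<and> (LINT x|lebesgue. \<bar>\<sigma> x - mollify \<sigma> (\<rho> j) x\<bar>) < \<delta>) sequentially"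
    by (intro eventually_conj order_tendstoD(2)[OF h0 assms] order_tendstoD(2)[OF lim assms])
  then obtain j where "h j < \<delta>" "(LINT x|lebesgue. \<bar>\<sigma> x - mollify \<sigma> (\<rho> j) x\<bar>) < \<delta>"
    by (auto simp: eventually_sequentially)
  then show ?thesis using that[of "\<rho> j" "h j"] \<rho> \<rho>0 \<rho>s h(1) by blast
qed

end

text \<open>A Riemann sum of a function with integral one. The Lipschitz condition gives an error
  proportional to the mesh, with a constant uniform in the shift \<open>y\<close> and in the finite
  index set, which only has to contain all nonzero terms.\<close>

lemma lattice_mollifier_sum:
  fixes \<rho> :: "real ^ 'n \<Rightarrow> real"
  assumes \<rho>: "test_fun \<rho>" "integral\<^sup>L lebesgue \<rho> = 1" "\<And>x. \<rho> (- x) = \<rho> x" and r: "\<And>x. norm x \<ge> r \<Longrightarrow> \<rho> x = 0"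
  obtains E where "E \<ge> 0" "\<And>\<xi> y A. \<xi> > 0 \<Longrightarrow> \<xi> \<le> X \<Longrightarrow> finite A \<Longrightarrow> (\<And>k. \<rho> (y - lpt \<xi> k) \<noteq> 0 \<Longrightarrow> k \<in> A) \<Longrightarrow>
    \<bar>\<xi> ^ CARD('n) * (\<Sum>k\<in>A. \<rho> (y - lpt \<xi> k)) - 1\<bar> \<le> E * \<xi>"
proof -
  obtain L where L: "L > 0" "\<And>x y. \<bar>\<rho> x - \<rho> y\<bar> \<le> L * norm (x - y)" using test_lipschitz[OF \<rho>(1)] by metis
  have \<rho>m[measurable]: "\<rho> \<in> borel_measurable borel" by (rule test_measurable[OF \<rho>(1)])
  define M where "M = measure lborel (cball (0 :: real ^ 'n) (r + real CARD('n) * X))"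
  let ?E = "L * real CARD('n) * M"
  have "\<bar>\<xi> ^ CARD('n) * (\<Sum>k\<in>A. \<rho> (y - lpt \<xi> k)) - 1\<bar> \<le> ?E * \<xi>"
    if \<xi>: "\<xi> > 0" "\<xi> \<le> X" and A: "finite A" "\<And>k. \<rho> (y - lpt \<xi> k) \<noteq> 0 \<Longrightarrow> k \<in> A" for \<xi> y A
  proof -
    let ?S = "cball y (r + real CARD('n) * X)"
    have A0: "k \<notin> A \<Longrightarrow> \<rho> (y - lpt \<xi> k) = 0" for k using A(2) by blast
    note s = step_integral[of \<xi> A "\<lambda>k. \<rho> (y - lpt \<xi> k)", OF \<xi>(1) A(1) A0]
    have e: "\<rho> (y - x) = \<rho> (x + - y)" for x using \<rho>(3)[of "x - y"] by simp
    have \<rho>i: "integrable lborel \<rho>"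
      using test_integrable[OF \<rho>(1)] by (subst (asm) integrable_completion) auto
    have i: "integrable lborel (\<lambda>x. \<rho> (y - x))"
      unfolding e by (rule lborel_integral_translate(2)[OF \<rho>m \<rho>i])
    have "(LINT x|lborel. \<rho> (y - x)) = (LINT x|lborel. \<rho> x)"
      unfolding e by (rule lborel_integral_translate(1)[OF \<rho>m])
    also have "\<dots> = 1" using \<rho>(2) by (subst (asm) integral_completion) auto
    finally have one: "(LINT x|lborel. \<rho> (y - x)) = 1" .
    have "\<xi> ^ CARD('n) * (\<Sum>k\<in>A. \<rho> (y - lpt \<xi> k)) - 1 =
        (LINT x|lborel. \<rho> (y - lpt \<xi> (cellidx \<xi> x)) - \<rho> (y - x))"
      using s(2) i by (simp add: s(3) one)
    also have "\<bar>\<dots>\<bar> \<le> (LINT x|lborel. (L * real CARD('n) * \<xi>) * indicator ?S x)"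
    proof (rule order_trans[OF integral_abs_bound], rule integral_mono)
      show "integrable lborel (\<lambda>x. \<bar>\<rho> (y - lpt \<xi> (cellidx \<xi> x)) - \<rho> (y - x)\<bar>)" using s(2) i by simp
      show "integrable lborel (\<lambda>x. (L * real CARD('n) * \<xi>) * indicator ?S x)"
        using emeasure_compact_finite[of ?S] by (intro integrable_mult_right integrable_real_indicator) auto
      fix x :: "real ^ 'n"
      let ?l = "lpt \<xi> (cellidx \<xi> x)"
      have dl: "norm (x - ?l) \<le> real CARD('n) * \<xi>" by (rule cellidx_dist[OF \<xi>(1)])
      have cX: "real CARD('n) * \<xi> \<le> real CARD('n) * X" using \<xi> by (intro mult_left_mono) auto
      show "\<bar>\<rho> (y - ?l) - \<rho> (y - x)\<bar> \<le> (L * real CARD('n) * \<xi>) * indicator ?S x"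
      proof (cases "x \<in> ?S")
        case True
        have "\<bar>\<rho> (y - ?l) - \<rho> (y - x)\<bar> \<le> L * norm (x - ?l)" using L(2)[of "y - ?l" "y - x"] by simp
        also have "\<dots> \<le> L * (real CARD('n) * \<xi>)" using dl L(1) by (intro mult_left_mono) auto
        finally show ?thesis using True by (simp add: mult.assoc)
      next
        case False
        then have n: "norm (y - x) > r + real CARD('n) * X" by (simp add: dist_norm)
        have "norm (y - x) \<le> norm (y - ?l) + norm (x - ?l)"
          using norm_triangle_ineq4[of "y - ?l" "x - ?l"] by simp
        then have "norm (y - ?l) \<ge> r" using n dl cX by linarith
        moreover have "real CARD('n) * X \<ge> 0" using \<xi> by simp
        then have "norm (y - x) \<ge> r" using n by linarith
        ultimately show ?thesis using r[of "y - ?l"] r[of "y - x"] False by simp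
      qed
    qed
    also have "\<dots> = ?E * \<xi>"
    proof (cases "r + real CARD('n) * X \<ge> 0")
      case True
      then show ?thesis by (simp add: M_def content_cball)
    next
      case False
      then show ?thesis by (simp add: M_def)
    qed
    finally show ?thesis .
  qed
  moreover have "?E \<ge> 0" using L(1) by (simp add: M_def)
  ultimately show ?thesis using that by blast
qed


section \<open>Functionals on test functions\<close>

text \<open>The preimage of an open set differs from its interior only by points of discontinuity, a
  subset of a null set, and Lebesgue measure is complete. This supplies the measurability of
  \<open>\<sigma>\<close> in the theorem.\<close>

lemma AE_isCont_measurable:
  fixes f :: "real ^ 'n \<Rightarrow> real"
  assumes "AE x in lebesgue. isCont f x"
  shows "f \<in> borel_measurable lebesgue"
proof (rule borel_measurableI)
  fix U :: "real set" assume U: "open U"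
  obtain N where N: "{x \<in> space lebesgue. \<not> isCont f x} \<subseteq> N" "N \<in> null_sets lebesgue"
    using AE_E[OF assms] by (metis (no_types, lifting) null_setsI)
  let ?A = "interior (f -` U)"
  have "f -` U - ?A \<subseteq> N"
  proof
    fix x assume x: "x \<in> f -` U - ?A"
    have "\<not> isCont f x"
    proof
      assume c: "isCont f x"
      then obtain T where "open T" "x \<in> T" "\<forall>y\<in>T. f y \<in> U"
        using U x unfolding continuous_at_open by blast
      then have "x \<in> ?A" by (auto intro: interiorI)
      then show False using x by simp
    qed
    then show "x \<in> N" using N(1) by auto
  qed
  then have "f -` U - ?A \<in> null_sets lebesgue" using N(2) by (rule null_sets_completion_subset)
  then have "f -` U - ?A \<in> sets lebesgue" by (rule null_setsD2)
  moreover have "?A \<in> sets lebesgue" by (intro sets_completionI_sets) simp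
  moreover have "f -` U \<inter> space lebesgue = (f -` U - ?A) \<union> ?A" using interior_subset by auto
  ultimately show "f -` U \<inter> space lebesgue \<in> sets lebesgue" by (metis sets.Un)
qed

text \<open>By Tychonoff's theorem the product of the intervals \<open>{- B \<phi>..B \<phi>}\<close> is compact.\<close>

lemma pointwise_cluster:
  fixes a :: "nat \<Rightarrow> 'b \<Rightarrow> real"
  assumes B: "\<And>n \<phi>. \<bar>a n \<phi>\<bar> \<le> B \<phi>" and F: "F \<noteq> bot"
  obtains G D where "G \<noteq> bot" "G \<le> F" "\<And>\<phi>. ((\<lambda>n. a n \<phi>) \<longlongrightarrow> D \<phi>) G"
proof -
  define S where "S = (\<Pi>\<^sub>E \<phi>\<in>UNIV. {- B \<phi>..B \<phi>})"
  have "compactin (product_topology (\<lambda>i. euclidean) UNIV) S"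
    unfolding S_def compactin_PiE by (simp add: compactin_euclidean_iff)
  then have "compact S" by (simp add: euclidean_product_topology compactin_euclidean_iff)
  moreover have "filtermap a F \<noteq> bot" using F by (simp add: filtermap_bot_iff)
  moreover have "eventually (\<lambda>f. f \<in> S) (filtermap a F)"
    using B by (auto simp: eventually_filtermap S_def abs_le_iff minus_le_iff intro!: always_eventually)
  ultimately obtain D where D: "inf (nhds D) (filtermap a F) \<noteq> bot"
    unfolding compact_filter by blast
  \<comment> \<open>The cluster point lives among functions of \<open>\<phi>\<close>; pulling its
    neighbourhood filter back along \<open>a\<close> gives a filter of indices that refines
    \<open>F\<close>.\<close>
  define G where "G = inf (filtercomap a (nhds D)) F"
  have "G \<noteq> bot"
  proof
    assume "G = bot"
    then have "eventually (\<lambda>_. False) G" by simp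
    then obtain P Q where P: "eventually P (filtercomap a (nhds D))" and Q: "eventually Q F"
      and PQ: "\<And>n. P n \<Longrightarrow> Q n \<Longrightarrow> False"
      unfolding G_def eventually_inf by auto
    obtain P' where P': "eventually P' (nhds D)" "\<And>n. P' (a n) \<Longrightarrow> P n"
      using P unfolding eventually_filtercomap by blast
    have "eventually (\<lambda>f. \<not> P' f) (filtermap a F)"
      unfolding eventually_filtermap using Q by eventually_elim (use P' PQ in blast)
    then have "eventually (\<lambda>_. False) (inf (nhds D) (filtermap a F))"
      unfolding eventually_inf using P'(1) by blast
    then show False using D by (simp add: trivial_limit_def)
  qed
  moreover have "G \<le> F" by (simp add: G_def)
  moreover have "((\<lambda>n. a n \<phi>) \<longlongrightarrow> D \<phi>) G" for \<phi>
  proof -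
    have "filterlim a (nhds D) G"
      unfolding G_def by (rule filterlim_mono[OF filterlim_filtercomap order_refl inf_le1])
    from continuous_on_tendsto_compose[OF continuous_on_product_coordinates[of \<phi>] this] show ?thesis
      by simp
  qed
  ultimately show ?thesis using that by blast
qed

text \<open>Linearity on test functions only; positivity, assumed separately, takes the place of
  continuity in the estimates.\<close>

definition test_functional :: "((real ^ 'n \<Rightarrow> real) \<Rightarrow> real) \<Rightarrow> bool" where
  "test_functional D \<longleftrightarrow> (\<forall>\<phi> \<psi> a b. test_fun \<phi> \<longrightarrow> test_fun \<psi> \<longrightarrow>
     D (\<lambda>x. a * \<phi> x + b * \<psi> x) = a * D \<phi> + b * D \<psi>)"

lemma test_functionalD:
  assumes "test_functional D" "test_fun \<phi>" "test_fun \<psi>"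
  shows "D (\<lambda>x. a * \<phi> x + b * \<psi> x) = a * D \<phi> + b * D \<psi>" "D (\<lambda>x. a * \<phi> x) = a * D \<phi>"
    "D (\<lambda>x. \<phi> x + \<psi> x) = D \<phi> + D \<psi>" "D (\<lambda>x. \<phi> x - \<psi> x) = D \<phi> - D \<psi>"
proof -
  have lin: "D (\<lambda>x. a * \<phi> x + b * \<psi> x) = a * D \<phi> + b * D \<psi>" for a b
    using assms by (simp add: test_functional_def)
  show "D (\<lambda>x. a * \<phi> x + b * \<psi> x) = a * D \<phi> + b * D \<psi>" by (rule lin)
  show "D (\<lambda>x. a * \<phi> x) = a * D \<phi>" using lin[of a 0] by simp
  show "D (\<lambda>x. \<phi> x + \<psi> x) = D \<phi> + D \<psi>" using lin[of 1 1] by simp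
  show "D (\<lambda>x. \<phi> x - \<psi> x) = D \<phi> - D \<psi>" using lin[of 1 "-1"] by simp
qed

lemma test_functional_sum:
  fixes \<psi> :: "'k \<Rightarrow> real ^ 'n \<Rightarrow> real"
  assumes D: "test_functional D" and "finite K" "\<And>k. k \<in> K \<Longrightarrow> test_fun (\<psi> k)"
  shows "D (\<lambda>x. \<Sum>k\<in>K. \<psi> k x) = (\<Sum>k\<in>K. D (\<psi> k))"
  using assms(2,3)
proof (induction K rule: finite_induct)
  case empty
  show ?case using test_functionalD(2)[OF D test_zero test_zero, of 0] by simp
next
  case (insert k K)
  have "D (\<lambda>x. \<psi> k x + (\<Sum>k\<in>K. \<psi> k x)) = D (\<psi> k) + D (\<lambda>x. \<Sum>k\<in>K. \<psi> k x)"
    by (rule test_functionalD(3)[OF D]) (use insert in \<open>auto intro: test_sum\<close>)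
  then show ?case using insert by simp
qed

lemma test_functional_mono:
  assumes D: "test_functional D" and pos: "\<And>\<phi>. test_fun \<phi> \<Longrightarrow> (\<And>x. \<phi> x \<ge> 0) \<Longrightarrow> 0 \<le> D \<phi>"
    and t: "test_fun \<phi>" "test_fun \<psi>" and le: "\<And>x. \<phi> x \<le> \<psi> x"
  shows "D \<phi> \<le> D \<psi>"
proof -
  have "0 \<le> D (\<lambda>x. \<psi> x - \<phi> x)" by (rule pos[OF test_diff[OF t(2,1)]]) (use le in simp)
  then show ?thesis using test_functionalD(4)[OF D t(2,1)] by simp
qed

section \<open>Lattice Laplacians of mollified functionals\<close>

lemma test_dlap: "test_fun \<phi> \<Longrightarrow> test_fun (dlap h \<phi>)"
proof -
  assume \<phi>: "test_fun \<phi>"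
  have "test_fun (\<lambda>x. (\<phi> (x - (- h *\<^sub>R axis i 1)) + \<phi> (x - h *\<^sub>R axis i 1)) + (- 2) * \<phi> x)" for i
    by (intro test_add test_cmult test_translate \<phi>)
  then have "test_fun (\<lambda>x. \<phi> (x + h *\<^sub>R axis i 1) + \<phi> (x - h *\<^sub>R axis i 1) - 2 * \<phi> x)" for i by simp
  then show ?thesis unfolding dlap_def[abs_def] by (intro test_cmult test_sum) auto
qed

text \<open>The stencil is a finite linear combination of translates, so linearity alone moves it
  from the lattice variable onto the mollifier.\<close>

lemma disc_lap_functional:
  fixes D :: "(real ^ 'n \<Rightarrow> real) \<Rightarrow> real"
  assumes D: "test_functional D" and \<rho>: "test_fun \<rho>"
  shows "disc_lap \<xi> (\<lambda>k. D (\<lambda>x. \<rho> (x - lpt \<xi> k))) k = D (\<lambda>x. dlap \<xi> \<rho> (x - lpt \<xi> k))"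
proof -
  let ?w = "\<lambda>k. D (\<lambda>x. \<rho> (x - lpt \<xi> k))" and ?c = "1 / (2 * real CARD('n) * \<xi>\<^sup>2)"
  let ?p = "\<lambda>i x. \<rho> (x - lpt \<xi> (k + axis i 1)) + \<rho> (x - lpt \<xi> (k - axis i 1))"
  have t: "test_fun (\<lambda>x. \<rho> (x - z))" for z by (rule test_translate[OF \<rho>])
  have tp: "test_fun (?p i)" for i by (intro test_add t)
  have tq: "test_fun (\<lambda>x. 1 * ?p i x + (- 2) * \<rho> (x - lpt \<xi> k))" for i by (intro test_lin tp t)
  have "?w (k + axis i 1) + ?w (k - axis i 1) - 2 * ?w k = D (\<lambda>x. 1 * ?p i x + (- 2) * \<rho> (x - lpt \<xi> k))" for i
    by (simp only: test_functionalD(1)[OF D tp t] test_functionalD(3)[OF D t t]) simp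
  then have "disc_lap \<xi> ?w k = ?c * (\<Sum>i\<in>UNIV. D (\<lambda>x. 1 * ?p i x + (- 2) * \<rho> (x - lpt \<xi> k)))"
    by (simp only: disc_lap_axis)
  also have "\<dots> = ?c * D (\<lambda>x. \<Sum>i\<in>UNIV. 1 * ?p i x + (- 2) * \<rho> (x - lpt \<xi> k))"
    by (intro arg_cong[where f = "(*) ?c"] test_functional_sum[OF D, symmetric] tq) simp
  also have "\<dots> = D (\<lambda>x. ?c * (\<Sum>i\<in>UNIV. 1 * ?p i x + (- 2) * \<rho> (x - lpt \<xi> k)))"
    by (rule test_functionalD(2)[OF D _ test_zero, symmetric]) (intro test_sum tq, simp)
  also have "(\<lambda>x. ?c * (\<Sum>i\<in>UNIV. 1 * ?p i x + (- 2) * \<rho> (x - lpt \<xi> k))) = (\<lambda>x. dlap \<xi> \<rho> (x - lpt \<xi> k))"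
  proof (rule ext, unfold dlap_def, intro arg_cong2[where f = "(*)"] refl sum.cong)
    fix x i
    have 1: "x - lpt \<xi> (k + axis i 1) = x - lpt \<xi> k - \<xi> *\<^sub>R axis i 1"
      by (simp add: lpt_add lpt_axis)
    have 2: "x - lpt \<xi> (k - axis i 1) = x - lpt \<xi> k + \<xi> *\<^sub>R axis i 1"
      by (simp add: lpt_diff lpt_axis)
    show "1 * ?p i x + (- 2) * \<rho> (x - lpt \<xi> k) = \<rho> (x - lpt \<xi> k + \<xi> *\<^sub>R axis i 1) + \<rho> (x - lpt \<xi> k - \<xi> *\<^sub>R axis i 1) - 2 * \<rho> (x - lpt \<xi> k)"
      unfolding 1 2 by simp
  qed
  finally show ?thesis .
qed

lemma dlap_zero_norm:
  assumes "\<And>x. norm x \<ge> r \<Longrightarrow> \<phi> x = 0" "h > 0" "norm x \<ge> r + h"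
  shows "dlap h \<phi> x = 0"
proof -
  have n: "norm (h *\<^sub>R axis i (1 :: real) :: real ^ 'a) = h" for i :: 'a using assms(2) by (simp add: norm_axis_1)
  have "\<phi> (x + h *\<^sub>R axis i 1) = 0" for i
    using norm_diff_ineq[of x "h *\<^sub>R axis i 1"] assms n[of i] by (intro assms(1)) linarith
  moreover have "\<phi> (x - h *\<^sub>R axis i 1) = 0" for i
    using norm_triangle_ineq2[of x "h *\<^sub>R axis i 1"] assms n[of i] by (intro assms(1)) linarith
  moreover have "\<phi> x = 0" using assms by (intro assms(1)) linarith
  ultimately show ?thesis by (simp add: dlap_def)
qed

text \<open>The minimum with a supersolution in a smaller ball is again a supersolution if the latter
  dominates the odometer in the adjacent shell.\<close>

lemma odometer_le_inner_supersol:
  fixes \<tau> u s :: "int ^ 'n \<Rightarrow> real" and k :: "int ^ 'n"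
  assumes \<xi>: "\<xi> > 0" and u: "odometer \<xi> R \<tau> u"
    and s0: "\<And>k. norm (lpt \<xi> k) < R' \<Longrightarrow> 0 \<le> s k"
    and s1: "\<And>k. norm (lpt \<xi> k) < R' \<Longrightarrow> \<tau> k + disc_lap \<xi> s k \<le> 0"
    and s2: "\<And>k. R' \<le> norm (lpt \<xi> k) \<Longrightarrow> norm (lpt \<xi> k) < R' + \<xi> \<Longrightarrow> u k \<le> s k"
    and k: "norm (lpt \<xi> k) < R'"
  shows "u k \<le> s k"
proof -
  define h where "h k = (if norm (lpt \<xi> k) < R' then min (u k) (s k) else u k)" for k
  have u0: "\<And>k. 0 \<le> u k" and u1: "\<And>k. k \<in> lat_ball \<xi> R \<Longrightarrow> \<tau> k + disc_lap \<xi> u k \<le> 0"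
    using u by (auto simp: odometer_def supersol_def)
  have hu: "h j \<le> u j" for j by (simp add: h_def)
  have "supersol \<xi> R \<tau> h"
    unfolding supersol_def
  proof (intro conjI allI ballI)
    fix j :: "int ^ 'n" show "0 \<le> h j" using u0 s0 by (simp add: h_def)
  next
    fix j :: "int ^ 'n" assume j: "j \<in> lat_ball \<xi> R"
    show "\<tau> j + disc_lap \<xi> h j \<le> 0"
    proof (cases "norm (lpt \<xi> j) < R' \<and> s j < u j")
      case True
      have "disc_lap \<xi> h j \<le> disc_lap \<xi> s j"
      proof (rule disc_lap_mono_at)
        show "h j = s j" using True by (simp add: h_def)
        fix i assume "i \<in> nbrs j"
        then have "norm (lpt \<xi> i) < R' + \<xi>" using norm_nbr_less[OF \<xi>, of i j] True by linarith
        then show "h i \<le> s i" using s2[of i] by (auto simp: h_def)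
      qed
      then show ?thesis using s1[of j] True by linarith
    next
      case False
      have "disc_lap \<xi> h j \<le> disc_lap \<xi> u j"
        by (rule disc_lap_mono_at) (use False hu in \<open>auto simp: h_def\<close>)
      then show ?thesis using u1[OF j] by linarith
    qed
  qed
  then have "u k \<le> h k" using u by (auto simp: odometer_def)
  then show ?thesis using k by (simp add: h_def)
qed


section \<open>Comparison of odometers with competitors\<close>

locale gds = density +
  fixes u :: "nat \<Rightarrow> int ^ 'n \<Rightarrow> real"
  assumes dim: "CARD('n) \<ge> 2"
    and u_odo: "\<And>n. odometer (\<xi> n) R (cell_avg \<sigma> (\<xi> n)) (u n)"
begin

definition vol :: real where
  "vol = measure lborel (cball (0 :: real ^ 'n) (R + real CARD('n) * \<xi> 0))"

definition pairing :: "nat \<Rightarrow> (real ^ 'n \<Rightarrow> real) \<Rightarrow> real" where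
  "pairing n \<phi> = \<xi> n ^ CARD('n) * (\<Sum>k\<in>lat_ball (\<xi> n) R. u n k * \<phi> (lpt (\<xi> n) k))"

section \<open>Bounds for the odometers, uniform in the mesh\<close>

lemma vol_nonneg: "vol \<ge> 0"
  by (simp add: vol_def)

lemma \<xi>pow_pos: "\<xi> n ^ CARD('n) > 0"
  using \<xi>_pos by simp

lemma lat_sum_le:
  assumes "c \<ge> 0" "\<And>k. k \<in> lat_ball (\<xi> n) R \<Longrightarrow> f k \<le> c"
  shows "\<xi> n ^ CARD('n) * (\<Sum>k\<in>(lat_ball (\<xi> n) R :: (int ^ 'n) set). f k) \<le> c * vol"
proof -
  have "\<xi> n ^ CARD('n) * (\<Sum>k\<in>(lat_ball (\<xi> n) R :: (int ^ 'n) set). f k)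
      \<le> \<xi> n ^ CARD('n) * (real (card (lat_ball (\<xi> n) R :: (int ^ 'n) set)) * c)"
    using assms \<xi>pow_pos[of n] by (intro mult_left_mono sum_bounded_above) auto
  also have "\<dots> = c * (\<xi> n ^ CARD('n) * real (card (lat_ball (\<xi> n) R :: (int ^ 'n) set)))"
    by (simp only: mult_ac)
  also have "\<dots> \<le> c * vol"
    unfolding vol_def using assms(1) by (intro mult_left_mono lat_ball_card_le \<xi>_pos \<xi>_le)
  finally show ?thesis .
qed

lemma u_nonneg: "0 \<le> u n k"
  using u_odo[of n] by (simp add: odometer_def supersol_def)

lemma u_zero: "k \<notin> lat_ball (\<xi> n) R \<Longrightarrow> u n k = 0"
  using u_odo[of n] by (simp add: odometer_def)

lemma u_supersol: "k \<in> lat_ball (\<xi> n) R \<Longrightarrow> cell_avg \<sigma> (\<xi> n) k + disc_lap (\<xi> n) (u n) k \<le> 0"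
  using u_odo[of n] by (simp add: odometer_def supersol_def)

lemma u_le_barrier: "u n k \<le> max 0 (S * ((R + \<xi> n)\<^sup>2 - (norm (lpt (\<xi> n) k))\<^sup>2))"
proof -
  have "cell_avg \<sigma> (\<xi> n) k \<le> S" for k using avg_bound[of n k] by linarith
  then have "supersol (\<xi> n) R (cell_avg \<sigma> (\<xi> n)) (\<lambda>k. max 0 (S * ((R + \<xi> n)\<^sup>2 - (norm (lpt (\<xi> n) k))\<^sup>2)))"
    by (intro supersol_barrier \<xi>_pos R_pos S_nonneg)
  then show ?thesis using u_odo[of n] unfolding odometer_def by blast
qed

text \<open>By a difference of squares the barrier is at most linear in \<open>\<xi> n + r\<close>
  near the boundary. This controls the odometer where the mollified competitor is not known to be a
  supersolution.\<close>

lemma u_le_shell: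
  assumes "norm (lpt (\<xi> n) k) \<ge> R - r" "0 \<le> r" "r \<le> R"
  shows "u n k \<le> S * ((\<xi> n + r) * (2 * R + \<xi> 0))"
proof -
  have "(R - r)\<^sup>2 \<le> (norm (lpt (\<xi> n) k))\<^sup>2" using assms by (intro power_mono) auto
  then have "(R + \<xi> n)\<^sup>2 - (norm (lpt (\<xi> n) k))\<^sup>2 \<le> (R + \<xi> n)\<^sup>2 - (R - r)\<^sup>2" by simp
  also have "\<dots> = (\<xi> n + r) * (2 * R + \<xi> n - r)" by (simp add: power2_eq_square algebra_simps)
  also have "\<dots> \<le> (\<xi> n + r) * (2 * R + \<xi> 0)"
    using \<xi>_pos[of n] \<xi>_le[of n] assms by (intro mult_left_mono) auto
  finally have "S * ((R + \<xi> n)\<^sup>2 - (norm (lpt (\<xi> n) k))\<^sup>2) \<le> S * ((\<xi> n + r) * (2 * R + \<xi> 0))"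
    using S_nonneg by (rule mult_left_mono)
  moreover have "0 \<le> S * ((\<xi> n + r) * (2 * R + \<xi> 0))"
    using S_nonneg \<xi>_pos[of n] \<xi>_pos[of 0] R_pos assms by simp
  ultimately show ?thesis using u_le_barrier[of n k] by linarith
qed

lemma u_bound: "u n k \<le> S * (R + \<xi> 0)\<^sup>2"
proof -
  have "(R + \<xi> n)\<^sup>2 \<le> (R + \<xi> 0)\<^sup>2" using R_pos \<xi>_pos[of n] \<xi>_le[of n] by (intro power_mono) auto
  then have "(R + \<xi> n)\<^sup>2 - (norm (lpt (\<xi> n) k))\<^sup>2 \<le> (R + \<xi> 0)\<^sup>2"
    using zero_le_power2[of "norm (lpt (\<xi> n) k)"] by linarith
  then have "S * ((R + \<xi> n)\<^sup>2 - (norm (lpt (\<xi> n) k))\<^sup>2) \<le> S * (R + \<xi> 0)\<^sup>2"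
    using S_nonneg by (rule mult_left_mono)
  moreover have "0 \<le> S * (R + \<xi> 0)\<^sup>2" using S_nonneg by simp
  ultimately show ?thesis using u_le_barrier[of n k] by linarith
qed

lemma pairing_bound:
  assumes "\<And>x. \<bar>\<phi> x\<bar> \<le> B"
  shows "\<bar>pairing n \<phi>\<bar> \<le> S * (R + \<xi> 0)\<^sup>2 * B * vol"
proof -
  have B: "B \<ge> 0" using assms[of 0] by linarith
  have "\<bar>pairing n \<phi>\<bar> \<le> \<xi> n ^ CARD('n) * (\<Sum>k\<in>lat_ball (\<xi> n) R. \<bar>u n k * \<phi> (lpt (\<xi> n) k)\<bar>)"
    unfolding pairing_def abs_mult[of "\<xi> n ^ CARD('n)"] abs_of_pos[OF \<xi>pow_pos]
    using \<xi>pow_pos[of n] by (intro mult_left_mono sum_abs) auto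
  also have "\<dots> \<le> (S * (R + \<xi> 0)\<^sup>2 * B) * vol"
  proof (rule lat_sum_le)
    show "0 \<le> S * (R + \<xi> 0)\<^sup>2 * B" using S_nonneg B by simp
    show "\<bar>u n k * \<phi> (lpt (\<xi> n) k)\<bar> \<le> S * (R + \<xi> 0)\<^sup>2 * B" for k
      unfolding abs_mult using u_nonneg[of n k] u_bound[of n k] assms S_nonneg by (intro mult_mono) auto
  qed
  finally show ?thesis .
qed

lemma pairing_lin: "pairing n (\<lambda>x. a * \<phi> x + b * \<psi> x) = a * pairing n \<phi> + b * pairing n \<psi>"
  by (simp add: pairing_def sum_distrib_left sum.distrib ring_distribs mult_ac)

lemma pairing_nonneg: "(\<And>x. \<phi> x \<ge> 0) \<Longrightarrow> 0 \<le> pairing n \<phi>"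
  unfolding pairing_def using \<xi>pow_pos[of n] u_nonneg by (intro mult_nonneg_nonneg sum_nonneg) auto

text \<open>The conditions on \<open>W\<close> rewritten for \<open>D = U - W\<close>: positivity is
  \<open>W \<le> U\<close>, and since \<open>\<Delta> U = - 2 d \<sigma>\<close>, the last clause is
  \<open>\<Delta> W \<ge> 0\<close> in the ball.\<close>

definition obstacle_functional :: "((real ^ 'n \<Rightarrow> real) \<Rightarrow> real) \<Rightarrow> bool" where
  "obstacle_functional D \<longleftrightarrow> test_functional D \<and> (\<forall>\<phi>. test_fun \<phi> \<and> (\<forall>x. \<phi> x \<ge> 0) \<longrightarrow> 0 \<le> D \<phi>) \<and>
     (\<forall>\<phi>. test_fun \<phi> \<and> (\<forall>x. \<phi> x \<ge> 0) \<and> closure {x. \<phi> x \<noteq> 0} \<subseteq> ball 0 R \<longrightarrow>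
       D (lap \<phi>) \<le> - 2 * real CARD('n) * (LINT x|lebesgue. \<sigma> x * \<phi> x))"

text \<open>With the stencil moved onto \<open>\<rho>\<close>, it is replaced by the Laplacian at a
  cost of at most \<open>L * \<xi> n\<close> on a bounded set; there \<open>\<theta>\<close>
  dominates, and positivity lets \<open>D\<close> be applied to the inequality. The condition on
  \<open>k\<close> keeps the support of the translated mollifier inside the ball, where
  \<open>D\<close> may be tested.\<close>

lemma mollified_functional_supersol:
  assumes D: "obstacle_functional D"
    and \<rho>: "test_fun \<rho>" "\<And>x. \<rho> x \<ge> 0" and r: "r > 0" "r < 1" "\<And>x. norm x \<ge> r \<Longrightarrow> \<rho> x = 0"
    and \<theta>: "test_fun \<theta>" "\<And>x. \<theta> x \<ge> 0" "\<And>x. norm x \<le> R + 2 + \<xi> 0 \<Longrightarrow> \<theta> x \<ge> 1"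
    and L: "L > 0" "\<And>x h. h > 0 \<Longrightarrow> \<bar>dlap h \<rho> x - lap \<rho> x / (2 * real CARD('n))\<bar> \<le> L * h"
    and k: "norm (lpt (\<xi> n) k) < R - r"
  shows "disc_lap (\<xi> n) (\<lambda>k. D (\<lambda>x. \<rho> (x - lpt (\<xi> n) k))) k
    \<le> - mollify \<sigma> \<rho> (lpt (\<xi> n) k) + L * \<xi> n * D \<theta>"
proof -
  define z where "z = lpt (\<xi> n) k"
  define \<rho>z where "\<rho>z x = \<rho> (x - z)" for x
  let ?d = "2 * real CARD('n)"
  have lin: "test_functional D" and pos: "\<And>\<phi>. test_fun \<phi> \<Longrightarrow> (\<And>x. \<phi> x \<ge> 0) \<Longrightarrow> 0 \<le> D \<phi>"
    using D by (auto simp: obstacle_functional_def)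
  have tz: "test_fun \<rho>z" unfolding \<rho>z_def by (rule test_translate[OF \<rho>(1)])
  have "disc_lap (\<xi> n) (\<lambda>k. D (\<lambda>x. \<rho> (x - lpt (\<xi> n) k))) k = D (\<lambda>x. dlap (\<xi> n) \<rho> (x - z))"
    unfolding z_def by (rule disc_lap_functional[OF lin \<rho>(1)])
  also have "\<dots> \<le> D (\<lambda>x. (1 / ?d) * lap \<rho>z x + (L * \<xi> n) * \<theta> x)"
  proof (rule test_functional_mono[OF lin pos])
    show "test_fun (\<lambda>x. dlap (\<xi> n) \<rho> (x - z))" by (rule test_translate[OF test_dlap[OF \<rho>(1)]])
    show "test_fun (\<lambda>x. (1 / ?d) * lap \<rho>z x + (L * \<xi> n) * \<theta> x)" by (rule test_lin[OF test_lap[OF tz] \<theta>(1)])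
    fix x
    have lz: "lap \<rho>z x = lap \<rho> (x - z)" unfolding \<rho>z_def by (rule lap_translate[OF test_smooth[OF \<rho>(1)]])
    show "dlap (\<xi> n) \<rho> (x - z) \<le> (1 / ?d) * lap \<rho>z x + (L * \<xi> n) * \<theta> x"
    proof (cases "norm (x - z) < r + \<xi> n")
      case True
      have "norm x \<le> R + 2 + \<xi> 0"
        using True k r norm_triangle_sub[of x z] \<xi>_le[of n] unfolding z_def by linarith
      then have "L * \<xi> n * 1 \<le> L * \<xi> n * \<theta> x" using \<theta>(3) L(1) \<xi>_pos[of n] by (intro mult_left_mono) auto
      moreover have "dlap (\<xi> n) \<rho> (x - z) \<le> lap \<rho> (x - z) / ?d + L * \<xi> n"
        using L(2)[OF \<xi>_pos[of n], of "x - z"] by linarith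
      ultimately show ?thesis by (simp add: lz)
    next
      case False
      have "dlap (\<xi> n) \<rho> (x - z) = 0"
        by (rule dlap_zero_norm[of r]) (use r \<xi>_pos[of n] False in auto)
      moreover have "lap \<rho> (x - z) = 0"
        by (rule lap_zero_norm[OF \<rho>(1), of r]) (use r \<xi>_pos[of n] False in auto)
      moreover have "0 \<le> L * \<xi> n * \<theta> x" using L(1) \<xi>_pos[of n] \<theta>(2) by simp
      ultimately show ?thesis by (simp add: lz)
    qed
  qed
  also have "\<dots> = (1 / ?d) * D (lap \<rho>z) + (L * \<xi> n) * D \<theta>"
    by (rule test_functionalD(1)[OF lin test_lap[OF tz] \<theta>(1)])
  also have "\<dots> \<le> - mollify \<sigma> \<rho> z + L * \<xi> n * D \<theta>"
  proof -
    have "{x. \<rho>z x \<noteq> 0} \<subseteq> cball z r"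
      using r(3) by (force simp: \<rho>z_def dist_norm norm_minus_commute not_le[symmetric])
    then have "closure {x. \<rho>z x \<noteq> 0} \<subseteq> cball z r" by (rule closure_minimal) simp
    moreover have "cball z r \<subseteq> ball 0 R"
    proof
      fix x assume "x \<in> cball z r"
      then show "x \<in> ball 0 R"
        using k norm_triangle_sub[of x z] unfolding z_def by (simp add: dist_norm norm_minus_commute)
    qed
    ultimately have "closure {x. \<rho>z x \<noteq> 0} \<subseteq> ball 0 R" by blast
    moreover have "\<forall>x. \<rho>z x \<ge> 0" using \<rho>(2) by (simp add: \<rho>z_def)
    ultimately have "D (lap \<rho>z) \<le> - ?d * (LINT x|lebesgue. \<sigma> x * \<rho>z x)"
      using D tz by (simp add: obstacle_functional_def)
    then have "(1 / ?d) * D (lap \<rho>z) \<le> (1 / ?d) * (- ?d * (LINT x|lebesgue. \<sigma> x * \<rho>z x))"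
      by (intro mult_left_mono) auto
    also have "\<dots> = - mollify \<sigma> \<rho> z" by (simp add: mollify_def \<rho>z_def)
    finally show ?thesis by simp
  qed
  finally show ?thesis by (simp only: z_def)
qed

text \<open>A lattice sum of translated mollifiers reproduces \<open>\<phi>\<close> up to two
  errors: the oscillation \<open>L * r\<close> of \<open>\<phi>\<close> over the support of
  \<open>\<rho>\<close>, and the quadrature error \<open>E * \<xi> n\<close> times
  \<open>\<phi> y + L * r \<le> B + L\<close>. The cutoff makes the error term a test function, so
  that \<open>D\<close> can be evaluated on it.\<close>

lemma lattice_mollification_le:
  assumes \<phi>: "\<And>x. \<phi> x \<ge> 0" "\<And>x. \<phi> x \<le> B" "\<And>x y. \<bar>\<phi> x - \<phi> y\<bar> \<le> L * norm (x - y)" "L \<ge> 0"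
    and \<rho>: "\<And>x. \<rho> x \<ge> 0" and r: "r > 0" "r < 1" "\<And>x. norm x \<ge> r \<Longrightarrow> \<rho> x = 0"
    and \<theta>: "\<And>x. \<theta> x \<ge> 0" "\<And>x. norm x \<le> R + 2 + \<xi> 0 \<Longrightarrow> \<theta> x \<ge> 1"
    and E: "E \<ge> 0" "\<And>\<xi>' y A. \<xi>' > 0 \<Longrightarrow> \<xi>' \<le> \<xi> 0 \<Longrightarrow> finite A \<Longrightarrow> (\<And>k. \<rho> (y - lpt \<xi>' k) \<noteq> 0 \<Longrightarrow> k \<in> A) \<Longrightarrow>
      \<bar>\<xi>' ^ CARD('n) * (\<Sum>k\<in>A. \<rho> (y - lpt \<xi>' k)) - 1\<bar> \<le> E * \<xi>'"
  shows "(\<Sum>k\<in>lat_ball (\<xi> n) R. (\<xi> n ^ CARD('n) * \<phi> (lpt (\<xi> n) k)) * \<rho> (y - lpt (\<xi> n) k))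
    \<le> 1 * \<phi> y + (L * r + E * \<xi> n * (B + L)) * \<theta> (y :: real ^ 'n)"
proof -
  let ?p = "\<xi> n ^ CARD('n)" and ?l = "\<lambda>k. lpt (\<xi> n) k :: real ^ 'n" and ?Q = "lat_ball (\<xi> n) R :: (int ^ 'n) set"
  have B: "B \<ge> 0" using \<phi>(1,2)[of 0] by linarith
  have \<eta>: "L * r + E * \<xi> n * (B + L) \<ge> 0" using \<phi>(4) r E(1) \<xi>_pos[of n] B by simp
  show ?thesis
  proof (cases "norm y \<le> R + 2 + \<xi> 0")
    case True
    \<comment> \<open>Adding the ball of radius \<open>norm y + r\<close> includes every lattice
      point at which \<open>\<rho>\<close> contributes, as the quadrature estimate requires; the
      extra terms are nonnegative.\<close>
    define A where "A = ?Q \<union> lat_ball (\<xi> n) (norm y + r)"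
    have finA: "finite A" unfolding A_def using finite_lat_ball[OF \<xi>_pos] by blast
    have memA: "k \<in> A" if "\<rho> (y - ?l k) \<noteq> 0" for k
    proof -
      have "norm (y - ?l k) < r" using r(3)[of "y - ?l k"] that by (simp add: not_le[symmetric]) (use r(3) that not_le in blast)
      then have "norm (?l k) < norm y + r" using norm_triangle_ineq2[of "?l k" y] by (simp add: norm_minus_commute)
      then show ?thesis by (simp add: A_def lat_ball_def)
    qed
    have sA: "?p * (\<Sum>k\<in>A. \<rho> (y - ?l k)) \<le> 1 + E * \<xi> n"
    proof -
      have "\<bar>?p * (\<Sum>k\<in>A. \<rho> (y - ?l k)) - 1\<bar> \<le> E * \<xi> n"
        by (rule E(2)[OF \<xi>_pos \<xi>_le finA]) (rule memA)
      then show ?thesis unfolding abs_le_iff by linarith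
    qed
    have "(\<Sum>k\<in>?Q. (?p * \<phi> (?l k)) * \<rho> (y - ?l k)) \<le> (\<Sum>k\<in>?Q. (?p * (\<phi> y + L * r)) * \<rho> (y - ?l k))"
    proof (rule sum_mono)
      fix k
      show "(?p * \<phi> (?l k)) * \<rho> (y - ?l k) \<le> (?p * (\<phi> y + L * r)) * \<rho> (y - ?l k)"
      proof (cases "norm (y - ?l k) \<ge> r")
        case False
        then have "L * norm (?l k - y) \<le> L * r" using \<phi>(4) by (intro mult_left_mono) (auto simp: norm_minus_commute)
        then have "\<phi> (?l k) \<le> \<phi> y + L * r" using \<phi>(3)[of "?l k" y] by linarith
        then show ?thesis using \<rho> \<xi>pow_pos[of n] by (intro mult_right_mono mult_left_mono) auto
      qed (simp add: r(3))
    qed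
    also have "\<dots> \<le> (\<Sum>k\<in>A. (?p * (\<phi> y + L * r)) * \<rho> (y - ?l k))"
      using \<rho> \<xi>pow_pos[of n] \<phi>(1)[of y] \<phi>(4) r
      by (intro sum_mono2 finA) (auto simp: A_def)
    also have "\<dots> = (\<phi> y + L * r) * (?p * (\<Sum>k\<in>A. \<rho> (y - ?l k)))"
      by (simp only: sum_distrib_left mult_ac)
    also have "\<dots> \<le> (\<phi> y + L * r) * (1 + E * \<xi> n)"
      using sA \<phi>(1)[of y] \<phi>(4) r by (intro mult_left_mono) auto
    also have "\<dots> = \<phi> y + (L * r + E * \<xi> n * (\<phi> y + L * r))" by (simp add: algebra_simps)
    also have "\<dots> \<le> \<phi> y + (L * r + E * \<xi> n * (B + L))"
    proof -
      have "L * r \<le> L * 1" using \<phi>(4) r by (intro mult_left_mono) auto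
      then have "E * \<xi> n * (\<phi> y + L * r) \<le> E * \<xi> n * (B + L)"
        using \<phi>(2)[of y] E(1) \<xi>_pos[of n] by (intro mult_left_mono) auto
      then show ?thesis by simp
    qed
    also have "\<dots> \<le> 1 * \<phi> y + (L * r + E * \<xi> n * (B + L)) * \<theta> y"
      using mult_left_mono[OF \<theta>(2)[OF True] \<eta>] by simp
    finally show ?thesis .
  next
    case False
    have "\<rho> (y - ?l k) = 0" if "k \<in> ?Q" for k
    proof (rule r(3))
      have "norm (?l k) < R" using that by (simp add: lat_ball_def)
      then show "r \<le> norm (y - ?l k)"
        using norm_triangle_ineq2[of y "?l k"] False r \<xi>_pos[of 0] by linarith
    qed
    then have "(\<Sum>k\<in>?Q. (?p * \<phi> (?l k)) * \<rho> (y - ?l k)) = 0" by simp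
    then show ?thesis using \<phi>(1)[of y] \<theta>(1)[of y] \<eta> by simp
  qed
qed

text \<open>The constant \<open>C\<close> depends on the mollifier, through \<open>E\<close> and
  \<open>M\<close>, but not on \<open>n\<close>. The other errors need not vanish with the mesh;
  they are governed by \<open>r\<close> and by the mean distance between averages and mollified
  density, so the mollifier is chosen before \<open>n\<close> grows.\<close>

lemma pairing_le_functional:
  assumes D: "obstacle_functional D"
    and \<phi>: "test_fun \<phi>" "\<And>x. \<phi> x \<ge> 0" "\<And>x. \<phi> x \<le> B" "\<And>x y. \<bar>\<phi> x - \<phi> y\<bar> \<le> L * norm (x - y)" "L \<ge> 0"
    and \<rho>: "test_fun \<rho>" "\<And>x. \<rho> x \<ge> 0" "integral\<^sup>L lebesgue \<rho> = 1" "\<And>x. \<rho> (- x) = \<rho> x"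
    and r: "r > 0" "r < 1" "r < R" "\<And>x. norm x \<ge> r \<Longrightarrow> \<rho> x = 0"
    and \<theta>: "test_fun \<theta>" "\<And>x. \<theta> x \<ge> 0" "\<And>x. norm x \<le> R + 2 + \<xi> 0 \<Longrightarrow> \<theta> x \<ge> 1"
  obtains C where "\<And>n. pairing n \<phi> \<le> D \<phi> + L * r * D \<theta>
    + B * (R + \<xi> 0)\<^sup>2 * (\<xi> n ^ CARD('n) * (\<Sum>k\<in>lat_ball (\<xi> n) R. \<bar>cell_avg \<sigma> (\<xi> n) k - mollify \<sigma> \<rho> (lpt (\<xi> n) k)\<bar>))
    + S * (2 * R + \<xi> 0) * r * B * vol + C * \<xi> n"
proof -
  have lin: "test_functional D" and pos: "\<And>\<phi>. test_fun \<phi> \<Longrightarrow> (\<And>x. \<phi> x \<ge> 0) \<Longrightarrow> 0 \<le> D \<phi>"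
    using D by (auto simp: obstacle_functional_def)
  have \<Theta>: "D \<theta> \<ge> 0" using pos[OF \<theta>(1,2)] .
  have B: "B \<ge> 0" using \<phi>(2,3)[of 0] by linarith
  obtain E where E: "E \<ge> 0" "\<And>\<xi>' y A. \<xi>' > 0 \<Longrightarrow> \<xi>' \<le> \<xi> 0 \<Longrightarrow> finite A \<Longrightarrow> (\<And>k. \<rho> (y - lpt \<xi>' k) \<noteq> 0 \<Longrightarrow> k \<in> A) \<Longrightarrow>
      \<bar>\<xi>' ^ CARD('n) * (\<Sum>k\<in>A. \<rho> (y - lpt \<xi>' k)) - 1\<bar> \<le> E * \<xi>'"
    using lattice_mollifier_sum[where X = "\<xi> 0" and r = r, OF \<rho>(1,3,4) r(4)] by blast
  obtain M where M: "M > 0" "\<And>x h. h > 0 \<Longrightarrow> \<bar>dlap h \<rho> x - lap \<rho> x / (2 * real CARD('n))\<bar> \<le> M * h"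
    using dlap_consistent[OF \<rho>(1)] by blast
  let ?Y = "(R + \<xi> 0)\<^sup>2"
  let ?C = "E * (B + L) * D \<theta> + (M * D \<theta> * ?Y + S * (2 * R + \<xi> 0)) * B * vol"
  show ?thesis
  proof (rule that[of ?C])
    fix n
    let ?p = "\<xi> n ^ CARD('n)" and ?l = "\<lambda>k. lpt (\<xi> n) k :: real ^ 'n" and ?Q = "lat_ball (\<xi> n) R :: (int ^ 'n) set"
    define w where "w k = D (\<lambda>x. \<rho> (x - ?l k))" for k
    define f where "f k = (if k \<in> ?Q then \<bar>cell_avg \<sigma> (\<xi> n) k - mollify \<sigma> \<rho> (?l k)\<bar> else 0)" for k
    obtain p where p: "odometer (\<xi> n) R f p" using GDS_odometer[OF \<xi>_pos[of n] R_pos, of f] by blast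
    define e where "e = M * \<xi> n * D \<theta>"
    define m where "m = S * ((\<xi> n + r) * (2 * R + \<xi> 0))"
    have w0: "w k \<ge> 0" for k unfolding w_def by (rule pos[OF test_translate[OF \<rho>(1)]]) (rule \<rho>(2))
    have p0: "p k \<ge> 0" for k using p by (simp add: odometer_def supersol_def)
    have e0: "e \<ge> 0" using M(1) \<xi>_pos[of n] \<Theta> by (simp add: e_def)
    have m0: "m \<ge> 0" using S_nonneg \<xi>_pos[of n] \<xi>_pos[of 0] R_pos r by (simp add: m_def)
    have shell: "u n k \<le> m" if "norm (?l k) \<ge> R - r" for k
      unfolding m_def by (rule u_le_shell[OF that]) (use r in auto)
    \<comment> \<open>Here \<open>w\<close> carries the comparison, \<open>p\<close> pays for the
      discrepancy \<open>f\<close>, the quadratic has Laplacian \<open>- e\<close> and cancels the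
      consistency error, and \<open>m\<close> lifts \<open>s\<close> above \<open>u n\<close> in the
      shell.\<close>
    define s where "s k = (w k + p k) + ((e * ?Y + m) + (- e) * (norm (?l k))\<^sup>2)" for k
    have s_ge: "s k \<ge> w k + p k + m" if "norm (?l k) \<le> R + \<xi> 0" for k
    proof -
      have "(norm (?l k))\<^sup>2 \<le> ?Y" using that by (intro power_mono) auto
      then have "e * (norm (?l k))\<^sup>2 \<le> e * ?Y" using e0 by (rule mult_left_mono)
      then show ?thesis by (simp add: s_def)
    qed
    have s_le: "s k \<le> w k + p k + (e * ?Y + m)" for k using e0 by (simp add: s_def)
    have u_le: "u n k \<le> w k + p k + (e * ?Y + m)" for k
    proof (cases "norm (?l k) < R - r")
      case True
      have "u n k \<le> s k"
      proof (rule odometer_le_inner_supersol[OF \<xi>_pos u_odo _ _ _ True])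
        fix j assume j: "norm (?l j) < R - r"
        then have "norm (?l j) \<le> R + \<xi> 0" using r \<xi>_pos[of 0] by linarith
        then show "0 \<le> s j" using s_ge[of j] w0[of j] p0[of j] m0 by linarith
        have jQ: "j \<in> ?Q" using j r by (simp add: lat_ball_def)
        have 1: "disc_lap (\<xi> n) s j = disc_lap (\<xi> n) w j + disc_lap (\<xi> n) p j - e"
          unfolding s_def disc_lap_add disc_lap_cmult disc_lap_norm_sq[OF \<xi>_pos] disc_lap_const by simp
        have 2: "disc_lap (\<xi> n) w j \<le> - mollify \<sigma> \<rho> (?l j) + e"
          unfolding w_def e_def by (rule mollified_functional_supersol[OF D \<rho>(1,2) r(1,2,4) \<theta> M j])
        have 3: "f j + disc_lap (\<xi> n) p j \<le> 0" using p jQ by (simp add: odometer_def supersol_def)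
        have 4: "f j = \<bar>cell_avg \<sigma> (\<xi> n) j - mollify \<sigma> \<rho> (?l j)\<bar>" using jQ by (simp add: f_def)
        show "cell_avg \<sigma> (\<xi> n) j + disc_lap (\<xi> n) s j \<le> 0" using 1 2 3 4 by linarith
      next
        fix j assume j: "R - r \<le> norm (?l j)" "norm (?l j) < R - r + \<xi> n"
        then have "norm (?l j) \<le> R + \<xi> 0" using r \<xi>_le[of n] by linarith
        then show "u n j \<le> s j" using s_ge[of j] w0[of j] p0[of j] shell[OF j(1)] by linarith
      qed
      then show ?thesis using s_le[of k] by linarith
    next
      case False
      then have "u n k \<le> m" by (intro shell) simp
      moreover have "e * ?Y \<ge> 0" using e0 by simp
      ultimately show ?thesis using w0[of k] p0[of k] by linarith
    qed
    have "pairing n \<phi> \<le> ?p * (\<Sum>k\<in>?Q. w k * \<phi> (?l k) + p k * \<phi> (?l k) + (e * ?Y + m) * \<phi> (?l k))"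
      unfolding pairing_def using \<xi>pow_pos[of n]
    proof (intro mult_left_mono sum_mono)
      fix k
      have "u n k * \<phi> (?l k) \<le> (w k + p k + (e * ?Y + m)) * \<phi> (?l k)" using u_le \<phi>(2) by (rule mult_right_mono)
      then show "u n k * \<phi> (?l k) \<le> w k * \<phi> (?l k) + p k * \<phi> (?l k) + (e * ?Y + m) * \<phi> (?l k)"
        by (simp only: distrib_right)
    qed simp
    also have "\<dots> = ?p * (\<Sum>k\<in>?Q. w k * \<phi> (?l k)) + ?p * (\<Sum>k\<in>?Q. p k * \<phi> (?l k)) + ?p * (\<Sum>k\<in>?Q. (e * ?Y + m) * \<phi> (?l k))"
      by (simp only: sum.distrib distrib_left)
    \<comment> \<open>The three sums are treated separately: \<open>w\<close> through the
      reproduction of \<open>\<phi>\<close> by mollifiers, \<open>p\<close> through its bound in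
      mean, the constants through the volume.\<close>
    also have "\<dots> \<le> (D \<phi> + (L * r + E * \<xi> n * (B + L)) * D \<theta>) + B * ?Y * (?p * (\<Sum>k\<in>?Q. f k)) + ((e * ?Y + m) * B) * vol"
    proof (intro add_mono)
      let ?\<Phi> = "\<lambda>y. \<Sum>k\<in>?Q. (?p * \<phi> (?l k)) * \<rho> (y - ?l k)"
      have "?p * (\<Sum>k\<in>?Q. w k * \<phi> (?l k)) = (\<Sum>k\<in>?Q. (?p * \<phi> (?l k)) * w k)"
        by (simp only: sum_distrib_left mult_ac)
      also have "\<dots> = (\<Sum>k\<in>?Q. D (\<lambda>y. (?p * \<phi> (?l k)) * \<rho> (y - ?l k)))"
        unfolding w_def by (intro sum.cong refl test_functionalD(2)[OF lin _ test_zero, symmetric] test_translate \<rho>(1))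
      also have "\<dots> = D ?\<Phi>"
        by (intro test_functional_sum[OF lin, symmetric] finite_lat_ball \<xi>_pos test_cmult test_translate \<rho>(1))
      also have "\<dots> \<le> D (\<lambda>y. 1 * \<phi> y + (L * r + E * \<xi> n * (B + L)) * \<theta> y)"
      proof (rule test_functional_mono[OF lin pos])
        show "test_fun ?\<Phi>" by (intro test_sum finite_lat_ball \<xi>_pos test_cmult test_translate \<rho>(1))
        show "test_fun (\<lambda>y. 1 * \<phi> y + (L * r + E * \<xi> n * (B + L)) * \<theta> y)" by (rule test_lin[OF \<phi>(1) \<theta>(1)])
        show "?\<Phi> y \<le> 1 * \<phi> y + (L * r + E * \<xi> n * (B + L)) * \<theta> y" for y
          by (rule lattice_mollification_le[OF \<phi>(2-5) \<rho>(2) r(1,2,4) \<theta>(2,3) E])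
      qed
      also have "\<dots> = D \<phi> + (L * r + E * \<xi> n * (B + L)) * D \<theta>"
        by (simp only: test_functionalD(1)[OF lin \<phi>(1) \<theta>(1)])
      finally show "?p * (\<Sum>k\<in>?Q. w k * \<phi> (?l k)) \<le> D \<phi> + (L * r + E * \<xi> n * (B + L)) * D \<theta>" .
    next
      have fn: "0 \<le> f k" for k by (simp add: f_def)
      have "(\<Sum>k\<in>?Q. p k * \<phi> (?l k)) \<le> (\<Sum>k\<in>?Q. p k * B)"
        by (intro sum_mono mult_left_mono p0 \<phi>(3))
      also have "\<dots> = B * (\<Sum>k\<in>?Q. p k)" by (simp only: sum_distrib_left mult.commute)
      also have "\<dots> \<le> B * ((R + \<xi> n)\<^sup>2 * (\<Sum>k\<in>?Q. f k))"
        by (intro mult_left_mono B odometer_sum_le[OF \<xi>_pos R_pos fn _ p]) (simp add: f_def)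
      also have "\<dots> \<le> B * (?Y * (\<Sum>k\<in>?Q. f k))"
        using R_pos \<xi>_pos[of n] \<xi>_le[of n]
        by (intro mult_left_mono mult_right_mono power_mono B sum_nonneg fn) auto
      finally have "?p * (\<Sum>k\<in>?Q. p k * \<phi> (?l k)) \<le> ?p * (B * (?Y * (\<Sum>k\<in>?Q. f k)))"
        using \<xi>pow_pos[of n] by (intro mult_left_mono) auto
      then show "?p * (\<Sum>k\<in>?Q. p k * \<phi> (?l k)) \<le> B * ?Y * (?p * (\<Sum>k\<in>?Q. f k))"
        by (simp only: mult_ac)
    next
      have em: "e * ?Y + m \<ge> 0" using e0 m0 by simp
      show "?p * (\<Sum>k\<in>?Q. (e * ?Y + m) * \<phi> (?l k)) \<le> ((e * ?Y + m) * B) * vol"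
        by (rule lat_sum_le) (use em B \<phi>(3) in \<open>auto intro!: mult_left_mono mult_nonneg_nonneg\<close>)
    qed
    also have "(\<Sum>k\<in>?Q. f k) = (\<Sum>k\<in>?Q. \<bar>cell_avg \<sigma> (\<xi> n) k - mollify \<sigma> \<rho> (?l k)\<bar>)"
      by (rule sum.cong) (auto simp: f_def)
    finally show "pairing n \<phi> \<le> D \<phi> + L * r * D \<theta>
        + B * ?Y * (?p * (\<Sum>k\<in>?Q. \<bar>cell_avg \<sigma> (\<xi> n) k - mollify \<sigma> \<rho> (?l k)\<bar>))
        + S * (2 * R + \<xi> 0) * r * B * vol + ?C * \<xi> n"
      unfolding e_def m_def by (simp only: ring_distribs mult_ac add_ac)
  qed
qed

text \<open>A one-sided estimate along the whole sequence and for every obstacle functional, so that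
  \<open>D\<close> may come from an arbitrary admissible \<open>W\<close> as well as from a cluster
  point.\<close>

lemma eventually_pairing_le:
  assumes D: "obstacle_functional D" and \<phi>: "test_fun \<phi>" "\<And>x. \<phi> x \<ge> 0" and \<delta>: "\<delta> > 0"
  shows "eventually (\<lambda>n. pairing n \<phi> \<le> D \<phi> + \<delta>) sequentially"
proof -
  obtain B where B: "B > 0" "\<And>x. \<bar>\<phi> x\<bar> \<le> B" using test_bounded[OF \<phi>(1)] by metis
  have B': "\<phi> x \<le> B" for x using B(2)[of x] by linarith
  obtain L where L: "L > 0" "\<And>x y. \<bar>\<phi> x - \<phi> y\<bar> \<le> L * norm (x - y)" using test_lipschitz[OF \<phi>(1)] by metis
  obtain \<theta> :: "real ^ 'n \<Rightarrow> real" where \<theta>: "test_fun \<theta>" "\<And>x. \<theta> x \<ge> 0" "\<And>x. norm x \<le> R + 2 + \<xi> 0 \<Longrightarrow> \<theta> x \<ge> 1"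
    using ex_cutoff[of "R + 2 + \<xi> 0"] by blast
  have \<Theta>: "D \<theta> \<ge> 0" using D \<theta> by (simp add: obstacle_functional_def)
  \<comment> \<open>\<open>K\<close> collects the coefficients of the errors proportional to
    \<open>r\<close> or to the mean discrepancy; both quantities will be at most
    \<open>\<eta>\<close>.\<close>
  define K where "K = L * D \<theta> + B * (R + \<xi> 0)\<^sup>2 + S * (2 * R + \<xi> 0) * B * vol"
  have K: "K \<ge> 0" unfolding K_def using L(1) B(1) \<Theta> S_nonneg R_pos \<xi>_pos[of 0] vol_nonneg by simp
  define \<eta> where "\<eta> = min (min 1 R) (\<delta> / (2 * (K + 1)))"
  have \<eta>: "\<eta> > 0" "\<eta> \<le> 1" "\<eta> \<le> R" using \<delta> K R_pos by (auto simp: \<eta>_def)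
  have K\<eta>: "K * \<eta> \<le> \<delta> / 2"
  proof -
    have "K * \<eta> \<le> (K + 1) * (\<delta> / (2 * (K + 1)))" using K \<eta> \<delta> by (intro mult_mono) (auto simp: \<eta>_def)
    also have "\<dots> = \<delta> / 2" using K by (simp add: field_simps)
    finally show ?thesis .
  qed
  obtain \<rho> r where \<rho>: "test_fun \<rho>" "\<And>x. \<rho> x \<ge> 0" "integral\<^sup>L lebesgue \<rho> = 1" and r: "r > 0" "r < \<eta>"
    "\<And>x. norm x \<ge> r \<Longrightarrow> \<rho> x = 0" and \<rho>s: "\<And>x. \<rho> (- x) = \<rho> x" and I: "(LINT x|lebesgue. \<bar>\<sigma> x - mollify \<sigma> \<rho> x\<bar>) < \<eta>"
    using ex_mollifier_L1[OF \<eta>(1)] by blast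
  let ?f = "\<lambda>n k. \<bar>cell_avg \<sigma> (\<xi> n) k - mollify \<sigma> \<rho> (lpt (\<xi> n) k)\<bar>"
  define F where "F n = \<xi> n ^ CARD('n) * (\<Sum>k\<in>lat_ball (\<xi> n) R. ?f n k)" for n
  have r1: "r < 1" "r < R" using r \<eta> by auto
  obtain C where C: "\<And>n. pairing n \<phi> \<le> D \<phi> + L * r * D \<theta> + B * (R + \<xi> 0)\<^sup>2 * F n + S * (2 * R + \<xi> 0) * r * B * vol + C * \<xi> n"
    using pairing_le_functional[OF D \<phi> B' L(2) less_imp_le[OF L(1)] \<rho> \<rho>s r(1) r1 r(3) \<theta>] unfolding F_def by blast
  have "eventually (\<lambda>n. \<xi> n ^ CARD('n) * (\<Sum>k\<in>lat_ball (\<xi> n) (R + r). ?f n k) < \<eta>) sequentially"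
    by (rule order_tendstoD(2)[OF avg_mollify_tendsto[OF \<rho> r(1,3)] I])
  moreover have "(\<lambda>n. C * \<xi> n) \<longlonglongrightarrow> C * 0" by (intro tendsto_intros \<xi>_lim)
  then have "eventually (\<lambda>n. C * \<xi> n < \<delta> / 2) sequentially" using \<delta> by (intro order_tendstoD(2)) auto
  ultimately show ?thesis
  proof eventually_elim
    case (elim n)
    \<comment> \<open>Convergence is known for the ball of radius \<open>R + r\<close>, and the sum
      over the smaller ball is dominated by it.\<close>
    have "(\<Sum>k\<in>lat_ball (\<xi> n) R. ?f n k) \<le> (\<Sum>k\<in>lat_ball (\<xi> n) (R + r). ?f n k)"
      using r(1) by (intro sum_mono2 finite_lat_ball \<xi>_pos) (auto simp: lat_ball_def)
    then have "F n \<le> \<xi> n ^ CARD('n) * (\<Sum>k\<in>lat_ball (\<xi> n) (R + r). ?f n k)"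
      unfolding F_def using \<xi>pow_pos[of n] by (intro mult_left_mono) auto
    then have F: "F n \<le> \<eta>" using elim(1) by linarith
    have "L * r * D \<theta> \<le> L * \<eta> * D \<theta>" using r L(1) \<Theta> by (intro mult_right_mono mult_left_mono) auto
    moreover have "B * (R + \<xi> 0)\<^sup>2 * F n \<le> B * (R + \<xi> 0)\<^sup>2 * \<eta>" using F B(1) by (intro mult_left_mono) auto
    moreover have "S * (2 * R + \<xi> 0) * r * B * vol \<le> S * (2 * R + \<xi> 0) * \<eta> * B * vol"
      using r S_nonneg R_pos \<xi>_pos[of 0] B(1) vol_nonneg by (intro mult_right_mono mult_left_mono) auto
    moreover have "L * \<eta> * D \<theta> + B * (R + \<xi> 0)\<^sup>2 * \<eta> + S * (2 * R + \<xi> 0) * \<eta> * B * vol = K * \<eta>"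
      by (simp add: K_def algebra_simps)
    ultimately show ?case using C[of n] elim(2) K\<eta> by linarith
  qed
qed

end


section \<open>Convergence\<close>

context gds
begin

section \<open>Pairings with the Newtonian potential\<close>

definition potential :: "(real ^ 'n \<Rightarrow> real) \<Rightarrow> real" where
  "potential \<phi> = (LINT x|lebesgue. newton_pot \<sigma> x * \<phi> x)"

lemma potential_integrable:
  assumes "test_fun \<phi>"
  shows "integrable lebesgue (\<lambda>x. newton_pot \<sigma> x * \<phi> x)"
proof -
  obtain B where B: "\<And>x. \<bar>\<phi> x\<bar> \<le> B" using test_bounded[OF assms] by metis
  obtain r where r: "\<And>x. norm x \<ge> r \<Longrightarrow> \<phi> x = 0" using test_fun_support[OF assms] by metis
  show ?thesis
    by (rule newton_pot_pairing(1)[where S = S and s = R and A = B and r = r, OF dim \<sigma>_meas \<sigma>_bound])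
      (simp_all add: \<sigma>_supp test_measurable[OF assms] B r)
qed

lemma potential_lin:
  assumes "test_fun \<phi>" "test_fun \<psi>"
  shows "potential (\<lambda>x. a * \<phi> x + b * \<psi> x) = a * potential \<phi> + b * potential \<psi>"
proof -
  have "potential (\<lambda>x. a * \<phi> x + b * \<psi> x) =
      (LINT x|lebesgue. a * (newton_pot \<sigma> x * \<phi> x) + b * (newton_pot \<sigma> x * \<psi> x))"
    unfolding potential_def by (simp only: distrib_left mult.left_commute)
  also have "\<dots> = a * potential \<phi> + b * potential \<psi>"
    unfolding potential_def
    by (subst Bochner_Integration.integral_add) (simp_all add: potential_integrable assms)
  finally show ?thesis .
qed

lemma potential_lap:
  assumes "test_fun \<phi>"
  shows "potential (lap \<phi>) = - 2 * real CARD('n) * (LINT x|lebesgue. \<sigma> x * \<phi> x)"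
  unfolding potential_def
  by (rule newton_pot_lap[where S = S and s = R, OF dim \<sigma>_meas \<sigma>_bound]) (simp_all add: \<sigma>_supp assms)

text \<open>Comparing \<open>\<phi>\<close> with the indicator of a ball gives a constant that
  depends only on the radius of the support, as an estimate of order zero requires.\<close>

lemma potential_bound:
  obtains C where "C \<ge> 0" "\<And>\<phi> B. test_fun \<phi> \<Longrightarrow> (\<And>x. \<bar>\<phi> x\<bar> \<le> B) \<Longrightarrow> (\<And>x. norm x > r \<Longrightarrow> \<phi> x = 0) \<Longrightarrow>
    \<bar>potential \<phi>\<bar> \<le> C * B"
proof -
  let ?i = "indicator (cball 0 r) :: real ^ 'n \<Rightarrow> real"
  have i: "integrable lebesgue (\<lambda>x. newton_pot \<sigma> x * ?i x)"
    by (rule newton_pot_pairing(1)[where S = S and s = R and A = 1 and r = r, OF dim \<sigma>_meas \<sigma>_bound])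
      (simp_all add: \<sigma>_supp indicator_def)
  let ?C = "LINT x|lebesgue. \<bar>newton_pot \<sigma> x * ?i x\<bar>"
  have "\<bar>potential \<phi>\<bar> \<le> ?C * B"
    if \<phi>: "test_fun \<phi>" and B: "\<And>x. \<bar>\<phi> x\<bar> \<le> B" and r: "\<And>x. norm x > r \<Longrightarrow> \<phi> x = 0" for \<phi> B
  proof -
    have "\<bar>potential \<phi>\<bar> \<le> (LINT x|lebesgue. \<bar>newton_pot \<sigma> x * \<phi> x\<bar>)"
      unfolding potential_def by (rule integral_abs_bound)
    also have "\<dots> \<le> (LINT x|lebesgue. \<bar>newton_pot \<sigma> x * ?i x\<bar> * B)"
    proof (rule integral_mono)
      show "integrable lebesgue (\<lambda>x. \<bar>newton_pot \<sigma> x * \<phi> x\<bar>)" using potential_integrable[OF \<phi>] by (rule integrable_abs)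
      show "integrable lebesgue (\<lambda>x. \<bar>newton_pot \<sigma> x * ?i x\<bar> * B)"
        by (rule integrable_mult_left) (rule integrable_abs[OF i])
      show "\<bar>newton_pot \<sigma> x * \<phi> x\<bar> \<le> \<bar>newton_pot \<sigma> x * ?i x\<bar> * B" for x
      proof (cases "norm x > r")
        case False
        then show ?thesis using mult_left_mono[OF B[of x], of "\<bar>newton_pot \<sigma> x\<bar>"] by (simp add: abs_mult)
      qed (simp add: r)
    qed
    also have "\<dots> = ?C * B" by (rule integral_mult_left_zero)
    finally show ?thesis .
  qed
  then show ?thesis using that[of ?C] by simp
qed

section \<open>Limits of the toppled configurations\<close>

definition nu :: "nat \<Rightarrow> (real ^ 'n \<Rightarrow> real) \<Rightarrow> real" where
  "nu n = lattice_dist (\<xi> n) (GDS (\<xi> n) R (cell_avg \<sigma> (\<xi> n)))"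

lemma GDS_eq: "GDS (\<xi> n) R (cell_avg \<sigma> (\<xi> n)) = (\<lambda>k. cell_avg \<sigma> (\<xi> n) k + disc_lap (\<xi> n) (u n) k)"
proof -
  obtain v where v: "odometer (\<xi> n) R (cell_avg \<sigma> (\<xi> n)) v"
    "GDS (\<xi> n) R (cell_avg \<sigma> (\<xi> n)) = (\<lambda>k. cell_avg \<sigma> (\<xi> n) k + disc_lap (\<xi> n) v k)"
    using GDS_odometer[OF \<xi>_pos R_pos] by metis
  then show ?thesis using odometer_unique[OF u_odo v(1)] by simp
qed

lemma nu_eq:
  assumes "test_fun \<phi>"
  shows "nu n \<phi> = \<xi> n ^ CARD('n) * (\<Sum>k\<in>lat_ball (\<xi> n) R. cell_avg \<sigma> (\<xi> n) k * \<phi> (lpt (\<xi> n) k))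
    + pairing n (dlap (\<xi> n) \<phi>)"
proof -
  let ?Q = "lat_ball (\<xi> n) R :: (int ^ 'n) set" and ?l = "\<lambda>k. lpt (\<xi> n) k :: real ^ 'n"
  let ?\<tau> = "cell_avg \<sigma> (\<xi> n)"
  \<comment> \<open>Mass toppled out of the ball rests on the adjacent layer, so the configuration
    may be nonzero there.\<close>
  define B where "B = ?Q \<union> (\<Union>k\<in>?Q. nbrs k)"
  have fB: "finite B" unfolding B_def using finite_lat_ball[OF \<xi>_pos] by auto
  have lap0: "disc_lap (\<xi> n) (u n) k = 0" if "k \<notin> B" for k
  proof -
    have "disc_lap (\<xi> n) (u n) k = disc_lap (\<xi> n) (\<lambda>_. 0) k"
    proof (rule disc_lap_cong_at)
      show "u n k = 0" using that by (intro u_zero) (simp add: B_def)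
      fix j assume "j \<in> nbrs k"
      then have "k \<in> nbrs j" by (simp only: nbrs_sym[of k j])
      then show "u n j = 0" using that by (intro u_zero) (auto simp: B_def)
    qed
    then show ?thesis by simp
  qed
  have z: "?\<tau> k + disc_lap (\<xi> n) (u n) k = 0" if "k \<notin> B" for k
    using that lap0 avg_supp[of k n] by (auto simp: B_def)
  have "(\<Sum>k | ?\<tau> k + disc_lap (\<xi> n) (u n) k \<noteq> 0. (?\<tau> k + disc_lap (\<xi> n) (u n) k) * \<phi> (?l k)) =
      (\<Sum>k\<in>B. (?\<tau> k + disc_lap (\<xi> n) (u n) k) * \<phi> (?l k))"
    using fB z by (intro sum.mono_neutral_left) auto
  also have "\<dots> = (\<Sum>k\<in>B. ?\<tau> k * \<phi> (?l k)) + (\<Sum>k\<in>B. disc_lap (\<xi> n) (u n) k * \<phi> (?l k))"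
    by (simp only: distrib_right sum.distrib)
  also have "(\<Sum>k\<in>B. ?\<tau> k * \<phi> (?l k)) = (\<Sum>k\<in>?Q. ?\<tau> k * \<phi> (?l k))"
    using fB avg_supp by (intro sum.mono_neutral_right) (auto simp: B_def)
  also have "(\<Sum>k\<in>B. disc_lap (\<xi> n) (u n) k * \<phi> (?l k)) = (\<Sum>k\<in>B. u n k * disc_lap (\<xi> n) (\<lambda>k. \<phi> (?l k)) k)"
  proof (rule disc_lap_by_parts[OF fB, symmetric])
    fix k assume "u n k \<noteq> 0"
    then have "k \<in> ?Q" using u_zero by blast
    then show "insert k (nbrs k) \<subseteq> B" by (auto simp: B_def)
  qed
  also have "\<dots> = (\<Sum>k\<in>?Q. u n k * dlap (\<xi> n) \<phi> (?l k))"
    unfolding disc_lap_lpt using fB u_zero by (intro sum.mono_neutral_right) (auto simp: B_def)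
  finally show ?thesis
    using assms by (simp only: nu_def lattice_dist_def if_True GDS_eq pairing_def distrib_left)
qed

text \<open>Positive mass can remain only outside the ball, where \<open>\<phi>\<close>
  vanishes.\<close>

lemma nu_nonpos:
  assumes \<phi>: "test_fun \<phi>" "\<And>x. \<phi> x \<ge> 0" "closure {x. \<phi> x \<noteq> 0} \<subseteq> ball 0 R"
  shows "nu n \<phi> \<le> 0"
proof -
  have "(cell_avg \<sigma> (\<xi> n) k + disc_lap (\<xi> n) (u n) k) * \<phi> (lpt (\<xi> n) k) \<le> 0" for k
  proof (cases "k \<in> lat_ball (\<xi> n) R")
    case True
    then show ?thesis using u_supersol[OF True] \<phi>(2) by (simp add: mult_nonpos_nonneg)
  next
    case False
    then have "lpt (\<xi> n) k \<notin> ball 0 R" by (simp add: lat_ball_def)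
    then have "\<phi> (lpt (\<xi> n) k) = 0" using \<phi>(3) closure_subset[of "{x. \<phi> x \<noteq> 0}"] by (meson mem_Collect_eq subset_iff)
    then show ?thesis by simp
  qed
  then have "(\<Sum>k | cell_avg \<sigma> (\<xi> n) k + disc_lap (\<xi> n) (u n) k \<noteq> 0.
      (cell_avg \<sigma> (\<xi> n) k + disc_lap (\<xi> n) (u n) k) * \<phi> (lpt (\<xi> n) k)) \<le> 0"
    by (rule sum_nonpos)
  then show ?thesis
    unfolding nu_def lattice_dist_def GDS_eq if_P[OF \<phi>(1)]
    by (rule mult_nonneg_nonpos[OF less_imp_le[OF \<xi>pow_pos]])
qed

text \<open>Stated along a filter so that it serves both cluster points and the full sequence. By
  summation by parts the Laplacian falls on \<open>\<phi>\<close>, where its consistency error is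
  uniform.\<close>

lemma nu_tendsto:
  assumes \<phi>: "test_fun \<phi>" and G: "G \<le> sequentially" and lim: "((\<lambda>n. pairing n (lap \<phi>)) \<longlongrightarrow> l) G"
  shows "((\<lambda>n. nu n \<phi>) \<longlongrightarrow> (LINT x|lebesgue. \<sigma> x * \<phi> x) + l / (2 * real CARD('n))) G"
proof -
  let ?c = "1 / (2 * real CARD('n))" and ?M = "S * (R + \<xi> 0)\<^sup>2"
  obtain L where L: "L > 0" "\<And>x h. h > 0 \<Longrightarrow> \<bar>dlap h \<phi> x - lap \<phi> x / (2 * real CARD('n))\<bar> \<le> L * h"
    using dlap_consistent[OF \<phi>] by blast
  have bd: "\<bar>pairing n (dlap (\<xi> n) \<phi>) - ?c * pairing n (lap \<phi>)\<bar> \<le> ?M * (L * \<xi> n) * vol" for n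
  proof -
    have "pairing n (dlap (\<xi> n) \<phi>) - ?c * pairing n (lap \<phi>) = pairing n (\<lambda>x. 1 * dlap (\<xi> n) \<phi> x + (- ?c) * lap \<phi> x)"
      by (simp only: pairing_lin)
    also have "\<bar>\<dots>\<bar> \<le> ?M * (L * \<xi> n) * vol"
      by (rule pairing_bound) (use L(2)[OF \<xi>_pos[of n]] in simp)
    finally show ?thesis .
  qed
  have "(\<lambda>n. ?M * (L * \<xi> n) * vol) \<longlonglongrightarrow> ?M * (L * 0) * vol" by (intro tendsto_intros \<xi>_lim)
  then have bd0: "(\<lambda>n. ?M * (L * \<xi> n) * vol) \<longlonglongrightarrow> 0" by (simp only: mult_zero_right mult_zero_left)
  have "(\<lambda>n. pairing n (dlap (\<xi> n) \<phi>) - ?c * pairing n (lap \<phi>)) \<longlonglongrightarrow> 0"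
  proof (rule Lim_null_comparison[OF always_eventually bd0], rule allI)
    show "norm (pairing n (dlap (\<xi> n) \<phi>) - ?c * pairing n (lap \<phi>)) \<le> ?M * (L * \<xi> n) * vol" for n
      unfolding real_norm_def by (rule bd)
  qed
  then have "((\<lambda>n. pairing n (dlap (\<xi> n) \<phi>) - ?c * pairing n (lap \<phi>)) \<longlongrightarrow> 0) G"
    by (rule tendsto_mono[OF G])
  from tendsto_add[OF this tendsto_mult[OF tendsto_const[of ?c] lim]]
  have "((\<lambda>n. pairing n (dlap (\<xi> n) \<phi>)) \<longlongrightarrow> l / (2 * real CARD('n))) G" by simp
  from tendsto_add[OF tendsto_mono[OF G avg_pairing_tendsto[OF \<phi>]] this]
  show ?thesis by (simp only: nu_eq[OF \<phi>])
qed

text \<open>The filter \<open>F\<close> is kept general: it is \<open>sequentially\<close> at first,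
  and later it is concentrated on indices that violate convergence. The inequalities are closed
  conditions and pass to the limit; the uniform bound on the odometers survives as an estimate of
  \<open>D\<close> in the supremum norm.\<close>

lemma cluster_functional:
  assumes F: "F \<noteq> bot" "F \<le> sequentially"
  obtains G D where "G \<noteq> bot" "G \<le> F" "\<And>\<phi>. test_fun \<phi> \<Longrightarrow> ((\<lambda>n. pairing n \<phi>) \<longlongrightarrow> D \<phi>) G" "obstacle_functional D"
    "\<And>\<phi> B. test_fun \<phi> \<Longrightarrow> (\<And>x. \<bar>\<phi> x\<bar> \<le> B) \<Longrightarrow> \<bar>D \<phi>\<bar> \<le> S * (R + \<xi> 0)\<^sup>2 * B * vol"
proof -
  \<comment> \<open>The value \<open>0\<close> off the test functions makes every coordinate of the
    product bounded.\<close>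
  define a where "a n \<phi> = (if test_fun \<phi> then pairing n \<phi> else 0)" for n \<phi>
  have "\<exists>b. \<forall>n. \<bar>a n \<phi>\<bar> \<le> b" for \<phi>
  proof (cases "test_fun \<phi>")
    case True
    obtain B where "\<And>x. \<bar>\<phi> x\<bar> \<le> B" using test_bounded[OF True] by metis
    then have "\<forall>n. \<bar>a n \<phi>\<bar> \<le> S * (R + \<xi> 0)\<^sup>2 * B * vol"
      using True by (auto simp: a_def intro!: pairing_bound)
    then show ?thesis by (rule exI)
  qed (auto simp: a_def)
  then obtain b where b: "\<And>n \<phi>. \<bar>a n \<phi>\<bar> \<le> b \<phi>" by metis
  obtain G D where G: "G \<noteq> bot" "G \<le> F" and lim: "\<And>\<phi>. ((\<lambda>n. a n \<phi>) \<longlongrightarrow> D \<phi>) G"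
    using pointwise_cluster[where a = a and B = b, OF b F(1)] by blast
  have lim': "((\<lambda>n. pairing n \<phi>) \<longlongrightarrow> D \<phi>) G" if "test_fun \<phi>" for \<phi>
    using lim[of \<phi>] that by (simp add: a_def)
  have GS: "G \<le> sequentially" using G(2) F(2) by (rule order_trans)
  have "test_functional D"
    unfolding test_functional_def
  proof (intro allI impI)
    fix \<phi> \<psi> :: "real ^ 'n \<Rightarrow> real" and a b assume t: "test_fun \<phi>" "test_fun \<psi>"
    have "((\<lambda>n. pairing n (\<lambda>x. a * \<phi> x + b * \<psi> x)) \<longlongrightarrow> a * D \<phi> + b * D \<psi>) G"
      unfolding pairing_lin by (intro tendsto_intros lim' t)
    then show "D (\<lambda>x. a * \<phi> x + b * \<psi> x) = a * D \<phi> + b * D \<psi>"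
      using tendsto_unique[OF G(1) lim'[OF test_lin[OF t]]] by blast
  qed
  moreover have "0 \<le> D \<phi>" if t: "test_fun \<phi>" and "\<forall>x. \<phi> x \<ge> 0" for \<phi>
    by (rule tendsto_lowerbound[OF lim'[OF t] _ G(1)]) (use that in \<open>auto intro!: always_eventually pairing_nonneg\<close>)
  moreover have "D (lap \<phi>) \<le> - 2 * real CARD('n) * (LINT x|lebesgue. \<sigma> x * \<phi> x)"
    if t: "test_fun \<phi>" and p: "\<forall>x. \<phi> x \<ge> 0" "closure {x. \<phi> x \<noteq> 0} \<subseteq> ball 0 R" for \<phi>
  proof -
    have "(LINT x|lebesgue. \<sigma> x * \<phi> x) + D (lap \<phi>) / (2 * real CARD('n)) \<le> 0"
      by (rule tendsto_upperbound[OF nu_tendsto[OF t GS lim'[OF test_lap[OF t]]] _ G(1)])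
        (use t p in \<open>auto intro!: always_eventually nu_nonpos\<close>)
    then have "D (lap \<phi>) / (2 * real CARD('n)) \<le> - (LINT x|lebesgue. \<sigma> x * \<phi> x)" by linarith
    then have "D (lap \<phi>) \<le> - (LINT x|lebesgue. \<sigma> x * \<phi> x) * (2 * real CARD('n))"
      by (subst (asm) pos_divide_le_eq) auto
    then show ?thesis by (simp add: mult_ac)
  qed
  ultimately have "obstacle_functional D" unfolding obstacle_functional_def by blast
  moreover have "\<bar>D \<phi>\<bar> \<le> S * (R + \<xi> 0)\<^sup>2 * B * vol" if t: "test_fun \<phi>" and B: "\<And>x. \<bar>\<phi> x\<bar> \<le> B" for \<phi> B
    by (rule tendsto_upperbound[OF tendsto_rabs[OF lim'[OF t]] _ G(1)])
      (intro always_eventually allI pairing_bound B)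
  ultimately show ?thesis using that G lim' by blast
qed

text \<open>The value \<open>0\<close> off the test functions is demanded by
  \<open>is_distribution\<close>. Both parts are bounded by the supremum norm on functions supported
  in \<open>K\<close>, so \<open>N = 0\<close> works and the sum has the single term for the empty
  list.\<close>

lemma Vset_of_obstacle_functional:
  assumes D: "obstacle_functional D"
    and b: "\<And>\<phi> B. test_fun \<phi> \<Longrightarrow> (\<And>x. \<bar>\<phi> x\<bar> \<le> B) \<Longrightarrow> \<bar>D \<phi>\<bar> \<le> M * B" "M \<ge> 0"
  shows "(\<lambda>\<phi>. if test_fun \<phi> then potential \<phi> - D \<phi> else 0) \<in> Vset \<sigma> R"
proof -
  let ?V = "\<lambda>\<phi>. if test_fun \<phi> then potential \<phi> - D \<phi> else 0"
  have lin: "test_functional D" using D by (simp add: obstacle_functional_def)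
  have "is_distribution ?V"
    unfolding is_distribution_def
  proof (intro conjI allI impI)
    fix \<phi> \<psi> :: "real ^ 'n \<Rightarrow> real" and a b assume t: "test_fun \<phi> \<and> test_fun \<psi>"
    then show "?V (\<lambda>x. a * \<phi> x + b * \<psi> x) = a * ?V \<phi> + b * ?V \<psi>"
      by (simp add: test_lin potential_lin test_functionalD(1)[OF lin] algebra_simps)
  next
    fix K :: "(real ^ 'n) set" assume "compact K"
    then obtain r where r: "\<And>x. x \<in> K \<Longrightarrow> norm x \<le> r" using compact_imp_bounded bounded_iff by metis
    obtain C where C: "C \<ge> 0" "\<And>\<phi> B. test_fun \<phi> \<Longrightarrow> (\<And>x. \<bar>\<phi> x\<bar> \<le> B) \<Longrightarrow> (\<And>x. norm x > r \<Longrightarrow> \<phi> x = 0) \<Longrightarrow>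
      \<bar>potential \<phi>\<bar> \<le> C * B" using potential_bound[of r] by blast
    have "\<bar>?V \<phi>\<bar> \<le> (C + M) * (\<Sum>is\<in>{is. length is \<le> 0}. SUP x. \<bar>iterpd is \<phi> x\<bar>)"
      if "test_fun \<phi> \<and> closure {x. \<phi> x \<noteq> 0} \<subseteq> K" for \<phi>
    proof -
      have t: "test_fun \<phi>" using that by blast
      let ?B = "SUP x. \<bar>\<phi> x\<bar>"
      obtain B0 where B0: "\<And>x. \<bar>\<phi> x\<bar> \<le> B0" using test_bounded[OF t] by metis
      have "bdd_above (range (\<lambda>x. \<bar>\<phi> x\<bar>))" by (rule bdd_aboveI2[where M = B0]) (rule B0)
      then have B: "\<bar>\<phi> x\<bar> \<le> ?B" for x by (rule cSUP_upper[rotated]) simp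
      have z: "\<phi> x = 0" if "norm x > r" for x
        using that r[of x] \<open>test_fun \<phi> \<and> _\<close> closure_subset[of "{x. \<phi> x \<noteq> 0}"] by force
      have "\<bar>potential \<phi>\<bar> \<le> C * ?B" by (rule C(2)[OF t B z])
      moreover have "\<bar>D \<phi>\<bar> \<le> M * ?B" by (rule b(1)[OF t B])
      ultimately have "\<bar>?V \<phi>\<bar> \<le> (C + M) * ?B" using t by (simp add: distrib_right)
      moreover have "{is :: 'n list. length is \<le> 0} = {[]}" by auto
      ultimately show ?thesis by simp
    qed
    then show "\<exists>C N. \<forall>\<phi>. test_fun \<phi> \<and> closure {x. \<phi> x \<noteq> 0} \<subseteq> K \<longrightarrow>
      \<bar>?V \<phi>\<bar> \<le> C * (\<Sum>is\<in>{is. length is \<le> N}. SUP x. \<bar>iterpd is \<phi> x\<bar>)" by blast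
  qed simp
  moreover have "dist_le ?V (fdist (newton_pot \<sigma>))"
    using D by (auto simp: dist_le_def fdist_def obstacle_functional_def potential_def)
  moreover have "?V (lap \<phi>) \<ge> 0"
    if "test_fun \<phi>" "\<forall>x. \<phi> x \<ge> 0" "closure {x. \<phi> x \<noteq> 0} \<subseteq> ball 0 R" for \<phi>
    using D that by (simp add: test_lap potential_lap obstacle_functional_def)
  ultimately show ?thesis by (simp add: Vset_def)
qed

text \<open>The reverse passage, which makes \<open>eventually_pairing_le\<close> applicable to
  every element of \<open>Vset\<close>; the last inequality comes from
  \<open>potential_lap\<close>.\<close>

lemma obstacle_functional_of_Vset:
  assumes W: "W \<in> Vset \<sigma> R"
  shows "obstacle_functional (\<lambda>\<phi>. potential \<phi> - W \<phi>)"
proof -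
  have dist: "is_distribution W" and le: "dist_le W (fdist (newton_pot \<sigma>))"
    and lap: "\<And>\<phi>. test_fun \<phi> \<and> (\<forall>x. \<phi> x \<ge> 0) \<and> closure {x. \<phi> x \<noteq> 0} \<subseteq> ball 0 R \<Longrightarrow> W (lap \<phi>) \<ge> 0"
    using W by (auto simp: Vset_def)
  have "W (\<lambda>x. a * \<phi> x + b * \<psi> x) = a * W \<phi> + b * W \<psi>" if "test_fun \<phi>" "test_fun \<psi>" for \<phi> \<psi> a b
    using dist that by (simp add: is_distribution_def)
  then have "test_functional (\<lambda>\<phi>. potential \<phi> - W \<phi>)"
    by (simp add: test_functional_def potential_lin algebra_simps)
  moreover have "0 \<le> potential \<phi> - W \<phi>" if "test_fun \<phi>" "\<forall>x. \<phi> x \<ge> 0" for \<phi>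
    using le that by (simp add: dist_le_def fdist_def potential_def)
  moreover have "potential (lap \<phi>) - W (lap \<phi>) \<le> - 2 * real CARD('n) * (LINT x|lebesgue. \<sigma> x * \<phi> x)"
    if "test_fun \<phi> \<and> (\<forall>x. \<phi> x \<ge> 0) \<and> closure {x. \<phi> x \<noteq> 0} \<subseteq> ball 0 R" for \<phi>
    using lap[OF that] potential_lap[of \<phi>] that by simp
  ultimately show ?thesis by (simp add: obstacle_functional_def)
qed

text \<open>The comparison holds for the whole sequence and also applies to the cluster functionals
  themselves; this forces convergence.\<close>

lemma nu_tendsto_Bal:
  assumes \<phi>: "test_fun \<phi>"
  shows "(\<lambda>n. nu n \<phi>) \<longlonglongrightarrow> Bal R \<sigma> \<phi>"
proof -
  define M where "M = S * (R + \<xi> 0)\<^sup>2 * vol"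
  have M: "M \<ge> 0" using S_nonneg vol_nonneg by (simp add: M_def)
  obtain G D where G: "G \<noteq> bot" "G \<le> sequentially" and lim: "\<And>\<phi>. test_fun \<phi> \<Longrightarrow> ((\<lambda>n. pairing n \<phi>) \<longlongrightarrow> D \<phi>) G"
    and D: "obstacle_functional D"
    and Db: "\<And>\<phi> B. test_fun \<phi> \<Longrightarrow> (\<And>x. \<bar>\<phi> x\<bar> \<le> B) \<Longrightarrow> \<bar>D \<phi>\<bar> \<le> S * (R + \<xi> 0)\<^sup>2 * B * vol"
    using cluster_functional[OF sequentially_bot order_refl] by blast
  have lin: "test_functional D" using D by (simp add: obstacle_functional_def)
  \<comment> \<open>\<open>D\<close> is least among all obstacle functionals, since the comparison
    for the sequence survives the limit along \<open>G\<close>.\<close>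
  have le_any: "D \<phi> \<le> D' \<phi>" if D': "obstacle_functional D'" and t: "test_fun \<phi>" "\<And>x. \<phi> x \<ge> 0" for D' \<phi>
  proof (rule field_le_epsilon)
    fix e :: real assume e: "e > 0"
    have "eventually (\<lambda>n. pairing n \<phi> \<le> D' \<phi> + e) G"
      using eventually_pairing_le[OF D' t e] G(2) by (rule filter_leD[rotated])
    then show "D \<phi> \<le> D' \<phi> + e" by (rule tendsto_upperbound[OF lim[OF t(1)] _ G(1)])
  qed
  have pos_lim: "(\<lambda>n. pairing n \<phi>) \<longlonglongrightarrow> D \<phi>" if t: "test_fun \<phi>" "\<And>x. \<phi> x \<ge> 0" for \<phi>
  proof (rule order_tendstoI)
    fix a assume "D \<phi> < a"
    then have "eventually (\<lambda>n. pairing n \<phi> \<le> D \<phi> + (a - D \<phi>) / 2) sequentially"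
      by (intro eventually_pairing_le[OF D t]) simp
    then show "eventually (\<lambda>n. pairing n \<phi> < a) sequentially"
      by eventually_elim (use \<open>D \<phi> < a\<close> in \<open>simp add: field_simps\<close>)
  next
    fix a assume a: "a < D \<phi>"
    show "eventually (\<lambda>n. a < pairing n \<phi>) sequentially"
    proof (rule ccontr)
      \<comment> \<open>\<open>F\<close> is concentrated on the indices where convergence from below
        fails; a cluster functional along it would lie strictly below \<open>D\<close> at
        \<open>\<phi>\<close>, against the minimality of \<open>D\<close>.\<close>
      define F where "F = inf sequentially (principal {n. \<not> a < pairing n \<phi>})"
      assume "\<not> ?thesis"
      then have "F \<noteq> bot"
        unfolding F_def trivial_limit_def eventually_inf_principal by simp
      moreover have "F \<le> sequentially" by (simp add: F_def)
      ultimately obtain G' D' where G': "G' \<noteq> bot" "G' \<le> F" and lim': "\<And>\<phi>. test_fun \<phi> \<Longrightarrow> ((\<lambda>n. pairing n \<phi>) \<longlongrightarrow> D' \<phi>) G'"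
        and D': "obstacle_functional D'"
        using cluster_functional by metis
      have "eventually (\<lambda>n. pairing n \<phi> \<le> a) F"
        unfolding F_def eventually_inf_principal by simp
      then have "eventually (\<lambda>n. pairing n \<phi> \<le> a) G'" using G'(2) by (rule filter_leD[rotated])
      then have "D' \<phi> \<le> a" by (rule tendsto_upperbound[OF lim'[OF t(1)] _ G'(1)])
      then show False using le_any[OF D' t] a by linarith
    qed
  qed
  have all_lim: "(\<lambda>n. pairing n \<psi>) \<longlonglongrightarrow> D \<psi>" if t: "test_fun \<psi>" for \<psi>
  proof -
    obtain B where B: "B > 0" "\<And>x. \<bar>\<psi> x\<bar> \<le> B" using test_bounded[OF t] by metis
    obtain r where r: "\<And>x. norm x \<ge> r \<Longrightarrow> \<psi> x = 0" using test_fun_support[OF t] by metis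
    obtain \<theta> :: "real ^ 'n \<Rightarrow> real" where \<theta>: "test_fun \<theta>" "\<And>x. \<theta> x \<ge> 0" "\<And>x. norm x \<le> r \<Longrightarrow> \<theta> x \<ge> 1"
      using ex_cutoff[of r] by blast
    \<comment> \<open>Adding \<open>B * \<theta>\<close> makes \<open>\<psi>\<close> nonnegative,
      which exhibits \<open>\<psi>\<close> as a difference of two nonnegative test
      functions.\<close>
    let ?\<psi> = "\<lambda>x. 1 * \<psi> x + B * \<theta> x"
    have tp: "test_fun ?\<psi>" by (rule test_lin[OF t \<theta>(1)])
    have "?\<psi> x \<ge> 0" for x
    proof (cases "norm x \<le> r")
      case True
      then have "B * 1 \<le> B * \<theta> x" using \<theta>(3) B(1) by (intro mult_left_mono) auto
      then show ?thesis using B(2)[of x] by simp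
    qed (use r \<theta>(2) B(1) in simp)
    then have "(\<lambda>n. pairing n ?\<psi> - B * pairing n \<theta>) \<longlonglongrightarrow> D ?\<psi> - B * D \<theta>"
      by (intro tendsto_intros pos_lim tp \<theta>)
    moreover have "pairing n ?\<psi> - B * pairing n \<theta> = pairing n \<psi>" for n
      unfolding pairing_lin by simp
    moreover have "D ?\<psi> - B * D \<theta> = D \<psi>"
      unfolding test_functionalD(1)[OF lin t \<theta>(1)] by simp
    ultimately show ?thesis by (simp only:)
  qed
  define V where "V \<phi> = (if test_fun \<phi> then potential \<phi> - D \<phi> else 0)" for \<phi>
  have V: "V \<in> Vset \<sigma> R"
    unfolding V_def[abs_def]
    by (rule Vset_of_obstacle_functional[OF D _ M]) (use Db in \<open>simp add: M_def mult_ac\<close>)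
  have Vmax: "dist_le W V" if "W \<in> Vset \<sigma> R" for W
    using le_any[OF obstacle_functional_of_Vset[OF that]] by (force simp: dist_le_def V_def)
  have "Vmax \<sigma> R = V"
    unfolding Vmax_def
  proof (rule the_equality)
    show "V \<in> Vset \<sigma> R \<and> (\<forall>W\<in>Vset \<sigma> R. dist_le W V)" using V Vmax by blast
    fix W assume W: "W \<in> Vset \<sigma> R \<and> (\<forall>W'\<in>Vset \<sigma> R. dist_le W' W)"
    \<comment> \<open>Two largest elements agree on nonnegative test functions; the decomposition
      used for \<open>all_lim\<close> then extends this to all test functions.\<close>
    have eq: "W \<psi> = V \<psi>" if "test_fun \<psi>" "\<And>x. \<psi> x \<ge> 0" for \<psi>
      using W V Vmax[of W] that unfolding dist_le_def by (meson antisym)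
    show "W = V"
    proof
      fix \<psi> :: "real ^ 'n \<Rightarrow> real"
      show "W \<psi> = V \<psi>"
      proof (cases "test_fun \<psi>")
        case False
        then show ?thesis using W V by (simp add: Vset_def is_distribution_def)
      next
        case t: True
        obtain B where B: "B > 0" "\<And>x. \<bar>\<psi> x\<bar> \<le> B" using test_bounded[OF t] by metis
        obtain r where r: "\<And>x. norm x \<ge> r \<Longrightarrow> \<psi> x = 0" using test_fun_support[OF t] by metis
        obtain \<theta> :: "real ^ 'n \<Rightarrow> real" where \<theta>: "test_fun \<theta>" "\<And>x. \<theta> x \<ge> 0" "\<And>x. norm x \<le> r \<Longrightarrow> \<theta> x \<ge> 1"
          using ex_cutoff[of r] by blast
        let ?\<psi> = "\<lambda>x. 1 * \<psi> x + B * \<theta> x"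
        have "?\<psi> x \<ge> 0" for x
        proof (cases "norm x \<le> r")
          case True
          then have "B * 1 \<le> B * \<theta> x" using \<theta>(3) B(1) by (intro mult_left_mono) auto
          then show ?thesis using B(2)[of x] by simp
        qed (use r \<theta>(2) B(1) in simp)
        then have "W ?\<psi> = V ?\<psi>" by (rule eq[OF test_lin[OF t \<theta>(1)]])
        moreover have "W ?\<psi> = 1 * W \<psi> + B * W \<theta>" using W t \<theta>(1) unfolding Vset_def is_distribution_def by blast
        moreover have "V ?\<psi> = 1 * V \<psi> + B * V \<theta>" using V t \<theta>(1) unfolding Vset_def is_distribution_def by blast
        ultimately show ?thesis using eq[OF \<theta>(1,2)] by simp
      qed
    qed
  qed
  \<comment> \<open>By \<open>potential_lap\<close> the potential contributes the density itself,
    and what is left is precisely the limit given by \<open>nu_tendsto\<close>.\<close>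
  then have "Bal R \<sigma> \<phi> = (LINT x|lebesgue. \<sigma> x * \<phi> x) + D (lap \<phi>) / (2 * real CARD('n))"
    using \<phi> by (simp add: Bal_def V_def test_lap potential_lap field_simps)
  then show ?thesis using nu_tendsto[OF \<phi> order_refl all_lim[OF test_lap[OF \<phi>]]] by simp
qed

end

theorem theorem3p5:
  fixes \<sigma> :: "real ^ 'n \<Rightarrow> real" and \<xi> :: "nat \<Rightarrow> real" and R :: real
  assumes "CARD('n) \<ge> 2"
    and "bounded (range \<sigma>)"
    and "AE x in lebesgue. isCont \<sigma> x"
    and "compact (closure {x. \<sigma> x \<noteq> 0})"
    and "integral\<^sup>L lebesgue \<sigma> < 0"
    and "\<forall>n. \<xi> n > 0" and "decseq \<xi>" and "\<xi> \<longlonglongrightarrow> 0"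
    and "R > 0"
    and "closure {x. \<sigma> x \<noteq> 0} \<subseteq> ball 0 R"
    and "\<forall>n k. cell_avg \<sigma> (\<xi> n) k \<noteq> 0 \<longrightarrow> lpt (\<xi> n) k \<in> ball 0 R"
  shows "dist_tendsto (\<lambda>n. lattice_dist (\<xi> n) (GDS (\<xi> n) R (cell_avg \<sigma> (\<xi> n)))) (Bal R \<sigma>)"
proof -
  obtain S where S: "\<And>x. \<bar>\<sigma> x\<bar> \<le> S" using assms(2) by (auto simp: bounded_iff)
  have "\<exists>v. odometer (\<xi> n) R (cell_avg \<sigma> (\<xi> n)) v" for n
    using GDS_odometer[of "\<xi> n" R "cell_avg \<sigma> (\<xi> n)"] assms(6,9) by metis
  then obtain u where u: "\<And>n. odometer (\<xi> n) R (cell_avg \<sigma> (\<xi> n)) (u n)" by metis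
  interpret gds \<sigma> \<xi> R S u
  proof unfold_locales
    show "\<sigma> \<in> borel_measurable lebesgue" by (rule AE_isCont_measurable[OF assms(3)])
    show "\<sigma> x = 0" if "norm x > R" for x
      using that assms(10) closure_subset[of "{x. \<sigma> x \<noteq> 0}"] by force
    show "cell_avg \<sigma> (\<xi> n) k = 0" if "k \<notin> lat_ball (\<xi> n) R" for n k
      using that assms(11) by (force simp: lat_ball_def)
  qed (use assms S u in auto)
  show ?thesis unfolding dist_tendsto_def using nu_tendsto_Bal by (simp add: nu_def)
qed

end
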